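(* Let $k\ge2$ and $p_1\ge p_2\ge\cdots\ge p_k>0$ with $\sum_{l=1}^kp_l\le1$. Let $\mathcal V=\{\mathcal V_{m,n}\}_{m,n\in\mathbb N}$ be the covariance of the Gaussian sequence $\xi=\{\xi_n\}_{n\in\mathbb N}$ defined by $\xi_1=g_1$, $\xi_n=\sum_{l=1}^kp_l\xi_{n-l}+g_n$ for $n\ge2$, where $\xi_i=0$ for all $i\le0$ and $g_1,g_2,\dots$ are independent standard normal random variables. Let $\mathcal Y$ be the Markov chain on $\mathbb N$ with potential density $\mathcal V$ and let $f$ be a finite excessive function for $\mathcal Y$. For $\alpha>0$ let $\widetilde{\mathcal Y}_\alpha=\{\widetilde{\mathcal Y}_{\alpha,j}\}_{j\in\mathbb N}$ be an $\alpha$-permanental sequence with kernel $\widetilde{\mathcal V}_{j,k}=\mathcal V_{j,k}+f_k$, $j,k\in\mathbb N$. (i) If $\sum_{j=1}^kp_j<1$ and $f\in c_0^+$, then $$\limsup_{j\to\infty}\frac{\widetilde{\mathcal Y}_{\alpha,j}}{\log j}=c^*\quad\text{a.s.},\qquad\forall\,\alpha>0,$$ for some constant $c^*$ with $$1+p_1^2\le c^*\le\frac1{1-\big(\sum_{l=1}^kp_l\big)^2}.$$ The precise value of $c^*$ is $$c^*=\sum_{l,l'=1}^{k'}\sum_{j=1}^{d_l}\sum_{j'=1}^{d_{l'}}B_j(q_l)B_{j'}(q_{l'})F_{j,j'}(q_lq_{l'}),$$ with the notation given in the context. (ii) If $\sum_{j=1}^kp_j=1$ and in addition $f=\mathcal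 Vh$ where $h\in\ell_1^+$, then $$\limsup_{j\to\infty}\frac{\widetilde{\mathcal Y}_{\alpha,j}}{j\log\log j}=\frac1{\big(\sum_{l=1}^klp_l\big)^2}\quad\text{a.s.},\qquad\forall\,\alpha\ge1/2.$$ Furthermore, when $\sum_{j=1}^kp_j<1$, the conditions "$f\in c_0^+$" and "$f=\mathcal Vh$ for some $h\in c_0^+$" are equivalent.
   Context: $\mathbb N=\{1,2,\dots\}$; $\ell_1^+$ is the set of non-negative summable sequences; $c_0^+$ is the set of non-negative sequences converging to $0$; $(\mathcal Vh)_j=\sum_n\mathcal V_{j,n}h_n$. $\mathcal V$ is the potential density of a symmetric transient continuous time Markov chain $\mathcal Y$ on $\mathbb N$, i.e. $\mathcal V_{m,n}=\int_0^\infty p_t(m,n)\,dt$ where $p_t$ are the transition functions of $\mathcal Y$ (which may be killed); its $Q$-matrix is $-A$, where $A_{m,m}=1+\sum_{i=1}^kp_i^2$, $A_{m,n}=-p_{|m-n|}+\sum_{l=1}^{k-|m-n|}p_lp_{|m-n|+l}$ for $1\le|m-n|\le k$, and $A_{m,n}=0$ for $|m-n|>k$. A non-negative function $f$ on $\mathbb N$ is excessive for $\mathcal Y$ if $P_tf(j)\uparrow f(j)$ as $t\downarrow0$ for all $j$, where $P_t$ is the transition semigroup of $\mathcal Y$. Notation for $c^*$: $P(x)=1-\sum_{l=1}^kp_lx^l$ has distinct (complex) roots $q_1,\dots,q_{k'}$ with multiplicities $d_1,\dots,d_{k'}$ (all $|q_l|>1$ when $\sum p_l<1$); $$B_j(q_l)=\frac{(-1)^j}{q_l^j(d_l-j)!}\lim_{x\to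 q_l}D^{(d_l-j)}\frac{x(x-q_l)^{d_l}}{P(x)},$$ where $D^{(m)}$ is the $m$-th derivative in $x$; and $F_{j,j'}(z)=\sum_{n=0}^\infty\binom{j-1+n}{j-1}\binom{j'-1+n}{j'-1}z^{-n}$. Permanental sequences: for $\alpha>0$ and a matrix $K=\{K_{i,j}\}_{i,j\in\mathbb N}$, an $\alpha$-permanental sequence with kernel $K$ is a sequence $\{Z_j\}_{j\in\mathbb N}$ of non-negative random variables such that for all $n$, all distinct $i_1,\dots,i_n\in\mathbb N$ and all $s_1,\dots,s_n>0$, $E\exp(-\sum_{m=1}^n s_mZ_{i_m})=\det(I+K'S)^{-\alpha}$, where $K'=\{K_{i_p,i_q}\}_{p,q=1}^n$ and $S=\mathrm{diag}(s_1,\dots,s_n)$. It is known that an $\alpha$-permanental sequence with kernel $\widetilde{\mathcal V}$ exists for every $\alpha>0$. *)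

theory Defs
  imports
    "HOL-Probability.Probability"
    "HOL-Complex_Analysis.Complex_Analysis"
    "Jordan_Normal_Form.Determinant"
begin

text \<open>
  Throughout, the index set is the set \<open>{1, 2, \<dots>}\<close>.  Sequences and infinite matrices over it are
  functions on \<^typ>\<open>nat\<close> whose values at the index \<open>0\<close> are never inspected.
\<close>

section \<open>Sequence spaces and the action of an infinite matrix\<close>

definition l1_plus :: "(nat \<Rightarrow> real) set" where
  "l1_plus = {h. (\<forall>n\<ge>1. 0 \<le> h n) \<and> h summable_on {1..}}"

definition c0_plus :: "(nat \<Rightarrow> real) set" where
  "c0_plus = {h. (\<forall>n\<ge>1. 0 \<le> h n) \<and> h \<longlonglongrightarrow> 0}"

text \<open>The relation \<open>f = V h\<close>; it includes the convergence of the series \<open>\<Sum>\<^sub>n V j n * h n\<close>.\<close>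

definition is_potential_of :: "(nat \<Rightarrow> nat \<Rightarrow> real) \<Rightarrow> (nat \<Rightarrow> real) \<Rightarrow> (nat \<Rightarrow> real) \<Rightarrow> bool" where
  "is_potential_of V h f \<longleftrightarrow> (\<forall>j\<ge>1. ((\<lambda>n. V j n * h n) has_sum f j) {1..})"

section \<open>The autoregressive Gaussian sequence\<close>

definition iid_std_normal :: "'a measure \<Rightarrow> (nat \<Rightarrow> 'a \<Rightarrow> real) \<Rightarrow> bool" where
  "iid_std_normal N g \<longleftrightarrow>
     prob_space N \<and>
     prob_space.indep_vars N (\<lambda>_. borel) g {1..} \<and>
     (\<forall>n\<ge>1. distributed N lborel (g n) std_normal_density)"

text \<open>The time index is \<^typ>\<open>int\<close> because the recursion refers to times \<open>\<le> 0\<close>.\<close>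

definition autoregressive ::
  "nat \<Rightarrow> (nat \<Rightarrow> real) \<Rightarrow> 'a measure \<Rightarrow> (nat \<Rightarrow> 'a \<Rightarrow> real) \<Rightarrow> (int \<Rightarrow> 'a \<Rightarrow> real) \<Rightarrow> bool" where
  "autoregressive k p N g \<xi> \<longleftrightarrow>
     (\<forall>\<omega>\<in>space N.
        (\<forall>i\<le>0. \<xi> i \<omega> = 0) \<and>
        \<xi> 1 \<omega> = g 1 \<omega> \<and>
        (\<forall>n\<ge>2. \<xi> (int n) \<omega> = (\<Sum>l=1..k. p l * \<xi> (int n - int l) \<omega>) + g n \<omega>))"

definition covariance :: "'a measure \<Rightarrow> ('a \<Rightarrow> real) \<Rightarrow> ('a \<Rightarrow> real) \<Rightarrow> real" where
  "covariance N X Y =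
     (LINT \<omega>|N. (X \<omega> - (LINT \<omega>'|N. X \<omega>')) * (Y \<omega> - (LINT \<omega>'|N. Y \<omega>')))"

section \<open>Continuous time Markov chains\<close>

text \<open>
  A (possibly killed) chain is given by its standard sub-Markovian transition functions
  \<open>pt t m n\<close>; the missing mass \<open>1 - \<Sum>\<^sub>n pt t m n\<close> is the probability of having been killed by time
  \<open>t\<close>.
\<close>

definition transition_function :: "(real \<Rightarrow> nat \<Rightarrow> nat \<Rightarrow> real) \<Rightarrow> bool" where
  "transition_function pt \<longleftrightarrow>
     (\<forall>t\<ge>0. \<forall>m\<ge>1. \<forall>n\<ge>1. 0 \<le> pt t m n) \<and>
     (\<forall>t\<ge>0. \<forall>m\<ge>1. pt t m summable_on {1..} \<and> (\<Sum>\<^sub>\<infinity>n\<in>{1..}. pt t m n) \<le> 1) \<and>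
     (\<forall>m\<ge>1. \<forall>n\<ge>1. pt 0 m n = (if m = n then 1 else 0)) \<and>
     (\<forall>s\<ge>0. \<forall>t\<ge>0. \<forall>m\<ge>1. \<forall>n\<ge>1.
        ((\<lambda>i. pt s m i * pt t i n) has_sum pt (s + t) m n) {1..}) \<and>
     (\<forall>m\<ge>1. ((\<lambda>t. pt t m m) \<longlongrightarrow> 1) (at_right 0))"

definition symmetric_chain :: "(real \<Rightarrow> nat \<Rightarrow> nat \<Rightarrow> real) \<Rightarrow> bool" where
  "symmetric_chain pt \<longleftrightarrow> (\<forall>t\<ge>0. \<forall>m\<ge>1. \<forall>n\<ge>1. pt t m n = pt t n m)"

definition has_Q_matrix :: "(real \<Rightarrow> nat \<Rightarrow> nat \<Rightarrow> real) \<Rightarrow> (nat \<Rightarrow> nat \<Rightarrow> real) \<Rightarrow> bool" where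
  "has_Q_matrix pt Q \<longleftrightarrow>
     (\<forall>m\<ge>1. \<forall>n\<ge>1. ((\<lambda>t. pt t m n) has_real_derivative Q m n) (at 0 within {0..}))"

text \<open>Convergence of these integrals to real numbers is the transience of the chain.\<close>

definition has_potential_density ::
  "(real \<Rightarrow> nat \<Rightarrow> nat \<Rightarrow> real) \<Rightarrow> (nat \<Rightarrow> nat \<Rightarrow> real) \<Rightarrow> bool" where
  "has_potential_density pt V \<longleftrightarrow>
     (\<forall>m\<ge>1. \<forall>n\<ge>1. ((\<lambda>t. pt t m n) has_integral V m n) {0..})"

definition A_matrix :: "nat \<Rightarrow> (nat \<Rightarrow> real) \<Rightarrow> nat \<Rightarrow> nat \<Rightarrow> real" where
  "A_matrix k p m n =
     (let d = nat \<bar>int m - int n\<bar> in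
      if d = 0 then 1 + (\<Sum>i=1..k. (p i)\<^sup>2)
      else if d \<le> k then - p d + (\<Sum>l=1..k - d. p l * p (d + l))
      else 0)"

definition semigroup_apply ::
  "(real \<Rightarrow> nat \<Rightarrow> nat \<Rightarrow> real) \<Rightarrow> real \<Rightarrow> (nat \<Rightarrow> real) \<Rightarrow> nat \<Rightarrow> real" where
  "semigroup_apply pt t f j = (\<Sum>\<^sub>\<infinity>n\<in>{1..}. pt t j n * f n)"

text \<open>
  Finite excessive functions.  A priori \<open>P\<^sub>t f j\<close> lies in \<open>[0, \<infinity>]\<close>, but the monotone convergence
  \<open>P\<^sub>t f j \<up> f j\<close> forces \<open>P\<^sub>t f j \<le> f j < \<infinity>\<close>; this is the summability clause.
\<close>

definition excessive :: "(real \<Rightarrow> nat \<Rightarrow> nat \<Rightarrow> real) \<Rightarrow> (nat \<Rightarrow> real) \<Rightarrow> bool" where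
  "excessive pt f \<longleftrightarrow>
     (\<forall>n\<ge>1. 0 \<le> f n) \<and>
     (\<forall>j\<ge>1.
        (\<forall>t>0. (\<lambda>n. pt t j n * f n) summable_on {1..}) \<and>
        antimono_on {0<..} (\<lambda>t. semigroup_apply pt t f j) \<and>
        ((\<lambda>t. semigroup_apply pt t f j) \<longlongrightarrow> f j) (at_right 0))"

section \<open>Permanental sequences\<close>

text \<open>
  The determinant below is never \<open>\<le> 0\<close> for a permanental sequence: the expectation is positive, so
  it does not vanish on the connected set of all \<open>s > 0\<close>, and it tends to \<open>1\<close> as \<open>s \<rightarrow> 0\<close>.  Hence
  \<open>powr\<close> is only used with a positive base.
\<close>

definition permanental_sequence ::
  "real \<Rightarrow> (nat \<Rightarrow> nat \<Rightarrow> real) \<Rightarrow> 'b measure \<Rightarrow> (nat \<Rightarrow> 'b \<Rightarrow> real) \<Rightarrow> bool" where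
  "permanental_sequence \<alpha> K M Z \<longleftrightarrow>
     prob_space M \<and>
     (\<forall>j\<ge>1. Z j \<in> borel_measurable M \<and> (\<forall>\<omega>\<in>space M. 0 \<le> Z j \<omega>)) \<and>
     (\<forall>n (i :: nat \<Rightarrow> nat) (s :: nat \<Rightarrow> real).
        inj_on i {..<n} \<and> (\<forall>m<n. 1 \<le> i m \<and> 0 < s m) \<longrightarrow>
        (LINT \<omega>|M. exp (- (\<Sum>m<n. s m * Z (i m) \<omega>))) =
        Determinant.det (1\<^sub>m n + Matrix.mat n n (\<lambda>(a, b). K (i a) (i b)) * mat_diag n s)
          powr (- \<alpha>))"

section \<open>The constant in the subcritical case\<close>

definition char_poly_P :: "nat \<Rightarrow> (nat \<Rightarrow> real) \<Rightarrow> complex poly" where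
  "char_poly_P k p = 1 - (\<Sum>l=1..k. Polynomial.monom (complex_of_real (p l)) l)"

text \<open>
  \<open>B_coeff P j q\<close> is the coefficient \<open>B\<^sub>j(q)\<close> at a root \<open>q\<close> of \<open>P\<close>, whose multiplicity
  \<open>Polynomial.order q P\<close> plays the role of \<open>d\<close>.
\<close>

definition B_coeff :: "complex poly \<Rightarrow> nat \<Rightarrow> complex \<Rightarrow> complex" where
  "B_coeff P j q =
     (let d = Polynomial.order q P in
      (- 1) ^ j / (q ^ j * fact (d - j)) *
      Lim (at q) ((deriv ^^ (d - j)) (\<lambda>x. x * (x - q) ^ d / poly P x)))"

definition F_series :: "nat \<Rightarrow> nat \<Rightarrow> complex \<Rightarrow> complex" where
  "F_series j j' z =
     (\<Sum>n. of_nat ((j - 1 + n) choose (j - 1)) * of_nat ((j' - 1 + n) choose (j' - 1)) / z ^ n)"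

definition c_star :: "nat \<Rightarrow> (nat \<Rightarrow> real) \<Rightarrow> complex" where
  "c_star k p =
     (let P = char_poly_P k p; R = {q. poly P q = 0} in
      \<Sum>q\<in>R. \<Sum>q'\<in>R. \<Sum>j=1..Polynomial.order q P. \<Sum>j'=1..Polynomial.order q' P.
        B_coeff P j q * B_coeff P j' q' * F_series j j' (q * q'))"

end

theory Submission
  imports Defs "HOL-Computational_Algebra.Fundamental_Theorem_Algebra" "HOL-Real_Asymp.Real_Asymp"
begin

text \<open>
  A finite section of the kernel \<open>V + 1 f\<^sup>T\<close> is an inverse M-matrix, because \<open>V\<close> is one and \<open>f\<close> is a
  potential.  If \<open>C\<close> is the inverse of the section, the binomial series turns \<open>det (I + K S) powr (- \<alpha>)\<close>
  into a power series with non-negative coefficients in the quantities \<open>C\<^sub>i\<^sub>i / (C\<^sub>i\<^sub>i + s\<^sub>i)\<close>.  Hence a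
  permanental vector is a mixture of vectors of independent gamma variables with shapes at least \<open>\<alpha>\<close>
  and rates \<open>C\<^sub>i\<^sub>i\<close>, so the probability that all its entries are small is at most the product of the
  corresponding gamma probabilities.  This replaces the second Borel--Cantelli lemma and gives the
  lower bounds along a subsequence on which \<open>1 / C\<^sub>i\<^sub>i\<close> is close to \<open>V\<^sub>i\<^sub>i\<close>: an arithmetic progression
  in the subcritical case, a geometric one in the critical case.

  The upper bounds come from the first Borel--Cantelli lemma and exponential moments.  In the critical
  case these control the increments of a dyadic chaining, and the two-dimensional Laplace transform
  gives a Chernoff bound for \<open>Z\<^sub>i - (1 + \<kappa>) Z\<^sub>j\<close>.

  Everything about \<open>V\<close> follows from the moving average \<open>\<xi>\<^sub>n = \<Sum>\<^sub>i \<phi>\<^sub>n\<^sub>-\<^sub>i g\<^sub>i\<close>, where \<open>\<phi>\<close> are the coefficients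
  of \<open>1 / P\<close>: in the subcritical case \<open>V\<^sub>j\<^sub>j\<close> converges to \<open>\<Sum>\<^sub>n \<phi>\<^sub>n\<^sup>2\<close>, which is \<open>c\<^sup>*\<close> by partial fractions, and
  in the critical case \<open>\<phi>\<^sub>n\<close> converges geometrically fast to \<open>1 / \<mu>\<close> with \<open>\<mu> = \<Sum>\<^sub>l l p\<^sub>l\<close>.
\<close>

section \<open>Gamma distributions and Laplace transforms\<close>

text \<open>The sequence is known only through its finite-dimensional Laplace transforms, and the
  kernel is not symmetric unless \<open>f\<close> is constant, so there is no Gaussian process to
  condition on or to compare with. Domination by a product of gamma probabilities stands in for
  independence. It rests on two sign facts about the inverse of a section of \<open>V\<close>: its
  off-diagonal entries are non-positive, because \<open>p\<close> decreases and has sum at most one,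
  and it maps the constants and \<open>f\<close> to non-negative vectors. Both facts survive Schur
  complements, hence hold on every finite set of indices, and they make the rank-one correction by
  \<open>f\<close> lower the entries of the inverse.

  The strength of the domination depends on the diagonal of the inverse of a whole section, so
  \<open>1 / C\<^sub>i\<^sub>i\<close> must be bounded below uniformly as the section grows. In the
  critical case a column of \<open>V\<close> does not decay away from the diagonal on the right, and
  no useful constant absorbs it; a small multiple of the column of the last index does. This is the
  origin of the comparison column in the lower bounds.\<close>

lemma moments_determine_measure:
  fixes M1 M2 :: "real measure"
  assumes sets1: "sets M1 = sets borel" and sets2: "sets M2 = sets borel"
    and fin1: "finite_measure M1" and fin2: "finite_measure M2"
    and unit1: "AE x in M1. x \<in> {0..1}" and unit2: "AE x in M2. x \<in> {0..1}"
    and moments: "\<And>k::nat. (\<integral>x. x ^ k \<partial>M1) = (\<integral>x. x ^ k \<partial>M2)"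
  shows "M1 = M2"
proof -
  interpret F1: finite_measure M1 by fact
  interpret F2: finite_measure M2 by fact
  define c where "c = measure M1 (space M1)"
  have c2: "c = measure M2 (space M2)"
    using moments[of 0] by (simp add: c_def)
  have space: "space M1 = UNIV" "space M2 = UNIV"
    using sets1 sets2 by (auto dest!: sets_eq_imp_space_eq)
  show ?thesis
  proof (cases "c = 0")
    case True
    show ?thesis
    proof (rule measure_eqI)
      show "sets M1 = sets M2" using sets1 sets2 by simp
      fix A assume "A \<in> sets M1"
      have "measure M1 A = 0" "measure M2 A = 0"
        using F1.bounded_measure[of A] F2.bounded_measure[of A] True c_def c2
        by (auto intro: antisym)
      then show "emeasure M1 A = emeasure M2 A"
        by (simp add: F1.emeasure_eq_measure F2.emeasure_eq_measure)
    qed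
  next
    case False
    then have c: "c > 0" by (simp add: c_def less_le)
    define N1 where "N1 = density M1 (\<lambda>_. ennreal (1 / c))"
    define N2 where "N2 = density M2 (\<lambda>_. ennreal (1 / c))"
    have sc: "prob_space (density M (\<lambda>_. ennreal (1 / c)))"
      if "finite_measure M" "c = measure M (space M)" for M :: "real measure"
    proof
      interpret finite_measure M by fact
      show "emeasure (density M (\<lambda>_. ennreal (1 / c))) (space (density M (\<lambda>_. ennreal (1 / c)))) = 1"
        using c that by (simp add: emeasure_density_const emeasure_eq_measure ennreal_mult''[symmetric])
    qed
    have rd1: "real_distribution N1"
      unfolding N1_def real_distribution_def real_distribution_axioms_def
      using sc[OF fin1 c_def] sets1 space by simp
    have rd2: "real_distribution N2"
      unfolding N2_def real_distribution_def real_distribution_axioms_def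
      using sc[OF fin2 c2] sets2 space by simp
    interpret R1: real_distribution N1 by fact
    interpret R2: real_distribution N2 by fact
    have AE1: "AE x in N1. x \<in> {0..1}" and AE2: "AE x in N2. x \<in> {0..1}"
      unfolding N1_def N2_def using unit1 unit2 by (auto simp: AE_density)
    have int1: "integrable N1 (\<lambda>x. x ^ k)" for k :: nat
    proof (rule R1.integrable_const_bound[of _ 1])
      show "AE x in N1. norm (x ^ k) \<le> 1"
        using AE1 by eventually_elim (auto simp: power_le_one)
    qed simp
    have int2: "integrable N2 (\<lambda>x. x ^ k)" for k :: nat
    proof (rule R2.integrable_const_bound[of _ 1])
      show "AE x in N2. norm (x ^ k) \<le> 1"
        using AE2 by eventually_elim (auto simp: power_le_one)
    qed simp
    have mom: "(\<integral>x. x ^ k \<partial>N1) = (\<integral>x. x ^ k \<partial>N2)" for k :: nat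
      unfolding N1_def N2_def using c moments[of k] sets1 sets2
      by (simp add: integral_density)
    have bd1: "(\<integral>x. \<bar>x\<bar> ^ k \<partial>N1) \<le> 1" for k :: nat
    proof -
      have "(\<integral>x. \<bar>x\<bar> ^ k \<partial>N1) \<le> (\<integral>x. 1 \<partial>N1)"
      proof (rule integral_mono_AE)
        show "integrable N1 (\<lambda>x. \<bar>x\<bar> ^ k)"
          using integrable_norm[OF int1[of k]] by (simp add: power_abs)
        show "AE x in N1. \<bar>x\<bar> ^ k \<le> 1"
          using AE1 by eventually_elim (auto simp: power_le_one)
      qed simp
      then show ?thesis using R1.prob_space by simp
    qed
    have bd2: "(\<integral>x. \<bar>x\<bar> ^ k \<partial>N2) \<le> 1" for k :: nat
    proof -
      have "(\<integral>x. \<bar>x\<bar> ^ k \<partial>N2) \<le> (\<integral>x. 1 \<partial>N2)"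
      proof (rule integral_mono_AE)
        show "integrable N2 (\<lambda>x. \<bar>x\<bar> ^ k)"
          using integrable_norm[OF int2[of k]] by (simp add: power_abs)
        show "AE x in N2. \<bar>x\<bar> ^ k \<le> 1"
          using AE2 by eventually_elim (auto simp: power_le_one)
      qed simp
      then show ?thesis using R2.prob_space by simp
    qed
    \<comment> \<open>Both characteristic functions lie within
      \<open>2 * \<bar>t\<bar> ^ n / fact n\<close> of the same Taylor polynomial, because absolute
      moments on the unit interval are at most one. The normalisation by \<open>c\<close> only
      serves to reach probability measures, for which Levy's uniqueness theorem is stated.\<close>
    have "char N1 t = char N2 t" for t
    proof -
      have le: "cmod (char N1 t - char N2 t) \<le> 4 * (\<bar>t\<bar> ^ n / fact n)" for n
      proof -
        define T where "T = (\<Sum>k\<le>n. ((\<i> * t)^k / fact k) * (\<integral>x. x ^ k \<partial>N1))"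
        have "cmod (char N1 t - T) \<le> (2*\<bar>t\<bar>^n / fact n) * (\<integral>x. \<bar>x\<bar> ^ n \<partial>N1)"
          unfolding T_def by (rule R1.char_approx1) (rule int1)
        also have "\<dots> \<le> 2*\<bar>t\<bar>^n / fact n"
          by (rule mult_left_le[OF bd1]) simp
        finally have 1: "cmod (char N1 t - T) \<le> 2*\<bar>t\<bar>^n / fact n" .
        have "cmod (char N2 t - T) \<le> (2*\<bar>t\<bar>^n / fact n) * (\<integral>x. \<bar>x\<bar> ^ n \<partial>N2)"
          unfolding T_def mom by (rule R2.char_approx1) (rule int2)
        also have "\<dots> \<le> 2*\<bar>t\<bar>^n / fact n"
          by (rule mult_left_le[OF bd2]) simp
        finally have 2: "cmod (char N2 t - T) \<le> 2*\<bar>t\<bar>^n / fact n" .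
        have "cmod (char N1 t - char N2 t) \<le> cmod (char N1 t - T) + cmod (char N2 t - T)"
          by norm
        with 1 2 show ?thesis by simp
      qed
      have "(\<lambda>n. 4 * (\<bar>t\<bar> ^ n / fact n)) \<longlonglongrightarrow> 4 * 0"
        by (intro tendsto_intros) (use summable_LIMSEQ_zero[OF summable_exp[of "\<bar>t\<bar>"]] in \<open>simp add: field_simps\<close>)
      then have "cmod (char N1 t - char N2 t) \<le> 0"
        by (intro LIMSEQ_le_const[where X="\<lambda>n. 4 * (\<bar>t\<bar> ^ n / fact n)"]) (use le in auto)
      then show ?thesis by simp
    qed
    then have N: "N1 = N2"
      by (intro Levy_uniqueness rd1 rd2) auto
    show ?thesis
    proof (rule measure_eqI)
      show "sets M1 = sets M2" using sets1 sets2 by simp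
      fix A assume "A \<in> sets M1"
      have "ennreal (1/c) * emeasure M1 A = ennreal (1/c) * emeasure M2 A"
        using \<open>A \<in> sets M1\<close> sets1 sets2 arg_cong[OF N, of "\<lambda>N. emeasure N A"] by (simp add: N1_def N2_def emeasure_density_const)
      then show "emeasure M1 A = emeasure M2 A"
        using c by (simp add: ennreal_mult_cancel_left)
    qed
  qed
qed

text \<open>Weighting by \<open>exp (- z)\<close> and substituting \<open>y = exp (- z)\<close>
  yields a measure on the unit interval whose k-th moment is the Laplace transform at
  \<open>k + 1\<close>. It is finite by \<open>fin\<close>, so its moments determine it, and the
  weight \<open>1 / y\<close> recovers the original measure, which may itself be infinite.\<close>

lemma laplace_transform_unique:
  fixes M1 M2 :: "real measure"
  assumes sets1: "sets M1 = sets borel" and sets2: "sets M2 = sets borel"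
    and fin: "(\<integral>\<^sup>+z. ennreal (exp (- z)) \<partial>M1) < \<infinity>"
    and pos1: "AE z in M1. 0 \<le> z" and pos2: "AE z in M2. 0 \<le> z"
    and lap: "\<And>s. s > 0 \<Longrightarrow> (\<integral>\<^sup>+z. ennreal (exp (- s * z)) \<partial>M1) = (\<integral>\<^sup>+z. ennreal (exp (- s * z)) \<partial>M2)"
  shows "M1 = M2"
proof -
  have [measurable_cong]: "sets M1 = sets borel" "sets M2 = sets borel" by fact+
  define T where "T M = distr (density M (\<lambda>z. ennreal (exp (- z)))) borel (\<lambda>z::real. exp (- z))" for M :: "real measure"
  have nn: "(\<integral>\<^sup>+y. g y \<partial>T M) = (\<integral>\<^sup>+z. ennreal (exp (- z)) * g (exp (- z)) \<partial>M)"
    if [measurable_cong]: "sets M = sets borel" and [measurable]: "g \<in> borel_measurable borel" for M g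
    unfolding T_def by (simp add: nn_integral_distr nn_integral_density)
  have AE: "AE x in T M. x \<in> {0<..1}" if [measurable_cong]: "sets M = sets borel" and "AE z in M. 0 \<le> z" for M
    unfolding T_def using that(2) by (subst AE_distr_iff) (auto simp: AE_density elim!: eventually_mono)
  have mass: "emeasure (T M) (space (T M)) = (\<integral>\<^sup>+z. ennreal (exp (- z)) \<partial>M)" if "sets M = sets borel" for M
    using nn[OF that, of "\<lambda>_. 1"] by simp
  have fin1: "finite_measure (T M1)" and fin2: "finite_measure (T M2)"
    using mass[OF sets1] mass[OF sets2] fin lap[of 1] by (auto intro!: finite_measureI)
  have T: "T M1 = T M2"
  proof (rule moments_determine_measure)
    fix k :: nat
    have eq: "(\<integral>\<^sup>+x. ennreal (x ^ k) \<partial>T M1) = (\<integral>\<^sup>+x. ennreal (x ^ k) \<partial>T M2)"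
    proof -
      have *: "(\<integral>\<^sup>+x. ennreal (x ^ k) \<partial>T M) = (\<integral>\<^sup>+z. ennreal (exp (- real (Suc k) * z)) \<partial>M)"
        if "sets M = sets borel" for M
        by (subst nn[OF that]) (auto simp: ennreal_mult''[symmetric] exp_of_nat_mult[symmetric] exp_add[symmetric] algebra_simps
              intro!: nn_integral_cong)
      show ?thesis using *[OF sets1] *[OF sets2] lap[of "real (Suc k)"] by simp
    qed
    have AE1: "AE x in T M1. 0 \<le> x ^ k" and AE2: "AE x in T M2. 0 \<le> x ^ k"
      using AE[OF sets1 pos1] AE[OF sets2 pos2] by (auto elim!: eventually_mono)
    have [measurable_cong]: "sets (T M1) = sets borel" "sets (T M2) = sets borel" by (simp_all add: T_def)
    show "(\<integral>x. x ^ k \<partial>T M1) = (\<integral>x. x ^ k \<partial>T M2)"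
      by (subst (1 2) integral_eq_nn_integral) (use AE1 AE2 eq in \<open>simp_all\<close>)
  qed (use AE[OF sets1 pos1] AE[OF sets2 pos2] fin1 fin2 in \<open>auto simp: T_def elim: eventually_mono\<close>)
  show ?thesis
  proof (rule measure_eqI)
    show "sets M1 = sets M2" using sets1 sets2 by simp
    fix A assume "A \<in> sets M1"
    then have [measurable]: "A \<in> sets borel" using sets1 by simp
    have *: "emeasure M A = (\<integral>\<^sup>+y. ennreal (1 / y) * indicator A (- ln y) \<partial>T M)" if "sets M = sets borel" for M
    proof -
      have "(\<integral>\<^sup>+y. ennreal (1 / y) * indicator A (- ln y) \<partial>T M) = (\<integral>\<^sup>+z. indicator A z \<partial>M)"
        by (subst nn[OF that]) (auto simp: mult.assoc[symmetric] ennreal_mult''[symmetric] intro!: nn_integral_cong)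
      also have "\<dots> = emeasure M A"
        using that by (intro nn_integral_indicator) simp
      finally show ?thesis by simp
    qed
    show "emeasure M1 A = emeasure M2 A"
      using *[OF sets1] *[OF sets2] T by simp
  qed
qed

definition gamma_distribution :: "real \<Rightarrow> real \<Rightarrow> real measure" where
  "gamma_distribution a D =
     density lborel (\<lambda>z. ennreal (indicator {0..} z * (D powr a * z powr (a - 1) * exp (- D * z) / Gamma a)))"

lemma sets_gamma_distribution [simp, measurable_cong]: "sets (gamma_distribution a D) = sets borel"
  by (simp add: gamma_distribution_def)

lemma space_gamma_distribution [simp]: "space (gamma_distribution a D) = UNIV"
  by (simp add: gamma_distribution_def)

lemma AE_gamma_distribution_nonneg: "AE z in gamma_distribution a D. 0 \<le> z"
  unfolding gamma_distribution_def by (subst AE_density) (auto simp: indicator_def)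

lemma laplace_gamma_distribution:
  assumes a: "a > 0" and D: "D > 0" and s: "D + s > 0"
  shows "(\<integral>\<^sup>+z. ennreal (exp (- s * z)) \<partial>gamma_distribution a D) = ennreal ((D / (D + s)) powr a)"
proof -
  define E where "E = D + s"
  have E: "E > 0" using s by (simp add: E_def)
  have G: "Gamma a > 0" using a by (simp add: Gamma_real_pos)
  have "(\<integral>\<^sup>+z. ennreal (exp (- s * z)) \<partial>gamma_distribution a D)
      = (\<integral>\<^sup>+z. ennreal (indicator {0..} z * (D powr a * z powr (a - 1) * exp (- E * z) / Gamma a)) \<partial>lborel)"
    unfolding gamma_distribution_def
    by (subst nn_integral_density)
      (use G in \<open>auto simp: ennreal_mult''[symmetric] indicator_def E_def exp_add[symmetric] algebra_simps mult_exp_exp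
        intro!: nn_integral_cong arg_cong[where f=ennreal]\<close>)
  also have "\<dots> = ennreal (1/E) * (\<integral>\<^sup>+t. ennreal (indicator {0..} (t/E) * (D powr a * (t/E) powr (a - 1) * exp (- t) / Gamma a)) \<partial>lborel)"
    using E by (subst nn_integral_real_affine[of _ "1/E" 0]) (auto simp: )
  also have "\<dots> = ennreal (1/E) * (\<integral>\<^sup>+t. ennreal (D powr a / E powr (a-1) / Gamma a) * ennreal (indicator {0..} t * t powr (a - 1) / exp t) \<partial>lborel)"
    using E G by (intro arg_cong2[where f="(*)"] refl nn_integral_cong)
      (auto simp: ennreal_mult''[symmetric] indicator_def powr_divide exp_minus divide_simps zero_le_divide_iff intro!: arg_cong[where f=ennreal])
  also have "\<dots> = ennreal (1/E) * (ennreal (D powr a / E powr (a-1) / Gamma a) * ennreal (Gamma a))"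
    by (subst nn_integral_cmult) (auto simp: Gamma_conv_nn_integral_real[OF a])
  also have "\<dots> = ennreal ((D / E) powr a)"
    using E D G by (simp add: ennreal_mult''[symmetric] powr_divide powr_diff)
  finally show ?thesis by (simp add: E_def)
qed

lemma prob_space_gamma_distribution:
  assumes "a > 0" "D > 0"
  shows "prob_space (gamma_distribution a D)"
  using laplace_gamma_distribution[OF assms, of 0] assms by (intro prob_spaceI) simp

text \<open>A transform of this shape identifies the law of \<open>X\<close> under the weight
  \<open>W\<close> as \<open>A powr (- a)\<close> times the gamma law of shape \<open>a\<close> and
  rate \<open>A / B\<close>. Its transform is explicit on the whole half-line of convergence, so it
  can be read off at \<open>s = - \<theta>\<close> without analytic continuation. The weight is one
  for a single tail and an exponential of a second variable for an increment.\<close>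

lemma exp_moment_of_laplace:
  fixes X W :: "'b \<Rightarrow> real"
  assumes X [measurable]: "X \<in> borel_measurable M" and W [measurable]: "W \<in> borel_measurable M"
    and X0: "\<And>\<omega>. \<omega> \<in> space M \<Longrightarrow> 0 \<le> X \<omega>"
    and A: "A > 0" and B: "B > 0" and a: "a > 0" and \<theta>: "\<theta> * B < A"
    and lap: "\<And>s. s > 0 \<Longrightarrow> (\<integral>\<^sup>+\<omega>. ennreal (W \<omega> * exp (- s * X \<omega>)) \<partial>M) = ennreal ((A + B * s) powr (- a))"
  shows "(\<integral>\<^sup>+\<omega>. ennreal (W \<omega> * exp (\<theta> * X \<omega>)) \<partial>M) = ennreal ((A - B * \<theta>) powr (- a))"
proof -
  define M1 where "M1 = distr (density M (\<lambda>\<omega>. ennreal (W \<omega>))) borel X"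
  define M2 where "M2 = density (gamma_distribution a (A / B)) (\<lambda>_. ennreal (A powr (- a)))"
  have nn1: "(\<integral>\<^sup>+z. ennreal (exp (c * z)) \<partial>M1) = (\<integral>\<^sup>+\<omega>. ennreal (W \<omega> * exp (c * X \<omega>)) \<partial>M)" for c
    unfolding M1_def by (simp add: nn_integral_distr nn_integral_density ennreal_mult'' )
  have nn2: "(\<integral>\<^sup>+z. ennreal (exp (- s * z)) \<partial>M2) = ennreal ((A + B * s) powr (- a))" if "A / B + s > 0" for s
  proof -
    have AB: "A + B * s > 0" using that B by (simp add: field_simps)
    have "(\<integral>\<^sup>+z. ennreal (exp (- s * z)) \<partial>M2) = ennreal (A powr (- a)) * ennreal ((A / B / (A / B + s)) powr a)"
      unfolding M2_def using A B a that
      by (simp add: nn_integral_density nn_integral_cmult laplace_gamma_distribution[of a "A/B" s, simplified])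
    also have "A / B / (A / B + s) = A / (A + B * s)" using B by (simp add: field_simps)
    also have "ennreal (A powr (- a)) * ennreal ((A / (A + B * s)) powr a) = ennreal ((A + B * s) powr (- a))"
      using A AB by (simp add: ennreal_mult''[symmetric] powr_minus powr_divide field_simps)
    finally show ?thesis .
  qed
  have "M1 = M2"
  proof (rule laplace_transform_unique)
    show "AE z in M1. 0 \<le> z"
      unfolding M1_def by (subst AE_distr_iff) (auto simp: AE_density X0)
    show "AE z in M2. 0 \<le> z"
      unfolding M2_def using AE_gamma_distribution_nonneg[of a "A/B"] by (auto simp: AE_density)
    show "(\<integral>\<^sup>+z. ennreal (exp (- z)) \<partial>M1) < \<infinity>"
      using nn1[of "-1"] lap[of 1] by simp
    fix s :: real assume s: "s > 0"
    then have "A / B + s > 0" using A B by (simp add: add_pos_pos)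
    then show "(\<integral>\<^sup>+z. ennreal (exp (- s * z)) \<partial>M1) = (\<integral>\<^sup>+z. ennreal (exp (- s * z)) \<partial>M2)"
      using nn1[of "-s"] nn2[of s] lap[OF s] by simp
  qed (auto simp: M1_def M2_def)
  moreover have "A / B + - \<theta> > 0" using \<theta> B by (simp add: field_simps)
  ultimately show ?thesis using nn1[of \<theta>] nn2[of "-\<theta>"] by simp
qed

text \<open>Monotone likelihood ratio: the quotient \<open>r\<close> of the two densities is a
  multiple of \<open>z ^ n\<close>, hence increasing on the half-line. If \<open>x < 0\<close> or
  \<open>r x < 1\<close>, the lower sets are compared directly; otherwise the upper sets
  are.\<close>

lemma gamma_distribution_shape_mono:
  fixes n :: nat and a D :: real
  assumes a: "a > 0" and D: "D > 0"
  shows "measure (gamma_distribution (a + n) D) {..x} \<le> measure (gamma_distribution a D) {..x}"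
proof -
  define f where "f z = indicator {0..} z * (D powr a * z powr (a - 1) * exp (- D * z) / Gamma a)" for z :: real
  define r where "r z = (D * z) ^ n * Gamma a / Gamma (a + n)" for z :: real
  have G: "Gamma a > 0" "Gamma (a + n) > 0" using a by (auto intro!: Gamma_real_pos add_pos_nonneg)
  interpret P: prob_space "gamma_distribution a D" by (rule prob_space_gamma_distribution[OF a D])
  interpret Q: prob_space "gamma_distribution (a + n) D" by (rule prob_space_gamma_distribution) (use a D in auto)
  have f0: "f z \<ge> 0" for z using G by (simp add: f_def)
  have [measurable]: "f \<in> borel_measurable borel" "r \<in> borel_measurable borel"
    unfolding f_def r_def by measurable
  have eqP: "gamma_distribution a D = density lborel (\<lambda>z. ennreal (f z))"
    by (simp add: gamma_distribution_def f_def)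
  have "indicator {0..} z * (D powr (a + n) * z powr (a + n - 1) * exp (- D * z) / Gamma (a + n)) = f z * r z" if "z \<noteq> 0" for z
  proof (cases "z > 0")
    case True
    then show ?thesis using G D
      by (simp add: f_def r_def powr_add powr_diff powr_realpow power_mult_distrib)
  qed (use that in \<open>auto simp: f_def indicator_def\<close>)
  then have eqQ: "gamma_distribution (a + n) D = density lborel (\<lambda>z. ennreal (f z * r z))"
    unfolding gamma_distribution_def
    by (intro density_cong) (use AE_lborel_singleton[of "0::real"] in \<open>auto elim!: eventually_mono\<close>)
  have rmono: "r z \<le> r w" if "0 \<le> z" "z \<le> w" for z w
    unfolding r_def using that D G by (intro divide_right_mono mult_right_mono power_mono mult_left_mono) auto
  have le: "emeasure (gamma_distribution (a + n) D) B \<le> emeasure (gamma_distribution a D) B"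
    if "\<And>z. z \<in> B \<Longrightarrow> 0 \<le> z \<Longrightarrow> r z \<le> 1" and [measurable]: "B \<in> sets borel" for B
    unfolding eqP eqQ
  proof (simp add: emeasure_density, intro nn_integral_mono)
    fix z
    have "f z * r z \<le> f z" if "z \<in> B"
      using that(1) \<open>\<And>z. z \<in> B \<Longrightarrow> 0 \<le> z \<Longrightarrow> r z \<le> 1\<close>[of z] f0[of z]
        mult_left_mono[of "r z" 1 "f z"]
      by (cases "0 \<le> z") (auto simp: f_def)
    then show "ennreal (f z * r z) * indicator B z \<le> ennreal (f z) * indicator B z"
      by (auto simp: indicator_def intro: ennreal_leI)
  qed
  have ge: "emeasure (gamma_distribution a D) B \<le> emeasure (gamma_distribution (a + n) D) B"
    if "\<And>z. z \<in> B \<Longrightarrow> 0 \<le> z \<Longrightarrow> 1 \<le> r z" and [measurable]: "B \<in> sets borel" for B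
    unfolding eqP eqQ
  proof (simp add: emeasure_density, intro nn_integral_mono)
    fix z
    have "f z \<le> f z * r z" if "z \<in> B"
      using that(1) \<open>\<And>z. z \<in> B \<Longrightarrow> 0 \<le> z \<Longrightarrow> 1 \<le> r z\<close>[of z] f0[of z] mult_left_mono[of 1 "r z" "f z"]
      by (cases "0 \<le> z") (auto simp: f_def)
    then show "ennreal (f z) * indicator B z \<le> ennreal (f z * r z) * indicator B z"
      by (auto simp: indicator_def intro: ennreal_leI)
  qed
  show ?thesis
  proof (cases "x \<ge> 0 \<and> r x \<ge> 1")
    case False
    have "emeasure (gamma_distribution (a + n) D) {..x} \<le> emeasure (gamma_distribution a D) {..x}"
      by (rule le) (use False in \<open>auto simp: not_le intro: order_trans[OF rmono] less_imp_le\<close>)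
    then show ?thesis by (simp add: P.emeasure_eq_measure Q.emeasure_eq_measure)
  next
    case True
    have "emeasure (gamma_distribution a D) {x<..} \<le> emeasure (gamma_distribution (a + n) D) {x<..}"
      by (rule ge) (use True in \<open>auto intro: order_trans[OF _ rmono]\<close>)
    then have "measure (gamma_distribution a D) {x<..} \<le> measure (gamma_distribution (a + n) D) {x<..}"
      by (simp add: P.emeasure_eq_measure Q.emeasure_eq_measure)
    moreover have "{..x} = UNIV - {x<..}" by auto
    ultimately show ?thesis
      using P.prob_compl[of "{x<..}"] Q.prob_compl[of "{x<..}"] by simp
  qed
qed

text \<open>The mass between \<open>u / D\<close> and \<open>(u + 1) / D\<close> suffices: there
  \<open>D * z \<ge> 1\<close>, so \<open>(D * z) powr (a - 1)\<close> is at least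
  \<open>1 / (u + 1)\<close> whatever \<open>a > 0\<close>. The lost factor \<open>u + 1\<close> is
  affordable, since \<open>u\<close> will be a simple or iterated logarithm taken slightly below the
  critical level.\<close>

lemma gamma_distribution_lower_tail:
  assumes a: "a > 0" and D: "D > 0" and u: "1 \<le> u" and x: "D * x \<le> u"
  shows "measure (gamma_distribution a D) {..x} \<le> 1 - exp (- 1 - u) / ((u + 1) * Gamma a)"
proof -
  have G: "Gamma a > 0" using a by simp
  interpret P: prob_space "gamma_distribution a D" by (rule prob_space_gamma_distribution[OF a D])
  define c where "c = D * (exp (- 1 - u) / ((u + 1) * Gamma a))"
  have c0: "c \<ge> 0" using D G u by (simp add: c_def)
  have cle: "c \<le> D powr a * z powr (a - 1) * exp (- D * z) / Gamma a" if z: "u / D < z" "z \<le> (u + 1) / D" for z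
  proof -
    have t: "u \<le> D * z" "D * z \<le> u + 1" using z D by (auto simp: field_simps)
    have z0: "z > 0" using z u D by (smt (verit) divide_nonneg_pos)
    have "D powr a * z powr (a - 1) = D * (D * z) powr (a - 1)"
      using D z0 by (simp add: powr_mult powr_diff)
    moreover have "(D * z) powr (a - 1) \<ge> (D * z) powr (- 1)"
      using t u a by (intro powr_mono) auto
    moreover have "(D * z) powr (- 1) \<ge> 1 / (u + 1)"
      using t u by (simp add: powr_minus divide_simps)
    ultimately have 1: "D powr a * z powr (a - 1) \<ge> D * (1 / (u + 1))"
      using D by (metis mult_left_mono order_less_imp_le order_trans)
    have 2: "exp (- D * z) \<ge> exp (- 1 - u)" using t by simp
    have "D * (1 / (u + 1)) * exp (- 1 - u) \<le> D powr a * z powr (a - 1) * exp (- D * z)"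
      by (rule mult_mono[OF 1 2]) (use u in auto)
    then have "D * (1 / (u + 1)) * exp (- 1 - u) / Gamma a \<le> D powr a * z powr (a - 1) * exp (- D * z) / Gamma a"
      using G by (intro divide_right_mono) auto
    then show ?thesis unfolding c_def by simp
  qed
  have "emeasure (gamma_distribution a D) {u/D<..} \<ge> (\<integral>\<^sup>+z. ennreal c * indicator {u/D<..(u+1)/D} z \<partial>lborel)"
    unfolding gamma_distribution_def
  proof (simp add: emeasure_density, intro nn_integral_mono)
    fix z
    have "0 \<le> z" if "u / D < z"
      using that u D by (smt (verit) divide_nonneg_pos)
    then show "ennreal c * indicator {u/D<..(u+1)/D} z \<le>
        ennreal (indicator {0..} z * (D powr a * z powr (a - 1) * exp (- (D * z))) / Gamma a) * indicator {u/D<..} z"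
      using cle[of z] by (auto simp: indicator_def intro!: ennreal_leI)
  qed
  also have "(\<integral>\<^sup>+z. ennreal c * indicator {u/D<..(u+1)/D} z \<partial>lborel) = ennreal (exp (- 1 - u) / ((u + 1) * Gamma a))"
    using D c0 by (simp add: nn_integral_cmult ennreal_mult''[symmetric] divide_right_mono diff_divide_distrib[symmetric]) (simp add: c_def)
  finally have "exp (- 1 - u) / ((u + 1) * Gamma a) \<le> measure (gamma_distribution a D) {u/D<..}"
    by (simp add: P.emeasure_eq_measure)
  also have "\<dots> \<le> measure (gamma_distribution a D) {x<..}"
    using x D by (intro P.finite_measure_mono) (auto simp: field_simps)
  also have "\<dots> = 1 - measure (gamma_distribution a D) {..x}"
    using P.prob_compl[of "{..x}"] by (simp add: Compl_eq_Diff_UNIV[symmetric])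
  finally show ?thesis by simp
qed

section \<open>Power series with non-negative coefficients\<close>

text \<open>The monomials are listed by one natural number, with repetitions allowed, so that sums
  and products require only a re-enumeration and no collection of equal multi-indices. Convergence
  is demanded on the closed cube; outside it \<open>F\<close> is unconstrained.\<close>

definition nonneg_power_series :: "nat set \<Rightarrow> ((nat \<Rightarrow> real) \<Rightarrow> real) \<Rightarrow> bool" where
  "nonneg_power_series I F \<longleftrightarrow> (\<exists>w (e :: nat \<Rightarrow> nat \<Rightarrow> nat). (\<forall>m. 0 \<le> w m) \<and>
     (\<forall>x. (\<forall>i\<in>I. 0 \<le> x i \<and> x i \<le> 1) \<longrightarrow> (\<lambda>m. w m * (\<Prod>i\<in>I. x i ^ e m i)) sums F x))"

text \<open>Tonelli's theorem for an iterated series, flattened by the Cantor pairing.\<close>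

lemma sums_prod_decode:
  fixes f :: "nat \<Rightarrow> nat \<Rightarrow> real"
  assumes nn: "\<And>r m. 0 \<le> f r m" and inner: "\<And>r. f r sums g r" and outer: "g sums s"
  shows "(\<lambda>n. case prod_decode n of (r, m) \<Rightarrow> f r m) sums s"
proof -
  have inner': "(f r has_sum g r) UNIV" for r
    by (rule sums_nonneg_imp_has_sum[OF inner]) (use nn in auto)
  have g0: "0 \<le> g r" for r using sums_le[OF nn[of r] sums_zero inner] by simp
  have outer': "(g has_sum s) UNIV"
    by (rule sums_nonneg_imp_has_sum[OF outer]) (use g0 in auto)
  have "infsum (\<lambda>m. norm (f r m)) UNIV = g r" for r
    using infsumI[OF inner'[of r]] nn by simp
  then have "(\<lambda>p. norm (f (fst p) (snd p))) summable_on UNIV \<times> UNIV"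
    using inner' outer' nn g0
    by (intro Infinite_Sum.abs_summable_on_Sigma_iff[THEN iffD2]) (auto dest: has_sum_imp_summable)
  then have "(\<lambda>(r, m). f r m) summable_on UNIV \<times> UNIV"
    using nn by (simp add: case_prod_unfold)
  then have "((\<lambda>(r, m). f r m) has_sum s) (UNIV \<times> UNIV)"
    using inner' outer' by (intro has_sum_SigmaI[where g=g]) auto
  then have "((\<lambda>n. case prod_decode n of (r, m) \<Rightarrow> f r m) has_sum s) UNIV"
    by (subst has_sum_reindex_bij_betw[OF bij_prod_decode, of "\<lambda>(r, m). f r m"]) simp
  then show ?thesis by (rule has_sum_imp_sums)
qed

lemma nonneg_power_series_const: "c \<ge> 0 \<Longrightarrow> nonneg_power_series I (\<lambda>_. c)"
  unfolding nonneg_power_series_def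
proof (intro exI conjI allI impI)
  fix x :: "nat \<Rightarrow> real"
  show "(\<lambda>m. (if m = 0 then c else 0) * (\<Prod>i\<in>I. x i ^ 0)) sums c"
    using sums_single[of 0 "\<lambda>_. c"] by simp
qed auto

lemma nonneg_power_series_var:
  assumes "finite I" "i \<in> I"
  shows "nonneg_power_series I (\<lambda>x. x i)"
  unfolding nonneg_power_series_def
proof (intro exI conjI allI impI)
  fix x :: "nat \<Rightarrow> real"
  have "(\<Prod>j\<in>I. x j ^ (if j = i then 1 else 0)) = (\<Prod>j\<in>I. if j = i then x i else 1)"
    by (rule prod.cong) auto
  also have "\<dots> = x i" using assms by simp
  finally have "(\<lambda>m::nat. (if m = 0 then 1 else 0) * (\<Prod>j\<in>I. x j ^ (if j = i then 1 else 0))) =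
      (\<lambda>m::nat. if m = 0 then x i else 0)" by (intro ext) simp
  then show "(\<lambda>m. (if m = 0 then 1 else 0) * (\<Prod>j\<in>I. x j ^ (if j = i then 1 else 0))) sums x i"
    using sums_single[of 0 "\<lambda>_. x i"] by (simp only:)
qed auto

lemma nonneg_power_series_nonneg:
  assumes "nonneg_power_series I F" "\<And>i. i \<in> I \<Longrightarrow> 0 \<le> x i \<and> x i \<le> 1"
  shows "0 \<le> F x"
proof -
  from assms obtain w e where w: "\<And>m. 0 \<le> w m" and s: "(\<lambda>m. w m * (\<Prod>i\<in>I. x i ^ e m i)) sums F x"
    unfolding nonneg_power_series_def by metis
  show ?thesis
    by (rule sums_le[OF _ sums_zero s]) (use w assms(2) in \<open>auto intro!: mult_nonneg_nonneg prod_nonneg\<close>)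
qed

lemma nonneg_power_series_le_top:
  assumes "nonneg_power_series I F" "\<And>i. i \<in> I \<Longrightarrow> 0 \<le> x i \<and> x i \<le> 1"
  shows "F x \<le> F (\<lambda>_. 1)"
proof -
  from assms(1) obtain w e where w: "\<And>m. 0 \<le> w m"
    and s: "\<And>x. (\<forall>i\<in>I. 0 \<le> x i \<and> x i \<le> 1) \<Longrightarrow> (\<lambda>m. w m * (\<Prod>i\<in>I. x i ^ e m i)) sums F x"
    unfolding nonneg_power_series_def by metis
  show ?thesis
    by (rule sums_le[OF _ s s])
      (use w assms(2) in \<open>auto intro!: mult_left_le prod_le_1 simp: power_le_one\<close>)
qed

lemma nonneg_power_series_suminf:
  assumes F: "\<And>r. nonneg_power_series I (F r)"
    and G: "\<And>x. (\<forall>i\<in>I. 0 \<le> x i \<and> x i \<le> 1) \<Longrightarrow> (\<lambda>r. F r x) sums G x"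
  shows "nonneg_power_series I G"
proof -
  from F have "\<forall>r. \<exists>w e. (\<forall>m. 0 \<le> w m) \<and>
     (\<forall>x. (\<forall>i\<in>I. 0 \<le> x i \<and> x i \<le> 1) \<longrightarrow> (\<lambda>m. w m * (\<Prod>i\<in>I. x i ^ e m i)) sums F r x)"
    unfolding nonneg_power_series_def by blast
  then obtain w e where w: "\<And>r m. 0 \<le> w r m"
    and s: "\<And>r x. (\<forall>i\<in>I. 0 \<le> x i \<and> x i \<le> 1) \<Longrightarrow> (\<lambda>m. w r m * (\<Prod>i\<in>I. x i ^ e r m i)) sums F r x"
    by metis
  show ?thesis
    unfolding nonneg_power_series_def
  proof (intro exI[of _ "\<lambda>n. case prod_decode n of (r, m) \<Rightarrow> w r m"]
      exI[of _ "\<lambda>n. case prod_decode n of (r, m) \<Rightarrow> e r m"] conjI allI impI)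
    fix n show "0 \<le> (case prod_decode n of (r, m) \<Rightarrow> w r m)" using w by (auto split: prod.split)
  next
    fix x assume x: "\<forall>i\<in>I. 0 \<le> x i \<and> x i \<le> (1::real)"
    have "(\<lambda>n. case prod_decode n of (r, m) \<Rightarrow> w r m * (\<Prod>i\<in>I. x i ^ e r m i)) sums G x"
      by (rule sums_prod_decode[OF _ s[OF x] G[OF x]])
        (use w x in \<open>auto intro!: mult_nonneg_nonneg prod_nonneg\<close>)
    then show "(\<lambda>n. (case prod_decode n of (r, m) \<Rightarrow> w r m) * (\<Prod>i\<in>I. x i ^ (case prod_decode n of (r, m) \<Rightarrow> e r m) i)) sums G x"
      by (rule sums_cong[THEN iffD1, rotated]) (auto split: prod.split)
  qed
qed

lemma nonneg_power_series_add:
  assumes "nonneg_power_series I F" "nonneg_power_series I G"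
  shows "nonneg_power_series I (\<lambda>x. F x + G x)"
proof (rule nonneg_power_series_suminf)
  define H where "H r = (if r = 0 then F else if r = 1 then G else (\<lambda>_. 0))" for r :: nat
  show "nonneg_power_series I (H r)" for r
    using assms nonneg_power_series_const[of 0 I] by (simp add: H_def)
  show "(\<lambda>r. H r x) sums (F x + G x)" for x
    using sums_finite[of "{0,1}" "\<lambda>r. H r x"] by (simp add: H_def)
qed

lemma nonneg_power_series_mult:
  assumes "nonneg_power_series I F" "nonneg_power_series I G"
  shows "nonneg_power_series I (\<lambda>x. F x * G x)"
proof -
  from assms(1) obtain w e where w: "\<And>m. 0 \<le> w m"
    and s: "\<And>x. (\<forall>i\<in>I. 0 \<le> x i \<and> x i \<le> 1) \<Longrightarrow> (\<lambda>m. w m * (\<Prod>i\<in>I. x i ^ e m i)) sums F x"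
    unfolding nonneg_power_series_def by metis
  from assms(2) obtain v d where v: "\<And>m. 0 \<le> v m"
    and t: "\<And>x. (\<forall>i\<in>I. 0 \<le> x i \<and> x i \<le> 1) \<Longrightarrow> (\<lambda>m. v m * (\<Prod>i\<in>I. x i ^ d m i)) sums G x"
    unfolding nonneg_power_series_def by metis
  show ?thesis
  proof (rule nonneg_power_series_suminf)
    show "nonneg_power_series I (\<lambda>x. (w r * (\<Prod>i\<in>I. x i ^ e r i)) * G x)" for r
      unfolding nonneg_power_series_def
    proof (intro exI[of _ "\<lambda>m. w r * v m"] exI[of _ "\<lambda>m i. e r i + d m i"] conjI allI impI)
      fix x assume x: "\<forall>i\<in>I. 0 \<le> x i \<and> x i \<le> (1::real)"
      show "(\<lambda>m. w r * v m * (\<Prod>i\<in>I. x i ^ (e r i + d m i))) sums (w r * (\<Prod>i\<in>I. x i ^ e r i) * G x)"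
        using sums_mult[OF t[OF x], of "w r * (\<Prod>i\<in>I. x i ^ e r i)"]
        by (simp add: power_add prod.distrib mult_ac)
    qed (use w v in auto)
    show "(\<lambda>r. (w r * (\<Prod>i\<in>I. x i ^ e r i)) * G x) sums (F x * G x)"
      if "\<forall>i\<in>I. 0 \<le> x i \<and> x i \<le> 1" for x
      by (rule sums_mult2[OF s[OF that]])
  qed
qed

lemma nonneg_power_series_power:
  "nonneg_power_series I F \<Longrightarrow> nonneg_power_series I (\<lambda>x. F x ^ n)"
  by (induction n) (simp_all add: nonneg_power_series_const nonneg_power_series_mult)

text \<open>For \<open>a > 0\<close> all Taylor coefficients of \<open>(1 - y) powr (- a)\<close> at
  zero are non-negative. A series with non-negative coefficients is largest at the top corner of the
  cube, so one inequality there keeps \<open>F\<close> inside the disc of convergence.\<close>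

lemma nonneg_power_series_binomial:
  assumes F: "nonneg_power_series I F" and lt: "F (\<lambda>_. 1) < 1" and a: "a > 0"
  shows "\<exists>G. nonneg_power_series I G \<and> (\<forall>x. (\<forall>i\<in>I. 0 \<le> x i \<and> x i \<le> 1) \<longrightarrow> G x = (1 - F x) powr (- a))"
proof -
  have bin: "(\<lambda>n. (pochhammer a n / fact n) * F x ^ n) sums (1 - F x) powr (- a)"
    if x: "\<forall>i\<in>I. 0 \<le> x i \<and> x i \<le> 1" for x
  proof -
    have "0 \<le> F x" "F x < 1"
      using nonneg_power_series_nonneg[OF F, of x] nonneg_power_series_le_top[OF F, of x] x lt by auto
    then have "(\<lambda>n. ((- a) gchoose n) * (- F x) ^ n) sums (1 + - F x) powr (- a)"
      by (intro gen_binomial_real) auto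
    moreover have "((- a) gchoose n) * (- F x) ^ n = (pochhammer a n / fact n) * F x ^ n" for n
    proof -
      have "(- F x) ^ n = (- 1) ^ n * F x ^ n"
        by (metis mult_minus1 power_mult_distrib)
      moreover have "(- 1 :: real) ^ n * (- 1) ^ n = 1"
        by (metis mult_minus1 minus_minus power_mult_distrib power_one)
      ultimately show ?thesis
        by (simp add: gbinomial_pochhammer)
    qed
    ultimately show ?thesis by simp
  qed
  define G where "G x = (if \<forall>i\<in>I. 0 \<le> x i \<and> x i \<le> 1 then (1 - F x) powr (- a) else 0)" for x
  have "nonneg_power_series I G"
  proof (rule nonneg_power_series_suminf)
    show "nonneg_power_series I (\<lambda>x. (pochhammer a r / fact r) * F x ^ r)" for r
      by (intro nonneg_power_series_mult nonneg_power_series_const nonneg_power_series_power F)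
        (use a in \<open>simp add: pochhammer_nonneg\<close>)
  qed (use bin in \<open>simp add: G_def\<close>)
  then show ?thesis
    by (intro exI[of _ G]) (auto simp: G_def)
qed

section \<open>Schur complements and negative powers of determinants of M-matrices\<close>

lemma det_eliminate_last:
  fixes M :: "nat \<Rightarrow> nat \<Rightarrow> real"
  assumes nz: "M n n \<noteq> 0"
  shows "Determinant.det (Matrix.mat (Suc n) (Suc n) (\<lambda>(i, j). M i j)) =
    M n n * Determinant.det (Matrix.mat n n (\<lambda>(i, j). M i j - M i n * M n j / M n n))"
proof -
  define A where "A = Matrix.mat n n (\<lambda>(i, j). M i j)"
  define B where "B = Matrix.mat n 1 (\<lambda>(i, j). M i n)"
  define C where "C = Matrix.mat 1 n (\<lambda>(i, j). M n j)"
  define D where "D = Matrix.mat 1 1 (\<lambda>(i, j). M n n)"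
  define E where "E = Matrix.mat 1 n (\<lambda>(i, j). - (M n j / M n n))"
  \<comment> \<open>Right multiplication by this unit lower triangular matrix clears the last row
    apart from the pivot; the upper left block becomes the Schur complement.\<close>
  define U where "U = four_block_mat (1\<^sub>m n) (0\<^sub>m n 1) E (1\<^sub>m 1)"
  note defs = A_def B_def C_def D_def E_def
  have carr: "A \<in> carrier_mat n n" "B \<in> carrier_mat n 1" "C \<in> carrier_mat 1 n" "D \<in> carrier_mat 1 1" "E \<in> carrier_mat 1 n"
    by (simp_all add: defs)
  have M: "Matrix.mat (Suc n) (Suc n) (\<lambda>(i, j). M i j) = four_block_mat A B C D"
    by (rule eq_matI) (auto simp: defs less_Suc_eq)
  have detU: "Determinant.det U = 1"
    unfolding U_def by (subst det_four_block_mat_upper_right_zero[where n=n and m=1]) (use carr in auto)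
  have "four_block_mat A B C D * U =
      four_block_mat (A * 1\<^sub>m n + B * E) (A * 0\<^sub>m n 1 + B * 1\<^sub>m 1) (C * 1\<^sub>m n + D * E) (C * 0\<^sub>m n 1 + D * 1\<^sub>m 1)"
    unfolding U_def by (rule mult_four_block_mat) (use carr in auto)
  also have "A * 0\<^sub>m n 1 + B * 1\<^sub>m 1 = B" using carr by auto
  also have "C * 0\<^sub>m n 1 + D * 1\<^sub>m 1 = D" using carr by auto
  also have "C * 1\<^sub>m n + D * E = 0\<^sub>m 1 n"
    by (rule eq_matI) (use carr nz in \<open>auto simp: defs scalar_prod_def\<close>)
  also have "A * 1\<^sub>m n + B * E = Matrix.mat n n (\<lambda>(i, j). M i j - M i n * M n j / M n n)"
    by (rule eq_matI) (use carr nz in \<open>auto simp: defs scalar_prod_def\<close>)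
  finally have eq: "four_block_mat A B C D * U =
      four_block_mat (Matrix.mat n n (\<lambda>(i, j). M i j - M i n * M n j / M n n)) B (0\<^sub>m 1 n) D" .
  have "Determinant.det (four_block_mat A B C D * U) = Determinant.det (four_block_mat A B C D) * Determinant.det U"
  proof (rule det_mult[where n="Suc n"])
    show "four_block_mat A B C D \<in> carrier_mat (Suc n) (Suc n)"
      using four_block_carrier_mat[OF carr(1) carr(4), of B C] by simp
    show "U \<in> carrier_mat (Suc n) (Suc n)"
      using four_block_carrier_mat[of "1\<^sub>m n" n n "1\<^sub>m 1" 1 1 "0\<^sub>m n 1" E] by (simp add: U_def)
  qed
  moreover have "Determinant.det (four_block_mat A B C D * U) =
      Determinant.det (Matrix.mat n n (\<lambda>(i, j). M i j - M i n * M n j / M n n)) * Determinant.det D"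
    unfolding eq by (rule det_four_block_mat_lower_left_zero[where n=n and m=1]) (use carr in auto)
  moreover have "Determinant.det D = M n n"
    by (subst det_single) (simp_all add: D_def)
  ultimately show ?thesis using detU M by (simp add: mult.commute)
qed

text \<open>
  Eliminating the last row and column of a diagonally dominant matrix with nonpositive off-diagonal
  entries keeps this form, and every pivot contributes a binomial series with nonnegative coefficients.
\<close>

lemma det_powr_power_series:
  fixes N :: "nat \<Rightarrow> nat \<Rightarrow> (nat \<Rightarrow> real) \<Rightarrow> real" and D v :: "nat \<Rightarrow> real"
  assumes I: "finite I" and a: "a > 0"
    and "{..<n} \<subseteq> I" and "\<And>i. i < n \<Longrightarrow> 0 < D i"
    and "\<And>i j. i < n \<Longrightarrow> j < n \<Longrightarrow> nonneg_power_series I (N i j)"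
    and "\<And>i. i < n \<Longrightarrow> 0 < v i"
    and "\<And>i. i < n \<Longrightarrow> (\<Sum>j<n. N i j (\<lambda>_. 1) * v j) < D i * v i"
  shows "\<exists>G. nonneg_power_series I G \<and> (\<forall>x. (\<forall>i\<in>I. 0 \<le> x i \<and> x i \<le> 1) \<and> (\<forall>i<n. 0 < x i) \<longrightarrow>
    0 < Determinant.det (Matrix.mat n n (\<lambda>(i, j). (if i = j then D i / x i else 0) - N i j x)) \<and>
    Determinant.det (Matrix.mat n n (\<lambda>(i, j). (if i = j then D i / x i else 0) - N i j x)) powr (- a) =
      (\<Prod>i<n. x i powr a) * G x)"
  using assms(3-)
proof (induction n arbitrary: N)
  case 0
  show ?case
    by (rule exI[of _ "\<lambda>_. 1"]) (auto intro: nonneg_power_series_const)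
next
  case (Suc n)
  note nps = nonneg_power_series_mult nonneg_power_series_add nonneg_power_series_const
  have Dn: "D n > 0" and vn: "v n > 0" using Suc.prems by auto
  have nI: "n \<in> I" using Suc.prems(1) by auto
  have Npos: "0 \<le> N i j x" if "i < Suc n" "j < Suc n" "\<forall>i\<in>I. 0 \<le> x i \<and> x i \<le> 1" for i j x
    using nonneg_power_series_nonneg[OF Suc.prems(3)[OF that(1,2)]] that(3) by blast
  have N1: "0 \<le> N i j (\<lambda>_. 1)" if "i < Suc n" "j < Suc n" for i j
    using Npos[OF that] by simp
  \<comment> \<open>The pivot equals \<open>(D n / x n) * (1 - Q x)\<close>, and the last row of the
    dominance condition gives \<open>Q < 1\<close> at the top corner. So both its inverse and its
    power \<open>- a\<close> are binomial series, up to explicit powers of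
    \<open>x n\<close>.\<close>
  define Q where "Q x = (1 / D n) * x n * N n n x" for x
  have Q: "nonneg_power_series I Q"
    unfolding Q_def using Dn Suc.prems(3) I nI by (intro nps nonneg_power_series_var) auto
  have row: "N n n (\<lambda>_. 1) * v n + (\<Sum>j<n. N n j (\<lambda>_. 1) * v j) < D n * v n"
    using Suc.prems(5)[of n] by (simp add: add.commute)
  have "0 \<le> (\<Sum>j<n. N n j (\<lambda>_. 1) * v j)"
    using N1 Suc.prems(4) by (intro sum_nonneg mult_nonneg_nonneg) (auto intro: less_imp_le)
  with row have "N n n (\<lambda>_. 1) * v n < D n * v n" by simp
  then have lt: "N n n (\<lambda>_. 1) < D n" using vn by simp
  then have Qlt: "Q (\<lambda>_. 1) < 1" using Dn by (simp add: Q_def)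
  obtain G1 where G1: "nonneg_power_series I G1"
    and G1eq: "\<And>x. (\<forall>i\<in>I. 0 \<le> x i \<and> x i \<le> 1) \<Longrightarrow> G1 x = (1 - Q x) powr (- 1)"
    using nonneg_power_series_binomial[OF Q Qlt, of 1] by auto
  obtain G2 where G2: "nonneg_power_series I G2"
    and G2eq: "\<And>x. (\<forall>i\<in>I. 0 \<le> x i \<and> x i \<le> 1) \<Longrightarrow> G2 x = (1 - Q x) powr (- a)"
    using nonneg_power_series_binomial[OF Q Qlt a] by auto
  have Q1: "Q x < 1" if "\<forall>i\<in>I. 0 \<le> x i \<and> x i \<le> 1" for x
    using nonneg_power_series_le_top[OF Q, of x] that Qlt by auto
  define R where "R x = (1 / D n) * x n * G1 x" for x
  have R: "nonneg_power_series I R"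
    unfolding R_def using Dn G1 I nI by (intro nps nonneg_power_series_var) auto
  have Req: "R x = 1 / (D n / x n - N n n x)" if "\<forall>i\<in>I. 0 \<le> x i \<and> x i \<le> 1" "0 < x n" for x
  proof -
    have "D n / x n - N n n x = (D n / x n) * (1 - Q x)"
      using Dn that(2) by (simp add: Q_def field_simps)
    moreover have "G1 x = 1 / (1 - Q x)"
      using G1eq[OF that(1)] Q1[OF that(1)] by (simp add: powr_minus_divide)
    ultimately show ?thesis by (simp add: R_def)
  qed
  \<comment> \<open>The two minus signs of the off-diagonal factors cancel, so elimination adds a
    product of non-negative series to \<open>N\<close> and the coefficients stay
    non-negative.\<close>
  define N' where "N' i j x = N i j x + N i n x * N n j x * R x" for i j x
  have "\<exists>G. nonneg_power_series I G \<and> (\<forall>x. (\<forall>i\<in>I. 0 \<le> x i \<and> x i \<le> 1) \<and> (\<forall>i<n. 0 < x i) \<longrightarrow>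
    0 < Determinant.det (Matrix.mat n n (\<lambda>(i, j). (if i = j then D i / x i else 0) - N' i j x)) \<and>
    Determinant.det (Matrix.mat n n (\<lambda>(i, j). (if i = j then D i / x i else 0) - N' i j x)) powr (- a) =
      (\<Prod>i<n. x i powr a) * G x)"
  proof (rule Suc.IH)
    show "nonneg_power_series I (N' i j)" if "i < n" "j < n" for i j
      unfolding N'_def using that Suc.prems(3) R by (intro nps) auto
    fix i assume i: "i < n"
    define r where "r = R (\<lambda>_. 1)"
    have r: "r = 1 / (D n - N n n (\<lambda>_. 1))" using Req[of "\<lambda>_. 1"] by (simp add: r_def)
    \<comment> \<open>Row \<open>n\<close> of the dominance condition, solved for
      \<open>v n\<close>. It shows that the term added to row \<open>i\<close> costs no more than
      the term \<open>N i n * v n\<close> that row \<open>i\<close> loses.\<close>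
    have "(\<Sum>j<n. N n j (\<lambda>_. 1) * v j) * r \<le> v n"
      using row lt by (simp add: r divide_simps) (simp add: algebra_simps)
    then have "N i n (\<lambda>_. 1) * ((\<Sum>j<n. N n j (\<lambda>_. 1) * v j) * r) \<le> N i n (\<lambda>_. 1) * v n"
      using N1[of i n] i by (intro mult_left_mono) auto
    moreover have "(\<Sum>j<n. N' i j (\<lambda>_. 1) * v j) =
        (\<Sum>j<n. N i j (\<lambda>_. 1) * v j) + N i n (\<lambda>_. 1) * ((\<Sum>j<n. N n j (\<lambda>_. 1) * v j) * r)"
      by (simp add: N'_def r_def sum.distrib sum_distrib_left sum_distrib_right algebra_simps)
    ultimately show "(\<Sum>j<n. N' i j (\<lambda>_. 1) * v j) < D i * v i"
      using Suc.prems(5)[of i] i by simp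
  qed (use Suc.prems in auto)
  then obtain G where G: "nonneg_power_series I G"
    and Gdet: "\<And>x. (\<forall>i\<in>I. 0 \<le> x i \<and> x i \<le> 1) \<Longrightarrow> (\<forall>i<n. 0 < x i) \<Longrightarrow>
      0 < Determinant.det (Matrix.mat n n (\<lambda>(i, j). (if i = j then D i / x i else 0) - N' i j x)) \<and>
      Determinant.det (Matrix.mat n n (\<lambda>(i, j). (if i = j then D i / x i else 0) - N' i j x)) powr (- a) =
      (\<Prod>i<n. x i powr a) * G x"
    by blast
  show ?case
  proof (intro exI[of _ "\<lambda>x. (D n powr (- a)) * G2 x * G x"] conjI allI impI; (elim conjE)?)
    show "nonneg_power_series I (\<lambda>x. (D n powr (- a)) * G2 x * G x)"
      using G G2 by (intro nps) auto
    fix x assume x: "\<forall>i\<in>I. 0 \<le> x i \<and> x i \<le> (1::real)" and x0: "\<forall>i<Suc n. 0 < x i"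
    define M where "M i j = (if i = j then D i / x i else 0) - N i j x" for i j
    have xn: "x n > 0" using x0 by simp
    have pivot: "M n n = (D n / x n) * (1 - Q x)"
      using Dn xn by (simp add: M_def Q_def field_simps)
    then have Mpos: "M n n > 0" using Q1[OF x] Dn xn by simp
    have inv: "R x = 1 / M n n" using Req[OF x xn] by (simp add: M_def)
    have "Matrix.mat n n (\<lambda>(i, j). M i j - M i n * M n j / M n n) =
        Matrix.mat n n (\<lambda>(i, j). (if i = j then D i / x i else 0) - N' i j x)"
      by (rule eq_matI) (auto simp: M_def[of _ _] N'_def inv)
    then have det: "Determinant.det (Matrix.mat (Suc n) (Suc n) (\<lambda>(i, j). M i j)) =
        M n n * Determinant.det (Matrix.mat n n (\<lambda>(i, j). (if i = j then D i / x i else 0) - N' i j x))"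
      using det_eliminate_last[of M n] Mpos by simp
    have IH: "0 < Determinant.det (Matrix.mat n n (\<lambda>(i, j). (if i = j then D i / x i else 0) - N' i j x))"
      "Determinant.det (Matrix.mat n n (\<lambda>(i, j). (if i = j then D i / x i else 0) - N' i j x)) powr (- a) =
      (\<Prod>i<n. x i powr a) * G x"
      using Gdet[OF x] x0 by auto
    show "0 < Determinant.det (Matrix.mat (Suc n) (Suc n) (\<lambda>(i, j). (if i = j then D i / x i else 0) - N i j x))"
      using det Mpos IH(1) by (simp add: M_def)
    have "M n n powr (- a) = D n powr (- a) * x n powr a * G2 x"
      unfolding pivot G2eq[OF x] using Dn xn Q1[OF x] by (simp add: powr_mult powr_divide powr_minus divide_simps)
    then show "Determinant.det (Matrix.mat (Suc n) (Suc n) (\<lambda>(i, j). (if i = j then D i / x i else 0) - N i j x)) powr (- a) =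
        (\<Prod>i<Suc n. x i powr a) * ((D n powr (- a)) * G2 x * G x)"
      using det Mpos IH by (simp add: M_def[abs_def] powr_mult)
  qed
qed

text \<open>The substitution \<open>x i = B i i / (B i i + s i)\<close> turns
  \<open>B i i / x i\<close> into \<open>B i i + s i\<close> and maps \<open>s \<ge> 0\<close> into
  the cube. The factor \<open>x i powr a\<close> split off by each pivot is the reason why every
  shape in the mixture is at least \<open>a\<close>. The vector \<open>v\<close> is the positivity
  certificate of an M-matrix.\<close>

lemma mmatrix_det_powr_expansion:
  fixes B :: "nat \<Rightarrow> nat \<Rightarrow> real" and v :: "nat \<Rightarrow> real"
  assumes a: "a > 0"
    and off: "\<And>i j. i < n \<Longrightarrow> j < n \<Longrightarrow> i \<noteq> j \<Longrightarrow> B i j \<le> 0"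
    and v: "\<And>i. i < n \<Longrightarrow> 0 < v i"
    and Bv: "\<And>i. i < n \<Longrightarrow> 0 < (\<Sum>j<n. B i j * v j)"
  shows "(\<forall>i<n. 0 < B i i) \<and>
    (\<exists>w (e :: nat \<Rightarrow> nat \<Rightarrow> nat). (\<forall>m. 0 \<le> w m) \<and> (\<forall>s. (\<forall>i<n. 0 \<le> s i) \<longrightarrow>
      0 < Determinant.det (Matrix.mat n n (\<lambda>(i, j). B i j + (if i = j then s i else 0))) \<and>
      (\<lambda>m. w m * (\<Prod>i<n. (B i i / (B i i + s i)) powr (a + e m i))) sums
        Determinant.det (Matrix.mat n n (\<lambda>(i, j). B i j + (if i = j then s i else 0))) powr (- a)))"
proof -
  have diag: "0 < B i i" if i: "i < n" for i
  proof -
    have "(\<Sum>j<n. B i j * v j) = B i i * v i + (\<Sum>j\<in>{..<n} - {i}. B i j * v j)"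
      using i by (subst sum.remove[of _ i]) auto
    moreover have "(\<Sum>j\<in>{..<n} - {i}. B i j * v j) \<le> 0"
      using off[OF i] v by (intro sum_nonpos mult_nonpos_nonneg) (auto intro: less_imp_le)
    ultimately have "0 < B i i * v i" using Bv[OF i] by simp
    then show ?thesis using v[OF i] by (simp add: zero_less_mult_iff)
  qed
  define N where "N i j x = (if i = j then 0 else - B i j)" for i j and x :: "nat \<Rightarrow> real"
  have "\<exists>G. nonneg_power_series {..<n} G \<and> (\<forall>x. (\<forall>i\<in>{..<n}. 0 \<le> x i \<and> x i \<le> 1) \<and> (\<forall>i<n. 0 < x i) \<longrightarrow>
    0 < Determinant.det (Matrix.mat n n (\<lambda>(i, j). (if i = j then B i i / x i else 0) - N i j x)) \<and>
    Determinant.det (Matrix.mat n n (\<lambda>(i, j). (if i = j then B i i / x i else 0) - N i j x)) powr (- a) =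
      (\<Prod>i<n. x i powr a) * G x)"
  proof (rule det_powr_power_series[where v=v])
    show "nonneg_power_series {..<n} (N i j)" if "i < n" "j < n" for i j
      unfolding N_def using off[OF that] by (intro nonneg_power_series_const) auto
    fix i assume i: "i < n"
    have "(\<Sum>j<n. N i j (\<lambda>_. 1) * v j) = (\<Sum>j\<in>{..<n} - {i}. - (B i j * v j))"
      using i by (subst sum.remove[of _ i]) (auto simp: N_def intro!: sum.cong)
    moreover have "(\<Sum>j<n. B i j * v j) = B i i * v i + (\<Sum>j\<in>{..<n} - {i}. B i j * v j)"
      using i by (subst sum.remove[of _ i]) auto
    ultimately show "(\<Sum>j<n. N i j (\<lambda>_. 1) * v j) < B i i * v i"
      using Bv[OF i] by (simp add: sum_negf)
  qed (use a v diag in auto)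
  then obtain G where G: "nonneg_power_series {..<n} G"
    and Gdet: "\<And>x. (\<forall>i\<in>{..<n}. 0 \<le> x i \<and> x i \<le> 1) \<Longrightarrow> (\<forall>i<n. 0 < x i) \<Longrightarrow>
      0 < Determinant.det (Matrix.mat n n (\<lambda>(i, j). (if i = j then B i i / x i else 0) - N i j x)) \<and>
      Determinant.det (Matrix.mat n n (\<lambda>(i, j). (if i = j then B i i / x i else 0) - N i j x)) powr (- a) =
      (\<Prod>i<n. x i powr a) * G x" by blast
  from G obtain w e where w: "\<And>m. 0 \<le> w m" and
    G: "\<And>x. (\<forall>i\<in>{..<n}. 0 \<le> x i \<and> x i \<le> 1) \<Longrightarrow> (\<lambda>m. w m * (\<Prod>i<n. x i ^ e m i)) sums G x"
    unfolding nonneg_power_series_def by blast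
  show ?thesis
  proof (intro conjI exI[of _ w] exI[of _ e] allI impI)
    fix s :: "nat \<Rightarrow> real" assume s: "\<forall>i<n. 0 \<le> s i"
    define x where "x i = B i i / (B i i + s i)" for i
    have x: "0 < x i" "x i \<le> 1" "B i i / x i = B i i + s i" if "i < n" for i
      using diag[OF that] s that by (auto simp: x_def add_pos_nonneg)
    have meq: "Matrix.mat n n (\<lambda>(i, j). (if i = j then B i i / x i else 0) - N i j x) =
        Matrix.mat n n (\<lambda>(i, j). B i j + (if i = j then s i else 0))"
      by (rule eq_matI) (auto simp: N_def x(3))
    show "0 < Determinant.det (Matrix.mat n n (\<lambda>(i, j). B i j + (if i = j then s i else 0)))"
      using Gdet[of x] x meq by (simp add: less_imp_le)
    have "(\<lambda>m. (\<Prod>i<n. x i powr a) * (w m * (\<Prod>i<n. x i ^ e m i))) sums ((\<Prod>i<n. x i powr a) * G x)"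
      by (intro sums_mult G) (use x in \<open>auto intro: less_imp_le\<close>)
    moreover have "(\<Prod>i<n. x i powr a) * (w m * (\<Prod>i<n. x i ^ e m i)) = w m * (\<Prod>i<n. x i powr (a + e m i))" for m
      using x by (simp add: powr_add powr_realpow prod.distrib)
    moreover have "Determinant.det (Matrix.mat n n (\<lambda>(i, j). B i j + (if i = j then s i else 0))) powr (- a) =
        (\<Prod>i<n. x i powr a) * G x"
      using Gdet[of x] x(1,2) meq by (simp add: less_imp_le)
    ultimately show "(\<lambda>m. w m * (\<Prod>i<n. (B i i / (B i i + s i)) powr (a + e m i))) sums
        Determinant.det (Matrix.mat n n (\<lambda>(i, j). B i j + (if i = j then s i else 0))) powr (- a)"
      unfolding x_def[symmetric] by simp
  qed (use diag w in auto)
qed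

section \<open>Mixtures of gamma distributions\<close>

text \<open>
  Induction on the number of exponential factors that are replaced by indicators, each replacement
  being an instance of the uniqueness of Laplace transforms.
\<close>

lemma gamma_mixture_law:
  fixes Z :: "nat \<Rightarrow> 'b \<Rightarrow> real" and D :: "nat \<Rightarrow> real" and e :: "nat \<Rightarrow> nat \<Rightarrow> nat"
    and u :: "nat \<Rightarrow> real \<Rightarrow> ennreal" and a :: real
  defines "\<gamma> \<equiv> \<lambda>m i. gamma_distribution (a + e m i) (D i)"
  assumes M: "prob_space M" and a: "a > 0" and D: "\<And>i. i < n \<Longrightarrow> 0 < D i"
    and Z: "\<And>i. i < n \<Longrightarrow> Z i \<in> borel_measurable M"
    and Z0: "\<And>i \<omega>. i < n \<Longrightarrow> \<omega> \<in> space M \<Longrightarrow> 0 \<le> Z i \<omega>"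
    and w: "\<And>m. 0 \<le> w m"
    and lap: "\<And>s. (\<And>i. i < n \<Longrightarrow> 0 < s i) \<Longrightarrow>
      (\<lambda>m. w m * (\<Prod>i<n. (D i / (D i + s i)) powr (a + e m i))) sums (LINT \<omega>|M. exp (- (\<Sum>i<n. s i * Z i \<omega>)))"
    and "j \<le> n"
    and "\<And>i. i < j \<Longrightarrow> \<exists>A\<in>sets borel. u i = indicator A"
    and "\<And>i. j \<le> i \<Longrightarrow> i < n \<Longrightarrow> \<exists>s>0. u i = (\<lambda>z. ennreal (exp (- s * z)))"
  shows "(\<integral>\<^sup>+\<omega>. (\<Prod>i<n. u i (Z i \<omega>)) \<partial>M) = (\<Sum>m. ennreal (w m) * (\<Prod>i<n. \<integral>\<^sup>+z. u i z \<partial>\<gamma> m i))"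
  using assms(9-)
proof (induction j arbitrary: u)
  case 0
  interpret prob_space M by fact
  from 0(3) have "\<forall>i. \<exists>s. i < n \<longrightarrow> s > 0 \<and> u i = (\<lambda>z. ennreal (exp (- s * z)))" by auto
  then obtain s where s: "\<And>i. i < n \<Longrightarrow> s i > 0" and u: "\<And>i. i < n \<Longrightarrow> u i = (\<lambda>z. ennreal (exp (- s i * z)))"
    by metis
  have [measurable]: "(\<lambda>\<omega>. \<Sum>i<n. s i * Z i \<omega>) \<in> borel_measurable M"
    using Z by measurable
  have prod_u: "(\<Prod>i<n. u i (Z i \<omega>)) = ennreal (exp (- (\<Sum>i<n. s i * Z i \<omega>)))" for \<omega>
    using u by (simp add: prod_ennreal exp_sum flip: sum_negf)
  have int: "integrable M (\<lambda>\<omega>. exp (- (\<Sum>i<n. s i * Z i \<omega>)))"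
  proof (rule integrable_const_bound[of _ 1])
    show "AE \<omega> in M. norm (exp (- (\<Sum>i<n. s i * Z i \<omega>))) \<le> 1"
    proof (rule AE_I2)
      fix \<omega> assume "\<omega> \<in> space M"
      then have "0 \<le> (\<Sum>i<n. s i * Z i \<omega>)"
        using s Z0 by (intro sum_nonneg mult_nonneg_nonneg) (auto intro: less_imp_le)
      then show "norm (exp (- (\<Sum>i<n. s i * Z i \<omega>))) \<le> 1" by simp
    qed
  qed simp
  have "(\<integral>\<^sup>+\<omega>. (\<Prod>i<n. u i (Z i \<omega>)) \<partial>M) = ennreal (LINT \<omega>|M. exp (- (\<Sum>i<n. s i * Z i \<omega>)))"
    unfolding prod_u by (rule nn_integral_eq_integral[OF int]) simp
  also have "\<dots> = (\<Sum>m. ennreal (w m * (\<Prod>i<n. (D i / (D i + s i)) powr (a + e m i))))"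
    by (rule suminf_ennreal_eq[symmetric]) (use w lap[of s] s in \<open>auto intro!: mult_nonneg_nonneg prod_nonneg\<close>)
  also have "\<dots> = (\<Sum>m. ennreal (w m) * (\<Prod>i<n. \<integral>\<^sup>+z. u i z \<partial>\<gamma> m i))"
  proof (rule suminf_cong)
    fix m
    have "(\<integral>\<^sup>+z. u i z \<partial>\<gamma> m i) = ennreal ((D i / (D i + s i)) powr (a + e m i))" if "i < n" for i
      unfolding \<gamma>_def u[OF that]
      by (rule laplace_gamma_distribution) (use a D[OF that] s[OF that] in \<open>auto intro: add_pos_nonneg\<close>)
    then show "ennreal (w m * (\<Prod>i<n. (D i / (D i + s i)) powr (a + e m i))) = ennreal (w m) * (\<Prod>i<n. \<integral>\<^sup>+z. u i z \<partial>\<gamma> m i)"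
      using w by (simp add: prod_ennreal ennreal_mult'' prod_nonneg)
  qed
  finally show ?case .
next
  case (Suc j)
  interpret prob_space M by fact
  have jn: "j < n" using Suc.prems(1) by simp
  have [measurable]: "Z i \<in> borel_measurable M" if "i < n" for i using Z that by simp
  have um: "u i \<in> borel_measurable borel" if "i < n" for i
    using Suc.prems(2)[of i] Suc.prems(3)[of i] that by (cases "i < Suc j") auto
  have u1: "u i z \<le> 1" if "i < n" "0 \<le> z" for i z
    using Suc.prems(2)[of i] Suc.prems(3)[of i] that
    by (cases "i < Suc j") (auto simp: indicator_def not_less)
  define W where "W \<omega> = (\<Prod>i\<in>{..<n} - {j}. u i (Z i \<omega>))" for \<omega>
  define c where "c m = ennreal (w m) * (\<Prod>i\<in>{..<n} - {j}. \<integral>\<^sup>+z. u i z \<partial>\<gamma> m i)" for m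
  define g where "g m z = ennreal (indicator {0..} z *
    (D j powr (a + e m j) * z powr (a + e m j - 1) * exp (- D j * z) / Gamma (a + e m j)))" for m z
  have [measurable]: "g m \<in> borel_measurable borel" for m
    unfolding g_def by measurable
  have \<gamma>j: "\<gamma> m j = density lborel (g m)" for m
    by (simp add: \<gamma>_def gamma_distribution_def g_def[abs_def])
  have W [measurable]: "W \<in> borel_measurable M"
    unfolding W_def by (intro borel_measurable_prod_ennreal measurable_compose[OF Z um]) auto
  \<comment> \<open>All factors except the one with index \<open>j\<close> are frozen into a weight,
    which leaves two measures on the line. The induction hypothesis, with an exponential in place
    \<open>j\<close>, says that their Laplace transforms agree; hence the indicator may be
    inserted.\<close>
  define M1 where "M1 = distr (density M W) borel (Z j)"
  define M2 where "M2 = density lborel (\<lambda>z. \<Sum>m. c m * g m z)"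
  have nn1: "(\<integral>\<^sup>+z. f z \<partial>M1) = (\<integral>\<^sup>+\<omega>. W \<omega> * f (Z j \<omega>) \<partial>M)" if [measurable]: "f \<in> borel_measurable borel" for f
    unfolding M1_def using jn by (simp add: nn_integral_distr nn_integral_density)
  have nn2: "(\<integral>\<^sup>+z. f z \<partial>M2) = (\<Sum>m. c m * (\<integral>\<^sup>+z. f z \<partial>\<gamma> m j))" if [measurable]: "f \<in> borel_measurable borel" for f
  proof -
    have "(\<integral>\<^sup>+z. f z \<partial>M2) = (\<integral>\<^sup>+z. (\<Sum>m. c m * (g m z * f z)) \<partial>lborel)"
      unfolding M2_def by (simp add: nn_integral_density mult.assoc flip: ennreal_suminf_multc)
    also have "\<dots> = (\<Sum>m. c m * (\<integral>\<^sup>+z. g m z * f z \<partial>lborel))"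
      by (simp add: nn_integral_suminf nn_integral_cmult)
    finally show ?thesis by (simp add: \<gamma>j nn_integral_density)
  qed
  have split1: "(\<Prod>i<n. (u(j := f)) i (Z i \<omega>)) = W \<omega> * f (Z j \<omega>)" for f \<omega>
    using jn by (subst prod.remove[of _ j]) (auto simp: W_def mult.commute intro!: prod.cong)
  have split2: "ennreal (w m) * (\<Prod>i<n. \<integral>\<^sup>+z. (u(j := f)) i z \<partial>\<gamma> m i) = c m * (\<integral>\<^sup>+z. f z \<partial>\<gamma> m j)" for f m
    using jn by (subst prod.remove[of _ j]) (auto simp: c_def mult_ac intro!: prod.cong)
  have "M1 = M2"
  proof (rule laplace_transform_unique)
    show "AE z in M1. 0 \<le> z"
      unfolding M1_def using jn Z0 by (subst AE_distr_iff) (auto simp: AE_density)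
    show "AE z in M2. 0 \<le> z"
      unfolding M2_def by (subst AE_density) (auto simp: g_def indicator_def intro!: AE_I2)
    have "(\<integral>\<^sup>+z. ennreal (exp (- z)) \<partial>M1) \<le> (\<integral>\<^sup>+\<omega>. 1 \<partial>M)"
    proof (subst nn1, simp, intro nn_integral_mono)
      fix \<omega> assume "\<omega> \<in> space M"
      then have "W \<omega> \<le> 1" unfolding W_def using u1 Z0 by (intro prod_le_1) auto
      moreover have "ennreal (exp (- Z j \<omega>)) \<le> 1" using Z0[OF jn \<open>\<omega> \<in> space M\<close>] by simp
      ultimately show "W \<omega> * ennreal (exp (- Z j \<omega>)) \<le> 1"
        using mult_mono[of "W \<omega>" 1 "ennreal (exp (- Z j \<omega>))" 1] by simp
    qed
    then show "(\<integral>\<^sup>+z. ennreal (exp (- z)) \<partial>M1) < \<infinity>"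
      by (auto simp: emeasure_space_1 intro: le_less_trans)
    fix s :: real assume s: "0 < s"
    have "(\<integral>\<^sup>+\<omega>. (\<Prod>i<n. (u(j := \<lambda>z. ennreal (exp (- s * z)))) i (Z i \<omega>)) \<partial>M) =
        (\<Sum>m. ennreal (w m) * (\<Prod>i<n. \<integral>\<^sup>+z. (u(j := \<lambda>z. ennreal (exp (- s * z)))) i z \<partial>\<gamma> m i))"
    proof (rule Suc.IH)
      show "\<exists>A\<in>sets borel. (u(j := \<lambda>z. ennreal (exp (- s * z)))) i = indicator A" if "i < j" for i
        using Suc.prems(2)[of i] that by auto
      show "\<exists>t>0. (u(j := \<lambda>z. ennreal (exp (- s * z)))) i = (\<lambda>z. ennreal (exp (- t * z)))" if "j \<le> i" "i < n" for i
        using Suc.prems(3)[of i] that s by (cases "i = j") auto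
    qed (use jn in simp)
    then show "(\<integral>\<^sup>+z. ennreal (exp (- s * z)) \<partial>M1) = (\<integral>\<^sup>+z. ennreal (exp (- s * z)) \<partial>M2)"
      unfolding split1 split2 by (subst nn1, simp, subst nn2, simp)
  qed (auto simp: M1_def M2_def)
  then have "(\<integral>\<^sup>+\<omega>. W \<omega> * u j (Z j \<omega>) \<partial>M) = (\<Sum>m. c m * (\<integral>\<^sup>+z. u j z \<partial>\<gamma> m j))"
    using nn1[of "u j"] nn2[of "u j"] um[OF jn] by simp
  then show ?case
    using split1[of "u j"] split2[of _ "u j"] by simp
qed

text \<open>Inserting full sets into the law shows that the weights sum to one. Each component is a
  product of gamma laws of shapes \<open>a\<close> plus an integer, and lowering these shapes to
  \<open>a\<close> only raises the probability of small values, so the bound no longer depends on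
  the component.\<close>

lemma gamma_mixture_domination:
  fixes Z :: "nat \<Rightarrow> 'b \<Rightarrow> real" and D :: "nat \<Rightarrow> real" and e :: "nat \<Rightarrow> nat \<Rightarrow> nat" and a :: real
  assumes M: "prob_space M" and a: "a > 0" and D: "\<And>i. i < n \<Longrightarrow> 0 < D i"
    and Z: "\<And>i. i < n \<Longrightarrow> Z i \<in> borel_measurable M"
    and Z0: "\<And>i \<omega>. i < n \<Longrightarrow> \<omega> \<in> space M \<Longrightarrow> 0 \<le> Z i \<omega>"
    and w: "\<And>m. 0 \<le> w m"
    and lap: "\<And>s. (\<And>i. i < n \<Longrightarrow> 0 < s i) \<Longrightarrow>
      (\<lambda>m. w m * (\<Prod>i<n. (D i / (D i + s i)) powr (a + e m i))) sums (LINT \<omega>|M. exp (- (\<Sum>i<n. s i * Z i \<omega>)))"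
  shows "measure M {\<omega> \<in> space M. \<forall>i<n. Z i \<omega> \<le> b i} \<le> (\<Prod>i<n. measure (gamma_distribution a (D i)) {..b i})"
proof -
  interpret prob_space M by fact
  have ps: "prob_space (gamma_distribution (a + e m i) (D i))" if "i < n" for m i
    by (rule prob_space_gamma_distribution) (use a D[OF that] in \<open>auto intro: add_pos_nonneg\<close>)
  have law: "(\<integral>\<^sup>+\<omega>. (\<Prod>i<n. indicator (A i) (Z i \<omega>)) \<partial>M) =
      (\<Sum>m. ennreal (w m) * (\<Prod>i<n. emeasure (gamma_distribution (a + e m i) (D i)) (A i)))"
    if "\<And>i. A i \<in> sets borel" for A :: "nat \<Rightarrow> real set"
    using gamma_mixture_law[where n=n and j=n and u="\<lambda>i. indicator (A i)", OF M a D Z Z0 w lap] that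
    by (auto simp: nn_integral_indicator)
  have "(\<integral>\<^sup>+\<omega>. 1 \<partial>M) = (\<Sum>m. ennreal (w m))"
    using law[of "\<lambda>_. UNIV"] prob_space.emeasure_space_1[OF ps] by simp
  then have sum_w: "(\<Sum>m. ennreal (w m)) = 1" by (simp add: emeasure_space_1)
  have meas: "{\<omega> \<in> space M. \<forall>i<n. Z i \<omega> \<le> b i} \<in> sets M"
    using Z by measurable
  have "emeasure M {\<omega> \<in> space M. \<forall>i<n. Z i \<omega> \<le> b i} =
      (\<integral>\<^sup>+\<omega>. indicator {\<omega> \<in> space M. \<forall>i<n. Z i \<omega> \<le> b i} \<omega> \<partial>M)"
    by (rule nn_integral_indicator[OF meas, symmetric])
  also have "\<dots> = (\<integral>\<^sup>+\<omega>. (\<Prod>i<n. indicator {..b i} (Z i \<omega>)) \<partial>M)"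
  proof (rule nn_integral_cong)
    fix \<omega> assume "\<omega> \<in> space M"
    show "indicator {\<omega> \<in> space M. \<forall>i<n. Z i \<omega> \<le> b i} \<omega> = (\<Prod>i<n. indicator {..b i} (Z i \<omega>) :: ennreal)"
    proof (cases "\<forall>i<n. Z i \<omega> \<le> b i")
      case True
      then have "(\<Prod>i<n. indicator {..b i} (Z i \<omega>) :: ennreal) = 1"
        by (intro prod.neutral) auto
      then show ?thesis using True \<open>\<omega> \<in> space M\<close> by simp
    next
      case False
      then obtain i where i: "i < n" "\<not> Z i \<omega> \<le> b i" by auto
      have "\<exists>i\<in>{..<n}. indicator {..b i} (Z i \<omega>) = (0 :: ennreal)"
        by (rule bexI[of _ i]) (use i in auto)
      then have "(\<Prod>i<n. indicator {..b i} (Z i \<omega>) :: ennreal) = 0"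
        by (intro prod_zero) simp_all
      then show ?thesis using False by simp
    qed
  qed
  also have "\<dots> = (\<Sum>m. ennreal (w m) * (\<Prod>i<n. emeasure (gamma_distribution (a + e m i) (D i)) {..b i}))"
    by (rule law) simp
  also have "\<dots> \<le> (\<Sum>m. ennreal (w m) * (\<Prod>i<n. ennreal (measure (gamma_distribution a (D i)) {..b i})))"
  proof (rule suminf_le)
    fix m
    have "emeasure (gamma_distribution (a + e m i) (D i)) {..b i} \<le> ennreal (measure (gamma_distribution a (D i)) {..b i})"
      if i: "i < n" for i
    proof -
      interpret G: prob_space "gamma_distribution (a + e m i) (D i)" by (rule ps[OF i])
      show ?thesis
        unfolding G.emeasure_eq_measure using gamma_distribution_shape_mono[OF a D[OF i]] by (simp add: ennreal_leI)
    qed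
    then show "ennreal (w m) * (\<Prod>i<n. emeasure (gamma_distribution (a + e m i) (D i)) {..b i}) \<le>
        ennreal (w m) * (\<Prod>i<n. ennreal (measure (gamma_distribution a (D i)) {..b i}))"
      by (intro mult_left_mono prod_mono_ennreal) auto
  qed auto
  also have "\<dots> = ennreal (\<Prod>i<n. measure (gamma_distribution a (D i)) {..b i})"
    by (simp add: sum_w prod_ennreal ennreal_suminf_multc)
  finally show ?thesis
    by (simp add: emeasure_eq_measure prod_nonneg)
qed

text \<open>If \<open>B\<close> inverts the section of \<open>K\<close>, then
  \<open>det (I + K S) = det K * det (B + S)\<close>, and the second factor has a gamma expansion.
  The row sums \<open>v\<close> of the section of \<open>K\<close> certify the M-matrix property,
  since \<open>B v\<close> is the constant one. The power of \<open>det K\<close> is absorbed into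
  the weights.\<close>

lemma permanental_domination:
  fixes B :: "nat \<Rightarrow> nat \<Rightarrow> real" and t :: "nat \<Rightarrow> nat"
  assumes perm: "permanental_sequence a K M Z" and a: "a > 0"
    and t: "inj_on t {..<n}" and t1: "\<And>i. i < n \<Longrightarrow> 1 \<le> t i"
    and K0: "\<And>i j. i < n \<Longrightarrow> j < n \<Longrightarrow> 0 \<le> K (t i) (t j)" and Kd: "\<And>i. i < n \<Longrightarrow> 0 < K (t i) (t i)"
    and off: "\<And>i j. i < n \<Longrightarrow> j < n \<Longrightarrow> i \<noteq> j \<Longrightarrow> B i j \<le> 0"
    and BK: "\<And>i l. i < n \<Longrightarrow> l < n \<Longrightarrow> (\<Sum>j<n. B i j * K (t j) (t l)) = (if i = l then 1 else 0)"
  shows "(\<forall>i<n. 0 < B i i) \<and>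
    measure M {\<omega> \<in> space M. \<forall>i<n. Z (t i) \<omega> \<le> b i} \<le> (\<Prod>i<n. measure (gamma_distribution a (B i i)) {..b i})"
proof -
  have M: "prob_space M" and Zm: "\<And>j. 1 \<le> j \<Longrightarrow> Z j \<in> borel_measurable M"
    and Z0: "\<And>j \<omega>. 1 \<le> j \<Longrightarrow> \<omega> \<in> space M \<Longrightarrow> 0 \<le> Z j \<omega>"
    and lap: "\<And>s. (\<forall>m<n. 0 < s m) \<Longrightarrow> (LINT \<omega>|M. exp (- (\<Sum>m<n. s m * Z (t m) \<omega>))) =
        Determinant.det (1\<^sub>m n + Matrix.mat n n (\<lambda>(a, b). K (t a) (t b)) * mat_diag n s) powr (- a)"
    using perm t t1 unfolding permanental_sequence_def by blast+
  define v where "v i = (\<Sum>l<n. K (t i) (t l))" for i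
  have v: "0 < v i" if i: "i < n" for i
    unfolding v_def by (rule sum_pos2[of _ i]) (use i K0 Kd in auto)
  have Bv: "(\<Sum>j<n. B i j * v j) = 1" if i: "i < n" for i
  proof -
    have "(\<Sum>j<n. B i j * v j) = (\<Sum>l<n. \<Sum>j<n. B i j * K (t j) (t l))"
      unfolding v_def sum_distrib_left by (rule sum.swap)
    also have "\<dots> = (\<Sum>l<n. if i = l then 1 else 0)" using BK[OF i] by simp
    also have "\<dots> = 1" using i by simp
    finally show ?thesis .
  qed
  obtain w and e :: "nat \<Rightarrow> nat \<Rightarrow> nat" where diag: "\<And>i. i < n \<Longrightarrow> 0 < B i i" and w: "\<And>m. 0 \<le> w m"
    and detpos: "\<And>s. (\<forall>i<n. 0 \<le> s i) \<Longrightarrow>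
      0 < Determinant.det (Matrix.mat n n (\<lambda>(i, j). B i j + (if i = j then s i else 0)))"
    and expand: "\<And>s. (\<forall>i<n. 0 \<le> s i) \<Longrightarrow>
      (\<lambda>m. w m * (\<Prod>i<n. (B i i / (B i i + s i)) powr (a + e m i))) sums
        Determinant.det (Matrix.mat n n (\<lambda>(i, j). B i j + (if i = j then s i else 0))) powr (- a)"
  proof -
    have "0 < (\<Sum>j<n. B i j * v j)" if "i < n" for i using Bv[OF that] by simp
    from mmatrix_det_powr_expansion[where n=n and B=B and v=v and a=a, OF a off v this] that
    show thesis by blast
  qed
  define Km where "Km = Matrix.mat n n (\<lambda>(i, j). K (t i) (t j))"
  define Bm where "Bm = Matrix.mat n n (\<lambda>(i, j). B i j)"
  have carr [simp]: "Km \<in> carrier_mat n n" "Bm \<in> carrier_mat n n" by (simp_all add: Km_def Bm_def)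
  have BK1: "Bm * Km = 1\<^sub>m n"
    by (rule eq_matI) (auto simp: Km_def Bm_def scalar_prod_def BK lessThan_atLeast0[symmetric])
  then have KB1: "Km * Bm = 1\<^sub>m n"
    by (rule mat_mult_left_right_inverse[OF carr(2,1)])
  have "Determinant.det Bm > 0"
    using detpos[of "\<lambda>_. 0"] by (simp add: Bm_def)
  moreover have "Determinant.det Bm * Determinant.det Km = 1"
    using det_mult[OF carr(2,1)] BK1 by simp
  ultimately have detK: "Determinant.det Km > 0"
    using zero_less_mult_pos[of "Determinant.det Bm" "Determinant.det Km"] by simp
  have fact: "Determinant.det (1\<^sub>m n + Km * mat_diag n s) =
      Determinant.det Km * Determinant.det (Matrix.mat n n (\<lambda>(i, j). B i j + (if i = j then s i else 0)))" for s
  proof -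
    have "Matrix.mat n n (\<lambda>(i, j). B i j + (if i = j then s i else 0)) = Bm + mat_diag n s"
      by (rule eq_matI) (auto simp: Bm_def mat_diag_def)
    moreover have "Km * (Bm + mat_diag n s) = 1\<^sub>m n + Km * mat_diag n s"
      by (subst mult_add_distrib_mat[of _ n n _ n]) (auto simp: KB1)
    ultimately show ?thesis
      using det_mult[of Km n "Bm + mat_diag n s"] by simp
  qed
  have "measure M {\<omega> \<in> space M. \<forall>i<n. Z (t i) \<omega> \<le> b i} \<le> (\<Prod>i<n. measure (gamma_distribution a (B i i)) {..b i})"
  proof (rule gamma_mixture_domination[where w="\<lambda>m. Determinant.det Km powr (- a) * w m" and e=e])
    fix s :: "nat \<Rightarrow> real" assume s: "\<And>i. i < n \<Longrightarrow> 0 < s i"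
    have "(LINT \<omega>|M. exp (- (\<Sum>i<n. s i * Z (t i) \<omega>))) =
        Determinant.det Km powr (- a) * Determinant.det (Matrix.mat n n (\<lambda>(i, j). B i j + (if i = j then s i else 0))) powr (- a)"
      using lap[of s] s fact[of s] detK detpos[of s] by (simp add: Km_def powr_mult less_imp_le)
    then show "(\<lambda>m. Determinant.det Km powr (- a) * w m * (\<Prod>i<n. (B i i / (B i i + s i)) powr (a + e m i))) sums
        (LINT \<omega>|M. exp (- (\<Sum>i<n. s i * Z (t i) \<omega>)))"
      using sums_mult[OF expand[of s], of "Determinant.det Km powr (- a)"] s by (simp add: mult.assoc less_imp_le)
  qed (use M a diag Zm Z0 t1 w in auto)
  with diag show ?thesis by blast
qed

section \<open>Inverse M-matrices and the autoregressive covariance\<close>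

text \<open>Matrices are restricted to arbitrary finite index sets instead of being renumbered, so
  that a subsequence of indices is simply a subset.\<close>

definition left_inverse_on :: "nat set \<Rightarrow> (nat \<Rightarrow> nat \<Rightarrow> real) \<Rightarrow> (nat \<Rightarrow> nat \<Rightarrow> real) \<Rightarrow> bool" where
  "left_inverse_on I B K \<longleftrightarrow> (\<forall>i\<in>I. \<forall>l\<in>I. (\<Sum>j\<in>I. B i j * K j l) = (if i = l then 1 else 0))"

text \<open>In the diagonal entry of \<open>B K = 1\<close> all terms but
  \<open>B i i * K i i\<close> are non-positive.\<close>

lemma mmatrix_inverse_diag_pos:
  assumes I: "finite I" and inv: "left_inverse_on I B K"
    and off: "\<And>i j. i \<in> I \<Longrightarrow> j \<in> I \<Longrightarrow> i \<noteq> j \<Longrightarrow> B i j \<le> 0"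
    and K0: "\<And>i j. i \<in> I \<Longrightarrow> j \<in> I \<Longrightarrow> 0 \<le> K i j" and Kd: "\<And>i. i \<in> I \<Longrightarrow> 0 < K i i"
    and i: "i \<in> I"
  shows "0 < B i i"
proof -
  have "(\<Sum>j\<in>I. B i j * K j i) = B i i * K i i + (\<Sum>j\<in>I - {i}. B i j * K j i)"
    using I i by (rule sum.remove)
  moreover have "(\<Sum>j\<in>I - {i}. B i j * K j i) \<le> 0"
    using i off K0 by (intro sum_nonpos mult_nonpos_nonneg) auto
  moreover have "(\<Sum>j\<in>I. B i j * K j i) = 1" using inv i by (simp add: left_inverse_on_def)
  ultimately have "0 < B i i * K i i" by simp
  then show ?thesis using Kd[OF i] by (simp add: zero_less_mult_iff)
qed

text \<open>Applying a Schur complement to \<open>u\<close> amounts to subtracting a multiple of row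
  \<open>n\<close> so that the value of \<open>u\<close> at \<open>n\<close> drops out.\<close>

lemma sum_eliminate:
  fixes B :: "nat \<Rightarrow> nat \<Rightarrow> real"
  assumes "finite I" "n \<in> I" "B n n \<noteq> 0"
  shows "(\<Sum>j\<in>I - {n}. (B i j - B i n * B n j / B n n) * u j) =
    (\<Sum>j\<in>I. B i j * u j) - B i n / B n n * (\<Sum>j\<in>I. B n j * u j)"
proof -
  have "(\<Sum>j\<in>I - {n}. (B i j - B i n * B n j / B n n) * u j) =
      (\<Sum>j\<in>I - {n}. B i j * u j) - B i n / B n n * (\<Sum>j\<in>I - {n}. B n j * u j)"
    unfolding sum_distrib_left sum_subtractf[symmetric] by (intro sum.cong) (simp_all add: algebra_simps)
  moreover have "(\<Sum>j\<in>I. B l j * u j) = B l n * u n + (\<Sum>j\<in>I - {n}. B l j * u j)" for l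
    using assms by (intro sum.remove)
  ultimately show ?thesis using assms by (simp add: algebra_simps)
qed

text \<open>The inverse of a smaller section of \<open>K\<close> is a Schur complement of
  \<open>B\<close>, obtained here by removing one index at a time. The correction
  \<open>B i n * B n j / B n n\<close> is non-negative off the pivot row, so signs persist. Moreover
  a vector with \<open>B u \<ge> 0\<close> keeps this property after restriction: a potential stays
  a potential on a subset.\<close>

lemma mmatrix_restrict:
  fixes B K :: "nat \<Rightarrow> nat \<Rightarrow> real"
  assumes "finite I" "T \<subseteq> I" "left_inverse_on I B K"
    and "\<And>i j. B i j = B j i"
    and "\<And>i j. i \<in> I \<Longrightarrow> j \<in> I \<Longrightarrow> i \<noteq> j \<Longrightarrow> B i j \<le> 0"
    and "\<And>i j. i \<in> I \<Longrightarrow> j \<in> I \<Longrightarrow> 0 \<le> K i j" and "\<And>i. i \<in> I \<Longrightarrow> 0 < K i i"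
  shows "\<exists>B'. left_inverse_on T B' K \<and> (\<forall>i j. B' i j = B' j i) \<and>
    (\<forall>i\<in>T. \<forall>j\<in>T. i \<noteq> j \<longrightarrow> B' i j \<le> 0) \<and>
    (\<forall>u. (\<forall>i\<in>I. 0 \<le> (\<Sum>j\<in>I. B i j * u j)) \<longrightarrow> (\<forall>i\<in>T. 0 \<le> (\<Sum>j\<in>T. B' i j * u j)))"
  using assms
proof (induction "card (I - T)" arbitrary: I B)
  case 0
  then have "I = T" by auto
  with 0 show ?case by (intro exI[of _ B]) auto
next
  case (Suc d)
  then obtain n where n: "n \<in> I" "n \<notin> T" by (metis Diff_iff card.empty equals0I nat.simps(3))
  define C where "C i j = B i j - B i n * B n j / B n n" for i j
  have nn: "0 < B n n"
    by (rule mmatrix_inverse_diag_pos[of I B K]) (use Suc.prems n in auto)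
  have apply_C: "(\<Sum>j\<in>I - {n}. C i j * u j) =
      (\<Sum>j\<in>I. B i j * u j) - B i n / B n n * (\<Sum>j\<in>I. B n j * u j)" for i u
    unfolding C_def using Suc.prems(1) n nn by (intro sum_eliminate) auto
  have "\<exists>B'. left_inverse_on T B' K \<and> (\<forall>i j. B' i j = B' j i) \<and>
    (\<forall>i\<in>T. \<forall>j\<in>T. i \<noteq> j \<longrightarrow> B' i j \<le> 0) \<and>
    (\<forall>u. (\<forall>i\<in>I - {n}. 0 \<le> (\<Sum>j\<in>I - {n}. C i j * u j)) \<longrightarrow> (\<forall>i\<in>T. 0 \<le> (\<Sum>j\<in>T. B' i j * u j)))"
  proof (rule Suc.hyps)
    have "I - {n} - T = (I - T) - {n}" by auto
    then show "d = card (I - {n} - T)"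
      using Suc.hyps(2) n Suc.prems(1) by simp
    show "left_inverse_on (I - {n}) C K"
      unfolding left_inverse_on_def
    proof (intro ballI)
      fix i l assume "i \<in> I - {n}" "l \<in> I - {n}"
      then show "(\<Sum>j\<in>I - {n}. C i j * K j l) = (if i = l then 1 else 0)"
        unfolding apply_C using Suc.prems(3) n by (auto simp: left_inverse_on_def)
    qed
    show "C i j = C j i" for i j using Suc.prems(4) by (simp add: C_def mult.commute)
    show "C i j \<le> 0" if "i \<in> I - {n}" "j \<in> I - {n}" "i \<noteq> j" for i j
    proof -
      have "0 \<le> B i n * B n j" using that n Suc.prems(5) by (intro mult_nonpos_nonpos) auto
      then have "0 \<le> B i n * B n j / B n n" using nn by simp
      moreover have "B i j \<le> 0" using that Suc.prems(5) by auto
      ultimately show ?thesis by (simp add: C_def)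
    qed
  qed (use Suc.prems n in auto)
  then obtain B' where B': "left_inverse_on T B' K" "\<forall>i j. B' i j = B' j i"
    "\<forall>i\<in>T. \<forall>j\<in>T. i \<noteq> j \<longrightarrow> B' i j \<le> 0"
    and pot: "\<And>u. (\<forall>i\<in>I - {n}. 0 \<le> (\<Sum>j\<in>I - {n}. C i j * u j)) \<Longrightarrow> (\<forall>i\<in>T. 0 \<le> (\<Sum>j\<in>T. B' i j * u j))"
    by blast
  have "\<forall>i\<in>T. 0 \<le> (\<Sum>j\<in>T. B' i j * u j)" if u: "\<forall>i\<in>I. 0 \<le> (\<Sum>j\<in>I. B i j * u j)" for u
  proof (rule pot, intro ballI)
    fix i assume "i \<in> I - {n}"
    then have "B i n / B n n * (\<Sum>j\<in>I. B n j * u j) \<le> 0"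
      using n nn u Suc.prems(5)[of i n] by (intro mult_nonpos_nonneg divide_nonpos_pos) auto
    then show "0 \<le> (\<Sum>j\<in>I - {n}. C i j * u j)"
      unfolding apply_C using u \<open>i \<in> I - {n}\<close> by fastforce
  qed
  with B' show ?case by blast
qed

text \<open>The Sherman-Morrison formula for \<open>V\<close> plus the product of the column of ones
  and the row \<open>f\<close>. The correction is the product of \<open>B 1\<close> and, by symmetry
  of \<open>B\<close>, of \<open>B f\<close>, divided by \<open>1 + H\<close>; both vectors are
  non-negative, so no entry of the inverse increases.\<close>

lemma mmatrix_rank_one_update:
  fixes B V :: "nat \<Rightarrow> nat \<Rightarrow> real" and f :: "nat \<Rightarrow> real"
  assumes T: "finite T" and inv: "left_inverse_on T B V" and sym: "\<And>i j. B i j = B j i"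
    and off: "\<And>i j. i \<in> T \<Longrightarrow> j \<in> T \<Longrightarrow> i \<noteq> j \<Longrightarrow> B i j \<le> 0"
    and e0: "\<And>i. i \<in> T \<Longrightarrow> 0 \<le> (\<Sum>j\<in>T. B i j)"
    and h0: "\<And>i. i \<in> T \<Longrightarrow> 0 \<le> (\<Sum>j\<in>T. B i j * f j)"
  shows "\<exists>C. left_inverse_on T C (\<lambda>i j. V i j + f j) \<and>
    (\<forall>i\<in>T. \<forall>j\<in>T. i \<noteq> j \<longrightarrow> C i j \<le> 0) \<and> (\<forall>i\<in>T. C i i \<le> B i i)"
proof -
  define e where "e i = (\<Sum>j\<in>T. B i j)" for i
  define h where "h i = (\<Sum>j\<in>T. B i j * f j)" for i
  define H where "H = (\<Sum>i\<in>T. h i)"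
  have H0: "0 \<le> H" unfolding H_def h_def by (rule sum_nonneg) (rule h0)
  define C where "C i j = B i j - e i * h j / (1 + H)" for i j
  have sub: "0 \<le> e i * h j / (1 + H)" if "i \<in> T" "j \<in> T" for i j
    using e0[OF that(1)] h0[OF that(2)] H0 by (auto simp: e_def h_def)
  have hV: "(\<Sum>j\<in>T. h j * V j l) = f l" if l: "l \<in> T" for l
  proof -
    have "(\<Sum>j\<in>T. h j * V j l) = (\<Sum>j\<in>T. \<Sum>i\<in>T. f i * (B i j * V j l))"
      unfolding h_def sum_distrib_right by (intro sum.cong refl) (simp add: sym[of _ "_ :: nat"] mult_ac)
    also have "\<dots> = (\<Sum>i\<in>T. f i * (\<Sum>j\<in>T. B i j * V j l))"
      unfolding sum_distrib_left by (rule sum.swap)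
    also have "\<dots> = (\<Sum>i\<in>T. f i * (if i = l then 1 else 0))"
      using inv l by (intro sum.cong refl) (simp add: left_inverse_on_def)
    also have "\<dots> = f l" using T l by (simp add: if_distrib[where f="\<lambda>c. f _ * c"] cong: if_cong)
    finally show ?thesis .
  qed
  show ?thesis
  proof (intro exI[of _ C] conjI ballI impI)
    show "left_inverse_on T C (\<lambda>i j. V i j + f j)"
      unfolding left_inverse_on_def
    proof (intro ballI)
      fix i l assume il: "i \<in> T" "l \<in> T"
      have "(\<Sum>j\<in>T. C i j * (V j l + f l)) =
          (\<Sum>j\<in>T. B i j * V j l) + e i * f l - e i / (1 + H) * ((\<Sum>j\<in>T. h j * V j l) + H * f l)"
      proof -
        have "C i j * (V j l + f l) =
            B i j * V j l + B i j * f l - (e i / (1 + H) * (h j * V j l) + e i / (1 + H) * f l * h j)" for j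
          by (simp add: C_def algebra_simps add_divide_distrib)
        then have "(\<Sum>j\<in>T. C i j * (V j l + f l)) = (\<Sum>j\<in>T. B i j * V j l) + (\<Sum>j\<in>T. B i j) * f l -
            (e i / (1 + H) * (\<Sum>j\<in>T. h j * V j l) + e i / (1 + H) * f l * (\<Sum>j\<in>T. h j))"
          by (simp only: sum.distrib sum_subtractf sum_distrib_left sum_distrib_right)
        then show ?thesis by (simp add: e_def[symmetric] H_def[symmetric] algebra_simps)
      qed
      also have "\<dots> = (if i = l then 1 else 0) + e i * f l - e i / (1 + H) * (f l + H * f l)"
        using inv il by (simp add: hV left_inverse_on_def)
      also have "e i / (1 + H) * (f l + H * f l) = e i * f l"
        using H0 by (simp add: field_simps)
      finally show "(\<Sum>j\<in>T. C i j * (V j l + f l)) = (if i = l then 1 else 0)" by simp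
    qed
    show "C i j \<le> 0" if "i \<in> T" "j \<in> T" "i \<noteq> j" for i j
      using sub[OF that(1,2)] off[OF that] by (simp add: C_def)
    show "C i i \<le> B i i" if "i \<in> T" for i
      using sub[OF that that] by (simp add: C_def)
  qed
qed

text \<open>
  A lower bound for the conditional variance \<open>1 / B i i\<close>: column \<open>i\<close> of \<open>V\<close> is compared with a
  combination of the constants and column \<open>M\<close>, on which \<open>B\<close> is non-negative.
\<close>

lemma mmatrix_inverse_diag_le:
  fixes B V :: "nat \<Rightarrow> nat \<Rightarrow> real"
  assumes T: "finite T" and inv: "left_inverse_on T B V"
    and off: "\<And>i j. i \<in> T \<Longrightarrow> j \<in> T \<Longrightarrow> i \<noteq> j \<Longrightarrow> B i j \<le> 0"
    and e0: "\<And>i. i \<in> T \<Longrightarrow> 0 \<le> (\<Sum>j\<in>T. B i j)"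
    and i: "i \<in> T" and M: "M \<in> T" and \<eta>: "0 \<le> \<eta>1" "0 \<le> \<eta>2"
    and bound: "\<And>j. j \<in> T \<Longrightarrow> j \<noteq> i \<Longrightarrow> V j i \<le> \<eta>1 + \<eta>2 * V j M"
  shows "B i i * (V i i - \<eta>1 - \<eta>2 * V i M) \<le> 1"
proof -
  have split: "(\<Sum>j\<in>T. B i j * u j) = B i i * u i + (\<Sum>j\<in>T - {i}. B i j * u j)" for u :: "nat \<Rightarrow> real"
    using T i by (rule sum.remove)
  have "0 \<le> \<eta>1 * (\<Sum>j\<in>T. B i j * 1) + \<eta>2 * (\<Sum>j\<in>T. B i j * V j M)"
    using e0[OF i] \<eta> inv i M by (auto simp: left_inverse_on_def)
  also have "\<dots> = B i i * (\<eta>1 + \<eta>2 * V i M) + (\<Sum>j\<in>T - {i}. B i j * (\<eta>1 + \<eta>2 * V j M))"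
    unfolding split by (simp add: algebra_simps sum.distrib sum_distrib_left)
  finally have 1: "- (\<Sum>j\<in>T - {i}. B i j * (\<eta>1 + \<eta>2 * V j M)) \<le> B i i * (\<eta>1 + \<eta>2 * V i M)" by simp
  have "(\<Sum>j\<in>T - {i}. B i j * (\<eta>1 + \<eta>2 * V j M)) \<le> (\<Sum>j\<in>T - {i}. B i j * V j i)"
    using off i bound by (intro sum_mono mult_left_mono_neg) auto
  moreover have "1 = B i i * V i i + (\<Sum>j\<in>T - {i}. B i j * V j i)"
    using split[of "\<lambda>j. V j i"] inv i by (simp add: left_inverse_on_def)
  ultimately show ?thesis using 1 by (simp add: algebra_simps)
qed

section \<open>The autoregression, its Green matrix and the inverses of its sections\<close>

locale autoregression =
  fixes k :: nat and p :: "nat \<Rightarrow> real"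
  assumes k2: "2 \<le> k"
    and p_decreasing: "\<And>i j. 1 \<le> i \<Longrightarrow> i \<le> j \<Longrightarrow> j \<le> k \<Longrightarrow> p j \<le> p i"
    and p_pos: "0 < p k"
    and p_sum: "(\<Sum>l=1..k. p l) \<le> 1"
begin

definition pp :: "nat \<Rightarrow> real" where "pp l = (if 1 \<le> l \<and> l \<le> k then p l else 0)"

definition coef :: "nat \<Rightarrow> real" where "coef n = (if n = 0 then 1 else - pp n)"

text \<open>This is also a renewal sequence: the probability that a walk on the integers from 0,
  with step law \<open>p\<close> and killed with the remaining mass, visits \<open>n\<close>. This
  explains the bounds 0 and 1 and the limit \<open>1 / \<mu>\<close> in the critical case.\<close>

definition \<phi> :: "nat \<Rightarrow> real" where "\<phi> n = fps_nth (inverse (Abs_fps coef)) n"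

text \<open>The covariance of two moving averages with coefficients \<open>\<phi>\<close>. All
  matrix arguments use this deterministic form; \<open>covariance_autoregressive\<close> identifies
  it with \<open>V\<close>.\<close>

definition green :: "nat \<Rightarrow> nat \<Rightarrow> real" where
  "green i j = (\<Sum>m=1..min i j. \<phi> (i - m) * \<phi> (j - m))"

lemma p_positive: "0 < p l" if "1 \<le> l" "l \<le> k"
  using p_decreasing[of l k] p_pos that by simp

lemma pp_nonneg: "0 \<le> pp l"
  using p_positive[of l] by (simp add: pp_def less_imp_le)

lemma pp_antimono: "1 \<le> i \<Longrightarrow> i \<le> j \<Longrightarrow> pp j \<le> pp i"
  using p_decreasing[of i j] p_positive[of i] by (auto simp: pp_def)

lemma sum_pp_le:
  assumes "finite A" "0 \<notin> A"
  shows "sum pp A \<le> (\<Sum>l=1..k. p l)"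
proof -
  have "sum pp A = sum pp (A \<inter> {1..k})"
    using assms by (intro sum.mono_neutral_right) (auto simp: pp_def)
  also have "\<dots> \<le> sum pp {1..k}"
    by (intro sum_mono2) (auto simp: pp_nonneg)
  also have "\<dots> = (\<Sum>l=1..k. p l)" by (intro sum.cong) (auto simp: pp_def)
  finally show ?thesis .
qed

lemma sum_pp_le_1: "finite A \<Longrightarrow> 0 \<notin> A \<Longrightarrow> sum pp A \<le> 1"
  using sum_pp_le p_sum by (meson order_trans)

lemma coef_fps: "Abs_fps coef * Abs_fps \<phi> = 1"
proof -
  have "Abs_fps \<phi> = inverse (Abs_fps coef)" by (simp add: fps_eq_iff \<phi>_def)
  then show ?thesis
    by (simp add: inverse_mult_eq_1' coef_def)
qed

lemma coef_\<phi>: "(\<Sum>i=0..n. coef i * \<phi> (n - i)) = (if n = 0 then 1 else 0)"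
  using arg_cong[OF coef_fps, of "\<lambda>F. fps_nth F n"] by (simp add: fps_mult_nth)

lemma \<phi>_coef: "(\<Sum>i=0..n. \<phi> i * coef (n - i)) = (if n = 0 then 1 else 0)"
  using arg_cong[OF coef_fps, of "\<lambda>F. fps_nth F n"] by (subst (asm) mult.commute) (simp add: fps_mult_nth)

lemma \<phi>_0 [simp]: "\<phi> 0 = 1"
  using coef_\<phi>[of 0] by (simp add: coef_def)

lemma \<phi>_rec: "n \<ge> 1 \<Longrightarrow> \<phi> n = (\<Sum>l=1..n. pp l * \<phi> (n - l))"
  using coef_\<phi>[of n] by (simp add: sum.atLeast_Suc_atMost coef_def sum_negf)

lemma \<phi>_nonneg: "0 \<le> \<phi> n"
proof (induction n rule: less_induct)
  case (less n)
  show ?case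
  proof (cases "n = 0")
    case False
    have "0 \<le> (\<Sum>l=1..n. pp l * \<phi> (n - l))"
      using less by (intro sum_nonneg mult_nonneg_nonneg pp_nonneg) auto
    then show ?thesis using \<phi>_rec[of n] False by simp
  qed simp
qed

lemma \<phi>_le_1: "\<phi> n \<le> 1"
proof (induction n rule: less_induct)
  case (less n)
  show ?case
  proof (cases "n = 0")
    case False
    have "\<phi> n = (\<Sum>l=1..n. pp l * \<phi> (n - l))" using \<phi>_rec[of n] False by simp
    also have "\<dots> \<le> (\<Sum>l=1..n. pp l * 1)"
      using less by (intro sum_mono mult_left_mono pp_nonneg) auto
    also have "\<dots> \<le> 1" using sum_pp_le_1[of "{1..n}"] by simp
    finally show ?thesis .
  qed simp
qed

text \<open>Lower triangular Toeplitz matrices multiply by convolution of their symbols, and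
  triangularity makes truncation to \<open>{1..n}\<close> harmless.\<close>

lemma toeplitz_mult:
  fixes a b :: "nat \<Rightarrow> real"
  assumes r: "r \<in> {1..n}" and m: "m \<in> {1..n}"
  shows "(\<Sum>j=1..n. (if j \<le> r then a (r - j) else 0) * (if m \<le> j then b (j - m) else 0)) =
    (if m \<le> r then \<Sum>i=0..r - m. a i * b (r - m - i) else 0)"
proof (cases "m \<le> r")
  case True
  have "(\<Sum>j=1..n. (if j \<le> r then a (r - j) else 0) * (if m \<le> j then b (j - m) else 0)) =
      (\<Sum>j\<in>{m..r}. a (r - j) * b (j - m))"
    using r m by (intro sum.mono_neutral_cong_right) auto
  also have "\<dots> = (\<Sum>i=0..r - m. a i * b (r - m - i))"
    by (rule sum.reindex_bij_witness[where i="\<lambda>i. r - i" and j="\<lambda>j. r - j"]) (use True in auto)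
  finally show ?thesis using True by simp
next
  case False
  then show ?thesis by (simp add: sum.neutral)
qed

definition L :: "nat \<Rightarrow> nat \<Rightarrow> real" where "L r i = (if i \<le> r then coef (r - i) else 0)"
definition \<Phi> :: "nat \<Rightarrow> nat \<Rightarrow> real" where "\<Phi> j m = (if m \<le> j then \<phi> (j - m) else 0)"

lemma L_\<Phi>:
  assumes "r \<in> {1..n}" "m \<in> {1..n}"
  shows "(\<Sum>j=1..n. L r j * \<Phi> j m) = (if r = m then 1 else 0)"
  unfolding L_def \<Phi>_def toeplitz_mult[OF assms] coef_\<phi> by auto

lemma \<Phi>_L:
  assumes "r \<in> {1..n}" "m \<in> {1..n}"
  shows "(\<Sum>j=1..n. \<Phi> r j * L j m) = (if r = m then 1 else 0)"
  unfolding L_def \<Phi>_def toeplitz_mult[OF assms] \<phi>_coef by auto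

lemma green_\<Phi>: "i \<le> n \<Longrightarrow> green i j = (\<Sum>m=1..n. \<Phi> i m * \<Phi> j m)"
  unfolding green_def \<Phi>_def by (intro sum.mono_neutral_cong_left) auto

lemma green_sym: "green i j = green j i"
  by (simp add: green_def mult.commute min.commute)

lemma green_nonneg: "0 \<le> green i j"
  unfolding green_def by (intro sum_nonneg mult_nonneg_nonneg \<phi>_nonneg)

lemma green_diag_ge_1: "1 \<le> i \<Longrightarrow> 1 \<le> green i i"
proof -
  assume i: "1 \<le> i"
  have "(\<Sum>m\<in>{i}. \<phi> (i - m) * \<phi> (i - m)) \<le> (\<Sum>m=1..i. \<phi> (i - m) * \<phi> (i - m))"
    using i by (intro sum_mono2) auto
  then show ?thesis by (simp add: green_def)
qed

text \<open>On \<open>{1..n}\<close> the Green matrix is \<open>\<Phi>\<close> times its transpose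
  and \<open>L\<close> inverts \<open>\<Phi>\<close>, so the inverse is the transpose of
  \<open>L\<close> times \<open>L\<close>. Unlike the factors it depends on \<open>n\<close>: near
  the lower right corner the sum over \<open>r\<close> is cut off.\<close>

definition green_inv :: "nat \<Rightarrow> nat \<Rightarrow> nat \<Rightarrow> real" where
  "green_inv n i j = (\<Sum>r=1..n. L r i * L r j)"

lemma left_inverse_green: "left_inverse_on {1..n} (green_inv n) green"
  unfolding left_inverse_on_def
proof (intro ballI)
  fix i l assume i: "i \<in> {1..n}" and l: "l \<in> {1..n}"
  have "(\<Sum>j=1..n. green_inv n i j * green j l) =
      (\<Sum>j=1..n. \<Sum>r=1..n. \<Sum>m=1..n. L r i * \<Phi> l m * (L r j * \<Phi> j m))"
    by (intro sum.cong refl) (simp add: green_\<Phi>[of _ n] green_inv_def sum_product mult_ac)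
  also have "\<dots> = (\<Sum>r=1..n. \<Sum>j=1..n. \<Sum>m=1..n. L r i * \<Phi> l m * (L r j * \<Phi> j m))"
    by (rule sum.swap)
  also have "\<dots> = (\<Sum>r=1..n. \<Sum>m=1..n. \<Sum>j=1..n. L r i * \<Phi> l m * (L r j * \<Phi> j m))"
    by (rule sum.cong[OF refl], rule sum.swap)
  also have "\<dots> = (\<Sum>r=1..n. \<Sum>m=1..n. L r i * \<Phi> l m * (if r = m then 1 else 0))"
    by (intro sum.cong refl, simp only: sum_distrib_left[symmetric] L_\<Phi>)
  also have "\<dots> = (\<Sum>r=1..n. \<Phi> l r * L r i)"
  proof (intro sum.cong refl)
    fix r assume "r \<in> {1..n}"
    then have "(\<Sum>m=1..n. L r i * \<Phi> l m * (if r = m then 1 else 0)) = L r i * \<Phi> l r"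
      by (simp add: if_distrib[where f="\<lambda>c. _ * c"] cong: if_cong)
    then show "(\<Sum>m=1..n. L r i * \<Phi> l m * (if r = m then 1 else 0)) = \<Phi> l r * L r i"
      by simp
  qed
  also have "\<dots> = (if i = l then 1 else 0)"
    using \<Phi>_L[OF l i] by auto
  finally show "(\<Sum>j=1..n. green_inv n i j * green j l) = (if i = l then 1 else 0)" .
qed

lemma green_inv_sym: "green_inv n i j = green_inv n j i"
  by (simp add: green_inv_def mult.commute)

text \<open>With \<open>d = j - i\<close> the entry is \<open>- p d\<close> plus a sum of products
  \<open>p (d + l) * p l\<close>. Monotonicity of \<open>p\<close> bounds the sum by
  \<open>p d\<close> times a partial sum of \<open>p\<close>, which is at most one. The estimate is
  indifferent to where the sum is cut, so it holds for every \<open>n\<close>.\<close>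

lemma green_inv_nonpos:
  assumes ij: "i \<in> {1..n}" "j \<in> {1..n}" "i < j"
  shows "green_inv n i j \<le> 0"
proof -
  have "green_inv n i j = (\<Sum>r=j..n. coef (r - i) * coef (r - j))"
    unfolding green_inv_def L_def using ij by (intro sum.mono_neutral_cong_right) auto
  also have "\<dots> = coef (j - i) + (\<Sum>r=Suc j..n. coef (r - i) * coef (r - j))"
    using ij by (subst sum.atLeast_Suc_atMost) (auto simp: coef_def)
  also have "(\<Sum>r=Suc j..n. coef (r - i) * coef (r - j)) \<le> (\<Sum>r=Suc j..n. pp (j - i) * pp (r - j))"
    using ij by (intro sum_mono) (auto simp: coef_def intro!: mult_right_mono pp_antimono pp_nonneg)
  also have "\<dots> = pp (j - i) * sum pp ((\<lambda>r. r - j) ` {Suc j..n})"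
    by (subst sum.reindex) (auto simp: sum_distrib_left inj_on_def)
  also have "\<dots> \<le> pp (j - i) * 1"
    by (intro mult_left_mono sum_pp_le_1 pp_nonneg) auto
  finally show ?thesis using ij by (simp add: coef_def)
qed

text \<open>The two triangular factors act one after the other: \<open>L\<close> looks back and
  produces \<open>u\<close>, its transpose looks ahead up to \<open>n\<close>.\<close>

lemma green_inv_apply:
  assumes i: "i \<in> {1..n}" and u: "\<And>r. r \<in> {1..n} \<Longrightarrow> (\<Sum>j=1..r. coef (r - j) * f j) = u r"
  shows "(\<Sum>j=1..n. green_inv n i j * f j) = u i - (\<Sum>r=Suc i..n. pp (r - i) * u r)"
proof -
  have "(\<Sum>j=1..n. green_inv n i j * f j) = (\<Sum>j=1..n. \<Sum>r=1..n. L r i * (L r j * f j))"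
    by (simp only: green_inv_def sum_distrib_right mult.assoc)
  also have "\<dots> = (\<Sum>r=1..n. L r i * (\<Sum>j=1..n. L r j * f j))"
    unfolding sum_distrib_left by (rule sum.swap)
  also have "\<dots> = (\<Sum>r=1..n. L r i * u r)"
  proof (intro sum.cong refl)
    fix r assume r: "r \<in> {1..n}"
    have "(\<Sum>j=1..n. L r j * f j) = (\<Sum>j=1..r. coef (r - j) * f j)"
      using r by (intro sum.mono_neutral_cong_right) (auto simp: L_def)
    then show "L r i * (\<Sum>j=1..n. L r j * f j) = L r i * u r" using u[OF r] by simp
  qed
  also have "\<dots> = (\<Sum>r=i..n. coef (r - i) * u r)"
    using i by (intro sum.mono_neutral_cong_right) (auto simp: L_def)
  also have "\<dots> = u i + (\<Sum>r=Suc i..n. coef (r - i) * u r)"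
    using i by (subst sum.atLeast_Suc_atMost) (auto simp: coef_def)
  also have "(\<Sum>r=Suc i..n. coef (r - i) * u r) = - (\<Sum>r=Suc i..n. pp (r - i) * u r)"
    unfolding sum_negf[symmetric] by (intro sum.cong) (auto simp: coef_def)
  finally show ?thesis by simp
qed

text \<open>Here \<open>L 1\<close> is one minus the partial sums of \<open>p\<close>, which is
  non-negative and decreasing; averaging it over later indices with weights of total mass at most
  one cannot exceed its current value.\<close>

lemma green_inv_one: "i \<in> {1..n} \<Longrightarrow> 0 \<le> (\<Sum>j=1..n. green_inv n i j * 1)"
proof -
  assume i: "i \<in> {1..n}"
  define u where "u r = (\<Sum>j=1..r. coef (r - j) * 1)" for r
  have u_eq: "u r = 1 - sum pp {1..<r}" if "1 \<le> r" for r
  proof -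
    have "u r = (\<Sum>j=0..<r. coef j)"
      unfolding u_def by (rule sum.reindex_bij_witness[where i="\<lambda>i. r - i" and j="\<lambda>j. r - j"]) auto
    also have "\<dots> = coef 0 + (\<Sum>j=1..<r. coef j)"
      using that by (subst sum.atLeast_Suc_lessThan) auto
    also have "(\<Sum>j=1..<r. coef j) = - sum pp {1..<r}"
      unfolding sum_negf[symmetric] by (intro sum.cong) (auto simp: coef_def)
    finally show ?thesis by (simp add: coef_def)
  qed
  have u0: "0 \<le> u i" using u_eq[of i] i sum_pp_le_1[of "{1..<i}"] by simp
  have "(\<Sum>r=Suc i..n. pp (r - i) * u r) \<le> (\<Sum>r=Suc i..n. pp (r - i) * u i)"
  proof (intro sum_mono mult_left_mono pp_nonneg)
    fix r assume r: "r \<in> {Suc i..n}"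
    have "sum pp {1..<i} \<le> sum pp {1..<r}" using r by (intro sum_mono2) (auto simp: pp_nonneg)
    then show "u r \<le> u i" using u_eq[of i] u_eq[of r] i r by simp
  qed
  also have "\<dots> = sum pp ((\<lambda>r. r - i) ` {Suc i..n}) * u i"
    by (subst sum.reindex) (auto simp: sum_distrib_right inj_on_def)
  also have "\<dots> \<le> 1 * u i"
    by (intro mult_right_mono sum_pp_le_1 u0) auto
  finally show ?thesis
    using green_inv_apply[of i n "\<lambda>_. 1" u] i by (simp add: u_def)
qed

text \<open>
  The potentials \<open>V h\<close> with \<open>h \<ge> 0\<close> factor through the upper triangular half \<open>u\<close> of the potential matrix.
\<close>

definition potential_half :: "(nat \<Rightarrow> real) \<Rightarrow> (nat \<Rightarrow> real) \<Rightarrow> bool" where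
  "potential_half u f \<longleftrightarrow> (\<forall>i\<ge>1. 0 \<le> u i \<and> (\<Sum>l=1..k. p l * u (i + l)) \<le> u i) \<and>
     (\<forall>j\<ge>1. f j = (\<Sum>m=1..j. \<phi> (j - m) * u m))"

text \<open>Since \<open>f = \<Phi> u\<close>, the back-looking factor returns \<open>u\<close>.
  Cutting the look-ahead sum at \<open>n\<close> omits non-negative terms only, so the inequality
  for \<open>u\<close> in \<open>potential_half\<close> settles every truncation at once.\<close>

lemma green_inv_potential:
  assumes "potential_half u f" "i \<in> {1..n}"
  shows "0 \<le> (\<Sum>j=1..n. green_inv n i j * f j)"
proof -
  have u0: "0 \<le> u i" and ex: "(\<Sum>l=1..k. p l * u (i + l)) \<le> u i" if "i \<ge> 1" for i
    using assms(1) that by (auto simp: potential_half_def)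
  have f: "f j = (\<Sum>m=1..n. \<Phi> j m * u m)" if "j \<in> {1..n}" for j
  proof -
    have "f j = (\<Sum>m=1..j. \<phi> (j - m) * u m)" using assms(1) that by (auto simp: potential_half_def)
    also have "\<dots> = (\<Sum>m=1..n. \<Phi> j m * u m)"
      unfolding \<Phi>_def using that by (intro sum.mono_neutral_cong_left) auto
    finally show ?thesis .
  qed
  have Lf: "(\<Sum>j=1..r. coef (r - j) * f j) = u r" if r: "r \<in> {1..n}" for r
  proof -
    have "(\<Sum>j=1..r. coef (r - j) * f j) = (\<Sum>j=1..n. L r j * f j)"
      using r by (intro sum.mono_neutral_cong_left) (auto simp: L_def)
    also have "\<dots> = (\<Sum>j=1..n. \<Sum>m=1..n. u m * (L r j * \<Phi> j m))"
      by (intro sum.cong refl) (simp add: f sum_distrib_left mult_ac)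
    also have "\<dots> = (\<Sum>m=1..n. u m * (\<Sum>j=1..n. L r j * \<Phi> j m))"
      unfolding sum_distrib_left by (rule sum.swap)
    also have "\<dots> = (\<Sum>m=1..n. u m * (if r = m then 1 else 0))"
      using r by (intro sum.cong refl) (simp only: L_\<Phi>)
    also have "\<dots> = u r" using r by (simp add: if_distrib[where f="\<lambda>c. _ * c"] cong: if_cong)
    finally show ?thesis .
  qed
  have "(\<Sum>r=Suc i..n. pp (r - i) * u r) = (\<Sum>l=1..n - i. pp l * u (i + l))"
    by (rule sum.reindex_bij_witness[where i="\<lambda>l. i + l" and j="\<lambda>r. r - i"]) auto
  also have "\<dots> = (\<Sum>l\<in>{1..n - i} \<inter> {1..k}. pp l * u (i + l))"
    by (intro sum.mono_neutral_right) (auto simp: pp_def)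
  also have "\<dots> \<le> (\<Sum>l\<in>{1..k}. pp l * u (i + l))"
    using u0 assms(2) by (intro sum_mono2) (auto intro!: mult_nonneg_nonneg pp_nonneg)
  finally show ?thesis
    using green_inv_apply[OF assms(2) Lf] ex[of i] assms(2) by (simp add: pp_def)
qed

section \<open>Large values along a subsequence\<close>

text \<open>The sparse section is inverted by restriction followed by the rank-one update, and
  comparison with a constant and the column of \<open>t N\<close> bounds the gamma rate by the
  inverse of \<open>green (t i) (t i) - \<eta> i - \<kappa> i * green (t i) (t N)\<close>. So
  \<open>x i\<close> is the level \<open>b i\<close> measured in units of that rate.\<close>

lemma permanental_lower_bound:
  fixes Z :: "nat \<Rightarrow> 'b \<Rightarrow> real" and t :: "nat \<Rightarrow> nat"
  assumes perm: "permanental_sequence a (\<lambda>i j. V i j + f j) M Z" and a: "a > 0"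
    and V: "\<And>i j. 1 \<le> i \<Longrightarrow> 1 \<le> j \<Longrightarrow> V i j = green i j"
    and f: "potential_half u f" and f0: "\<And>j. 1 \<le> j \<Longrightarrow> 0 \<le> f j"
    and t: "inj_on t {..<n}" and t1: "\<And>i. i < n \<Longrightarrow> 1 \<le> t i" and N: "N < n"
    and x: "\<And>i. i < n \<Longrightarrow> 1 \<le> x i" and \<eta>: "\<And>i. i < n \<Longrightarrow> 0 \<le> \<eta> i" and \<kappa>: "\<And>i. i < n \<Longrightarrow> 0 \<le> \<kappa> i"
    and bound: "\<And>i j. i < n \<Longrightarrow> j < n \<Longrightarrow> j \<noteq> i \<Longrightarrow> green (t j) (t i) \<le> \<eta> i + \<kappa> i * green (t j) (t N)"
    and b: "\<And>i. i < n \<Longrightarrow> b i \<le> x i * (green (t i) (t i) - \<eta> i - \<kappa> i * green (t i) (t N))"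
  shows "measure M {\<omega> \<in> space M. \<forall>i<n. Z (t i) \<omega> \<le> b i} \<le> (\<Prod>i<n. 1 - exp (- 1 - x i) / ((x i + 1) * Gamma a))"
proof -
  define T where "T = t ` {..<n}"
  define I where "I = {1..Max T}"
  have T: "finite T" "T \<subseteq> I" "T \<subseteq> {1..}" using t1 by (auto simp: T_def I_def)
  have green_pos: "0 < green i i" if "1 \<le> i" for i using green_diag_ge_1[OF that] by simp
  have off: "green_inv (Max T) i j \<le> 0" if "i \<in> I" "j \<in> I" "i \<noteq> j" for i j
    using green_inv_nonpos[of i "Max T" j] green_inv_nonpos[of j "Max T" i] green_inv_sym[of "Max T" i j] that
    by (cases "i < j") (auto simp: I_def)
  have "\<exists>B. left_inverse_on T B green \<and> (\<forall>i j. B i j = B j i) \<and>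
    (\<forall>i\<in>T. \<forall>j\<in>T. i \<noteq> j \<longrightarrow> B i j \<le> 0) \<and>
    (\<forall>u. (\<forall>i\<in>I. 0 \<le> (\<Sum>j\<in>I. green_inv (Max T) i j * u j)) \<longrightarrow> (\<forall>i\<in>T. 0 \<le> (\<Sum>j\<in>T. B i j * u j)))"
  proof (rule mmatrix_restrict[OF _ T(2) _ green_inv_sym off green_nonneg green_pos])
    show "left_inverse_on I (green_inv (Max T)) green" unfolding I_def by (rule left_inverse_green)
  qed (auto simp: I_def)
  then obtain B where B: "left_inverse_on T B green" and Bsym: "\<And>i j. B i j = B j i"
    and Boff: "\<And>i j. i \<in> T \<Longrightarrow> j \<in> T \<Longrightarrow> i \<noteq> j \<Longrightarrow> B i j \<le> 0"
    and Bpot: "\<And>u. (\<forall>i\<in>I. 0 \<le> (\<Sum>j\<in>I. green_inv (Max T) i j * u j)) \<Longrightarrow> (\<forall>i\<in>T. 0 \<le> (\<Sum>j\<in>T. B i j * u j))"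
    by blast
  have e0: "0 \<le> (\<Sum>j\<in>T. B i j)" if "i \<in> T" for i
    using Bpot[of "\<lambda>_. 1"] green_inv_one that by (auto simp: I_def)
  have h0: "0 \<le> (\<Sum>j\<in>T. B i j * f j)" if "i \<in> T" for i
    using Bpot[of f] green_inv_potential[OF f] that by (auto simp: I_def)
  obtain C where C: "left_inverse_on T C (\<lambda>i j. green i j + f j)"
    and Coff: "\<And>i j. i \<in> T \<Longrightarrow> j \<in> T \<Longrightarrow> i \<noteq> j \<Longrightarrow> C i j \<le> 0"
    and CB: "\<And>i. i \<in> T \<Longrightarrow> C i i \<le> B i i"
    using mmatrix_rank_one_update[OF T(1) B Bsym Boff e0 h0] by blast
  have tT: "t i \<in> T" if "i < n" for i using that by (simp add: T_def)
  have sumT: "(\<Sum>j\<in>T. g j) = (\<Sum>j<n. g (t j))" for g :: "nat \<Rightarrow> real"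
    unfolding T_def by (simp add: sum.reindex[OF t])
  have dom: "(\<forall>i<n. 0 < C (t i) (t i)) \<and>
    measure M {\<omega> \<in> space M. \<forall>i<n. Z (t i) \<omega> \<le> b i} \<le> (\<Prod>i<n. measure (gamma_distribution a (C (t i) (t i))) {..b i})"
  proof (rule permanental_domination[OF perm a t t1, where B="\<lambda>i j. C (t i) (t j)"])
    fix i l assume il: "i < n" "l < n"
    show "0 \<le> V (t i) (t l) + f (t l)" using V f0 t1 il green_nonneg by simp
    have "(\<Sum>j<n. C (t i) (t j) * (V (t j) (t l) + f (t l))) = (\<Sum>j<n. C (t i) (t j) * (green (t j) (t l) + f (t l)))"
      using V t1 il by (intro sum.cong) auto
    also have "\<dots> = (if t i = t l then 1 else 0)"
      using C tT il unfolding left_inverse_on_def sumT by blast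
    also have "t i = t l \<longleftrightarrow> i = l" using t il by (auto dest: inj_onD)
    finally show "(\<Sum>j<n. C (t i) (t j) * (V (t j) (t l) + f (t l))) = (if i = l then 1 else 0)" .
    show "C (t i) (t l) \<le> 0" if "i \<noteq> l" using Coff[OF tT tT] il that t by (auto dest: inj_onD)
  next
    fix i assume "i < n"
    then show "0 < V (t i) (t i) + f (t i)" using V f0 t1 green_pos by (simp add: add_pos_nonneg)
  qed
  have "(\<Prod>i<n. measure (gamma_distribution a (C (t i) (t i))) {..b i}) \<le> (\<Prod>i<n. 1 - exp (- 1 - x i) / ((x i + 1) * Gamma a))"
  proof (intro prod_mono conjI)
    fix i assume "i \<in> {..<n}"
    then have i: "i < n" by simp
    define G where "G = green (t i) (t i) - \<eta> i - \<kappa> i * green (t i) (t N)"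
    have Cpos: "0 < C (t i) (t i)" using dom i by blast
    have "B (t i) (t i) * G \<le> 1"
      unfolding G_def
    proof (rule mmatrix_inverse_diag_le[OF T(1) B Boff e0 tT[OF i] tT[OF N] \<eta>[OF i] \<kappa>[OF i]])
      fix j assume "j \<in> T" "j \<noteq> t i"
      then obtain j' where "j' < n" "j = t j'" by (auto simp: T_def)
      then show "green j (t i) \<le> \<eta> i + \<kappa> i * green j (t N)"
        using bound[OF i, of j'] \<open>j \<noteq> t i\<close> by auto
    qed auto
    moreover have "C (t i) (t i) * G \<le> B (t i) (t i) * G" if "0 \<le> G"
      using CB[OF tT[OF i]] that by (rule mult_right_mono)
    \<comment> \<open>The sign of \<open>G\<close> is not prescribed; when it is negative,
      positivity of the diagonal entry is enough.\<close>
    moreover have "C (t i) (t i) * G \<le> 1" if "G < 0"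
      using Cpos that mult_pos_neg[of "C (t i) (t i)" G] by linarith
    ultimately have CG: "C (t i) (t i) * G \<le> 1" by linarith
    have "C (t i) (t i) * b i \<le> C (t i) (t i) * (x i * G)"
      using b[OF i] Cpos unfolding G_def by (intro mult_left_mono) auto
    also have "\<dots> = x i * (C (t i) (t i) * G)" by simp
    also have "\<dots> \<le> x i * 1" using CG x[OF i] by (intro mult_left_mono) auto
    finally show "measure (gamma_distribution a (C (t i) (t i))) {..b i} \<le> 1 - exp (- 1 - x i) / ((x i + 1) * Gamma a)"
      using gamma_distribution_lower_tail[OF a Cpos x[OF i], of "b i"] by simp
  qed simp
  with dom show ?thesis by linarith
qed

text \<open>The event that all values from index \<open>c\<close> on are small has probability at
  most the product of the \<open>1 - q i\<close>, which diverges to zero with the sum of the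
  \<open>q i\<close>. The comparison column belongs to the last index of the current window, hence
  \<open>bound\<close> and \<open>b\<close> are required for every later \<open>N\<close>.\<close>

lemma permanental_infinitely_often:
  fixes Z :: "nat \<Rightarrow> 'b \<Rightarrow> real" and t :: "nat \<Rightarrow> nat"
  assumes perm: "permanental_sequence a (\<lambda>i j. V i j + f j) M Z" and a: "a > 0"
    and V: "\<And>i j. 1 \<le> i \<Longrightarrow> 1 \<le> j \<Longrightarrow> V i j = green i j"
    and f: "potential_half u f" and f0: "\<And>j. 1 \<le> j \<Longrightarrow> 0 \<le> f j"
    and t: "strict_mono t" and t1: "\<And>i. Suc 0 \<le> t i"
    and x: "\<And>i. m \<le> i \<Longrightarrow> 1 \<le> x i" and \<eta>: "\<And>i. m \<le> i \<Longrightarrow> 0 \<le> \<eta> i" and \<kappa>: "\<And>i. m \<le> i \<Longrightarrow> 0 \<le> \<kappa> i"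
    and bound: "\<And>i j N. m \<le> i \<Longrightarrow> m \<le> j \<Longrightarrow> i \<le> N \<Longrightarrow> j \<le> N \<Longrightarrow> j \<noteq> i \<Longrightarrow>
      green (t j) (t i) \<le> \<eta> i + \<kappa> i * green (t j) (t N)"
    and b: "\<And>i N. m \<le> i \<Longrightarrow> i \<le> N \<Longrightarrow> b i \<le> x i * (green (t i) (t i) - \<eta> i - \<kappa> i * green (t i) (t N))"
    and div: "\<not> summable (\<lambda>i. exp (- x i) / (x i + 1))"
  shows "AE \<omega> in M. \<exists>\<^sub>\<infinity>i. b i < Z (t i) \<omega>"
proof -
  have M: "prob_space M" and Zm: "\<And>j. 1 \<le> j \<Longrightarrow> Z j \<in> borel_measurable M"
    using perm unfolding permanental_sequence_def by blast+
  interpret prob_space M by fact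
  have [measurable]: "Z (t i) \<in> borel_measurable M" for i using Zm t1 by simp
  have G: "Gamma a > 0" using a by simp
  define q where "q i = exp (- 1 - x i) / ((x i + 1) * Gamma a)" for i
  have q_eq: "q i = exp (- 1) / Gamma a * (exp (- x i) / (x i + 1))" for i
    unfolding q_def by (simp add: exp_diff exp_minus divide_simps)
  have q0: "0 \<le> q i" if "m \<le> i" for i using x[OF that] G by (simp add: q_def)
  have ndiv: "\<not> summable (\<lambda>i. q (i + c))" for c
  proof -
    have "summable q \<longleftrightarrow> summable (\<lambda>i. exp (- x i) / (x i + 1))"
      unfolding q_eq[abs_def] using G by (subst summable_cmult_iff) simp
    with div show ?thesis using summable_iff_shift[of q c] by simp
  qed
  have zero: "AE \<omega> in M. \<not> (\<forall>i\<ge>c. Z (t i) \<omega> \<le> b i)" if c: "m \<le> c" for c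
  proof -
    define E where "E = {\<omega> \<in> space M. \<forall>i\<ge>c. Z (t i) \<omega> \<le> b i}"
    have E [measurable]: "E \<in> sets M" unfolding E_def by measurable
    have le: "prob E \<le> exp (- (\<Sum>i<Suc n. q (i + c)))" for n
    proof -
      have "prob E \<le> prob {\<omega> \<in> space M. \<forall>i<Suc n. Z (t (i + c)) \<omega> \<le> b (i + c)}"
        by (intro finite_measure_mono) (auto simp: E_def)
      also have "\<dots> \<le> (\<Prod>i<Suc n. 1 - exp (- 1 - x (i + c)) / ((x (i + c) + 1) * Gamma a))"
      proof (rule permanental_lower_bound[OF perm a V f f0, where N=n and \<eta>="\<lambda>i. \<eta> (i + c)" and \<kappa>="\<lambda>i. \<kappa> (i + c)"])
        show "inj_on (\<lambda>i. t (i + c)) {..<Suc n}"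
          using strict_mono_eq[OF t] by (auto simp: inj_on_def)
      qed (use c t1 in \<open>auto intro!: x \<eta> \<kappa> bound b\<close>)
      also have "\<dots> = (\<Prod>i<Suc n. 1 - q (i + c))" by (simp add: q_def)
      also have "\<dots> \<le> (\<Prod>i<Suc n. exp (- q (i + c)))"
      proof (intro prod_mono conjI)
        fix i
        show "1 - q (i + c) \<le> exp (- q (i + c))" using exp_ge_add_one_self[of "- q (i + c)"] by simp
        \<comment> \<open>Read off from the lower bound itself with a single index:
          \<open>1 - q (i + c)\<close> dominates a probability.\<close>
        have "q (i + c) \<le> 1"
        proof -
          have "prob {\<omega> \<in> space M. \<forall>j<(1::nat). Z (t (i + c)) \<omega> \<le> b (i + c)} \<le> (\<Prod>j<(1::nat). 1 - exp (- 1 - x (i + c)) / ((x (i + c) + 1) * Gamma a))"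
            by (rule permanental_lower_bound[OF perm a V f f0, where n=1 and N=0 and t="\<lambda>_. t (i + c)" and
                x="\<lambda>_. x (i + c)" and b="\<lambda>_. b (i + c)" and \<eta>="\<lambda>_. \<eta> (i + c)" and \<kappa>="\<lambda>_. \<kappa> (i + c)"])
              (use c t1 in \<open>auto simp: inj_on_def intro!: x \<eta> \<kappa> b\<close>)
          then have "0 \<le> (\<Prod>j<(1::nat). 1 - exp (- 1 - x (i + c)) / ((x (i + c) + 1) * Gamma a))"
            by (rule order_trans[OF measure_nonneg])
          then show ?thesis unfolding q_def by simp
        qed
        then show "0 \<le> 1 - q (i + c)" by simp
      qed
      also have "\<dots> = exp (- (\<Sum>i<Suc n. q (i + c)))"
        by (simp only: exp_sum[symmetric] finite_lessThan sum_negf)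
      finally show ?thesis .
    qed
    have "prob E = 0"
    proof (rule ccontr)
      assume "prob E \<noteq> 0"
      then have pos: "0 < prob E" by (simp add: zero_less_measure_iff)
      have "(\<Sum>i<n. q (i + c)) \<le> - ln (prob E)" for n
      proof -
        have "ln (prob E) \<le> ln (exp (- (\<Sum>i<Suc n. q (i + c))))"
          using le[of n] pos by (subst ln_le_cancel_iff) auto
        then have "(\<Sum>i<Suc n. q (i + c)) \<le> - ln (prob E)" by simp
        moreover have "(\<Sum>i<n. q (i + c)) \<le> (\<Sum>i<Suc n. q (i + c))"
          using q0[of "n + c"] c by simp
        ultimately show ?thesis by linarith
      qed
      then have "summable (\<lambda>i. q (i + c))"
        by (intro summableI_nonneg_bounded[where x="- ln (prob E)"]) (use q0 c in auto)
      with ndiv show False by blast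
    qed
    then have "AE \<omega> in M. \<omega> \<notin> E"
      by (intro AE_not_in null_setsI) (auto simp: emeasure_eq_measure)
    then show ?thesis by (auto simp: E_def elim: AE_mp)
  qed
  have "AE \<omega> in M. \<forall>c. \<not> (\<forall>i\<ge>c + m. Z (t i) \<omega> \<le> b i)"
    unfolding AE_all_countable using zero by auto
  then show ?thesis
  proof eventually_elim
    case (elim \<omega>)
    show ?case
      unfolding INFM_nat_le
    proof
      fix c
      from elim obtain i where "i \<ge> c + m" "b i < Z (t i) \<omega>" by (auto simp: not_le)
      then show "\<exists>i\<ge>c. b i < Z (t i) \<omega>" by (intro exI[of _ i]) auto
    qed
  qed
qed

end

section \<open>Asymptotics of the autoregressive covariance\<close>

lemma sum_triangle_swap:
  fixes g :: "nat \<Rightarrow> nat \<Rightarrow> real"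
  shows "(\<Sum>n=1..N. \<Sum>l=1..n. g l n) = (\<Sum>l=1..N. \<Sum>n=l..N. g l n)"
  by (simp add: sum.Sigma)
    (rule sum.reindex_bij_witness[where i="\<lambda>(a, b). (b, a)" and j="\<lambda>(a, b). (b, a)"], auto)

context autoregression
begin

lemma \<phi>_1: "\<phi> 1 = p 1"
  using \<phi>_rec[of 1] k2 by (simp add: pp_def)

text \<open>Young's inequality on partial sums, so that it may be used before convergence is known.
  It serves both \<open>\<phi>\<close> and its square, each time bounding a sum by one plus a
  fraction of itself.\<close>

lemma convolution_sum_le:
  assumes a: "\<And>n. 0 \<le> a n"
  shows "(\<Sum>n=1..N. \<Sum>l=1..n. pp l * a (n - l)) \<le> (\<Sum>l=1..k. p l) * (\<Sum>n\<le>N. a n)"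
proof -
  have "(\<Sum>n=1..N. \<Sum>l=1..n. pp l * a (n - l)) = (\<Sum>l=1..N. \<Sum>n=l..N. pp l * a (n - l))"
    by (rule sum_triangle_swap)
  also have "\<dots> = (\<Sum>l=1..N. pp l * (\<Sum>n=l..N. a (n - l)))"
    by (simp add: sum_distrib_left)
  also have "\<dots> \<le> (\<Sum>l=1..N. pp l * (\<Sum>n\<le>N. a n))"
  proof (intro sum_mono mult_left_mono pp_nonneg)
    fix l
    have "(\<Sum>n=l..N. a (n - l)) = sum a ((\<lambda>n. n - l) ` {l..N})"
      by (subst sum.reindex) (auto simp: inj_on_def)
    also have "\<dots> \<le> (\<Sum>n\<le>N. a n)" by (intro sum_mono2) (auto simp: a)
    finally show "(\<Sum>n=l..N. a (n - l)) \<le> (\<Sum>n\<le>N. a n)" .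
  qed
  also have "\<dots> = sum pp {1..N} * (\<Sum>n\<le>N. a n)" by (simp add: sum_distrib_right)
  also have "\<dots> \<le> (\<Sum>l=1..k. p l) * (\<Sum>n\<le>N. a n)"
    by (intro mult_right_mono sum_pp_le sum_nonneg a) auto
  finally show ?thesis .
qed

lemma green_diag: "green j j = (\<Sum>n<j. (\<phi> n)\<^sup>2)"
  unfolding green_def power2_eq_square
  by (simp, rule sum.reindex_bij_witness[where i="\<lambda>n. j - n" and j="\<lambda>m. j - m"]) auto

lemma \<phi>_summable:
  assumes s: "(\<Sum>l=1..k. p l) < 1"
  shows "summable \<phi>"
proof (rule summableI_nonneg_bounded[where x="1 / (1 - (\<Sum>l=1..k. p l))"])
  define s where "s = (\<Sum>l=1..k. p l)"
  fix N
  have "(\<Sum>n\<le>N. \<phi> n) = \<phi> 0 + (\<Sum>n=1..N. \<phi> n)"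
    by (simp add: atMost_atLeast0 sum.atLeast_Suc_atMost)
  also have "(\<Sum>n=1..N. \<phi> n) = (\<Sum>n=1..N. \<Sum>l=1..n. pp l * \<phi> (n - l))"
    by (intro sum.cong) (auto simp: \<phi>_rec)
  also have "\<dots> \<le> s * (\<Sum>n\<le>N. \<phi> n)"
    unfolding s_def by (rule convolution_sum_le) (rule \<phi>_nonneg)
  finally have "(\<Sum>n\<le>N. \<phi> n) \<le> 1 / (1 - s)"
    using s unfolding s_def[symmetric] by (simp add: field_simps)
  moreover have "(\<Sum>n<N. \<phi> n) \<le> (\<Sum>n\<le>N. \<phi> n)"
    by (intro sum_mono2) (auto simp: \<phi>_nonneg)
  ultimately show "(\<Sum>n<N. \<phi> n) \<le> 1 / (1 - (\<Sum>l=1..k. p l))" by (simp add: s_def)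
qed (rule \<phi>_nonneg)

text \<open>Cauchy-Schwarz with weights \<open>p\<close> gives a renewal inequality for the squares
  with an additional factor \<open>s\<close>; summing it bounds the sum of squares by one plus
  \<open>s\<^sup>2\<close> times itself. This is where the upper bound for \<open>c_star\<close>
  comes from; the lower one consists of the terms of order 0 and 1.\<close>

lemma \<phi>_squares_le:
  assumes s: "(\<Sum>l=1..k. p l) < 1"
  shows "(\<Sum>n\<le>N. (\<phi> n)\<^sup>2) \<le> 1 / (1 - (\<Sum>l=1..k. p l)\<^sup>2)"
proof -
  define s where "s = (\<Sum>l=1..k. p l)"
  have s0: "0 \<le> s" unfolding s_def using p_positive by (intro sum_nonneg) (auto intro: less_imp_le)
  have s1: "s\<^sup>2 < 1" using s0 s unfolding s_def[symmetric] by (simp add: power_less_one_iff)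
  have sq: "(\<phi> n)\<^sup>2 \<le> s * (\<Sum>l=1..n. pp l * (\<phi> (n - l))\<^sup>2)" if "1 \<le> n" for n
  proof -
    have "(\<phi> n)\<^sup>2 = (\<Sum>l=1..n. sqrt (pp l) * (sqrt (pp l) * \<phi> (n - l)))\<^sup>2"
      using \<phi>_rec[OF that] by (simp add: pp_nonneg flip: mult.assoc)
    also have "\<dots> \<le> (\<Sum>l=1..n. (sqrt (pp l))\<^sup>2) * (\<Sum>l=1..n. (sqrt (pp l) * \<phi> (n - l))\<^sup>2)"
      by (rule Cauchy_Schwarz_ineq_sum)
    also have "\<dots> = sum pp {1..n} * (\<Sum>l=1..n. pp l * (\<phi> (n - l))\<^sup>2)"
      by (simp add: power_mult_distrib pp_nonneg)
    also have "\<dots> \<le> s * (\<Sum>l=1..n. pp l * (\<phi> (n - l))\<^sup>2)"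
      unfolding s_def by (intro mult_right_mono sum_pp_le sum_nonneg mult_nonneg_nonneg pp_nonneg) auto
    finally show ?thesis .
  qed
  have "(\<Sum>n\<le>N. (\<phi> n)\<^sup>2) = (\<phi> 0)\<^sup>2 + (\<Sum>n=1..N. (\<phi> n)\<^sup>2)"
    by (simp add: atMost_atLeast0 sum.atLeast_Suc_atMost)
  also have "(\<Sum>n=1..N. (\<phi> n)\<^sup>2) \<le> (\<Sum>n=1..N. s * (\<Sum>l=1..n. pp l * (\<phi> (n - l))\<^sup>2))"
    by (intro sum_mono sq) auto
  also have "\<dots> = s * (\<Sum>n=1..N. \<Sum>l=1..n. pp l * (\<phi> (n - l))\<^sup>2)"
    by (simp only: sum_distrib_left)
  also have "\<dots> \<le> s * (s * (\<Sum>n\<le>N. (\<phi> n)\<^sup>2))"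
    unfolding s_def using s0[unfolded s_def] by (intro mult_left_mono convolution_sum_le) auto
  finally have "(\<Sum>n\<le>N. (\<phi> n)\<^sup>2) * (1 - s\<^sup>2) \<le> 1"
    by (simp add: algebra_simps power2_eq_square)
  then show ?thesis using s1 unfolding s_def[symmetric] by (simp add: pos_le_divide_eq)
qed

lemma \<phi>_squares_summable:
  assumes s: "(\<Sum>l=1..k. p l) < 1"
  shows "summable (\<lambda>n. (\<phi> n)\<^sup>2)"
proof (rule summableI_nonneg_bounded[where x="1 / (1 - (\<Sum>l=1..k. p l)\<^sup>2)"])
  fix N
  have "(\<Sum>n<N. (\<phi> n)\<^sup>2) \<le> (\<Sum>n\<le>N. (\<phi> n)\<^sup>2)" by (intro sum_mono2) auto
  also note \<phi>_squares_le[OF s]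
  finally show "(\<Sum>n<N. (\<phi> n)\<^sup>2) \<le> 1 / (1 - (\<Sum>l=1..k. p l)\<^sup>2)" .
qed simp

lemma \<phi>_square_norm_bounds:
  assumes s: "(\<Sum>l=1..k. p l) < 1"
  shows "1 + (p 1)\<^sup>2 \<le> (\<Sum>n. (\<phi> n)\<^sup>2)" "(\<Sum>n. (\<phi> n)\<^sup>2) \<le> 1 / (1 - (\<Sum>l=1..k. p l)\<^sup>2)"
proof -
  have "sum (\<lambda>n. (\<phi> n)\<^sup>2) {..<2} \<le> (\<Sum>n. (\<phi> n)\<^sup>2)"
    by (rule sum_le_suminf[OF \<phi>_squares_summable[OF s]]) auto
  then show "1 + (p 1)\<^sup>2 \<le> (\<Sum>n. (\<phi> n)\<^sup>2)"
    using \<phi>_1 by (simp add: numeral_2_eq_2)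
  show "(\<Sum>n. (\<phi> n)\<^sup>2) \<le> 1 / (1 - (\<Sum>l=1..k. p l)\<^sup>2)"
    using summable_LIMSEQ'[OF \<phi>_squares_summable[OF s]] \<phi>_squares_le[OF s]
    by (intro LIMSEQ_le_const2) auto
qed

lemma green_diag_tendsto:
  assumes s: "(\<Sum>l=1..k. p l) < 1"
  shows "(\<lambda>j. green j j) \<longlonglongrightarrow> (\<Sum>n. (\<phi> n)\<^sup>2)"
  unfolding green_diag by (rule summable_LIMSEQ[OF \<phi>_squares_summable[OF s]])

text \<open>One factor \<open>\<phi>\<close> is summable and the other is uniformly small beyond lag
  \<open>r\<close>. The lag does not depend on the position, so an arithmetic progression is sparse
  enough.\<close>

lemma green_offdiag_small:
  assumes s: "(\<Sum>l=1..k. p l) < 1" and \<eta>: "0 < \<eta>"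
  shows "\<exists>r. \<forall>i j. i + r \<le> j \<longrightarrow> green i j \<le> \<eta>"
proof -
  define S where "S = (\<Sum>n. \<phi> n)"
  have sm: "summable \<phi>" by (rule \<phi>_summable[OF s])
  have S0: "0 \<le> S" unfolding S_def by (intro suminf_nonneg sm \<phi>_nonneg)
  have "\<phi> \<longlonglongrightarrow> 0" by (rule summable_LIMSEQ_zero[OF sm])
  then have "eventually (\<lambda>n. \<phi> n < \<eta> / (S + 1)) sequentially"
    using \<eta> S0 by (intro order_tendstoD) auto
  then obtain r where r: "\<And>n. n \<ge> r \<Longrightarrow> \<phi> n < \<eta> / (S + 1)" by (auto simp: eventually_sequentially)
  have "green i j \<le> \<eta>" if ij: "i + r \<le> j" for i j
  proof -
    have "green i j = (\<Sum>m=1..i. \<phi> (i - m) * \<phi> (j - m))" using ij by (simp add: green_def)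
    also have "\<dots> \<le> (\<Sum>m=1..i. \<phi> (i - m) * (\<eta> / (S + 1)))"
      using ij r by (intro sum_mono mult_left_mono \<phi>_nonneg) (auto intro: less_imp_le)
    also have "\<dots> = (\<eta> / (S + 1)) * (\<Sum>m=1..i. \<phi> (i - m))"
      by (simp add: sum_distrib_left mult.commute)
    also have "(\<Sum>m=1..i. \<phi> (i - m)) = (\<Sum>n<i. \<phi> n)"
      by (rule sum.reindex_bij_witness[where i="\<lambda>n. i - n" and j="\<lambda>m. i - m"]) auto
    also have "(\<eta> / (S + 1)) * (\<Sum>n<i. \<phi> n) \<le> (\<eta> / (S + 1)) * S"
      unfolding S_def using \<eta> S0[unfolded S_def] by (intro mult_left_mono sum_le_suminf sm) (auto simp: \<phi>_nonneg)
    also have "\<dots> \<le> \<eta>" using \<eta> S0 by (simp add: field_simps)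
    finally show ?thesis .
  qed
  then show ?thesis by blast
qed

lemma green_le_min: "green i j \<le> real (min i j)"
proof -
  have "green i j \<le> (\<Sum>m=1..min i j. 1)"
    unfolding green_def by (intro sum_mono mult_le_one \<phi>_nonneg \<phi>_le_1)
  then show ?thesis by simp
qed

section \<open>The renewal theorem with a rate, and the Green matrix in the critical case\<close>

lemma \<phi>_pos: "0 < \<phi> n"
proof (induction n)
  case (Suc n)
  have "0 < p 1 * \<phi> n" using Suc p_positive[of 1] k2 by simp
  also have "p 1 * \<phi> n = (\<Sum>l\<in>{1}. pp l * \<phi> (Suc n - l))" using k2 by (simp add: pp_def)
  also have "\<dots> \<le> (\<Sum>l=1..Suc n. pp l * \<phi> (Suc n - l))"
    by (intro sum_mono2) (auto intro!: mult_nonneg_nonneg pp_nonneg \<phi>_nonneg)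
  also have "\<dots> = \<phi> (Suc n)" using \<phi>_rec[of "Suc n"] by simp
  finally show ?case .
qed simp

lemma \<phi>_window: "k \<le> n \<Longrightarrow> \<phi> n = (\<Sum>l=1..k. p l * \<phi> (n - l))"
proof -
  assume "k \<le> n"
  have "\<phi> n = (\<Sum>l=1..n. pp l * \<phi> (n - l))" using \<open>k \<le> n\<close> k2 by (intro \<phi>_rec) simp
  also have "\<dots> = (\<Sum>l=1..k. p l * \<phi> (n - l))"
    using \<open>k \<le> n\<close> by (intro sum.mono_neutral_cong_right) (auto simp: pp_def)
  finally show ?thesis .
qed

text \<open>In generating functions, \<open>P / (1 - x)\<close> times \<open>1 / P\<close> is
  \<open>1 / (1 - x)\<close>. In terms of the walk, time \<open>n\<close> is decomposed according to
  the last visited point \<open>n - j\<close>.\<close>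

lemma renewal_identity:
  "(\<Sum>j=0..n. (1 - sum pp {1..j}) * \<phi> (n - j)) = 1"
proof -
  have "(\<Sum>i=0..j. coef i) = 1 - sum pp {1..j}" for j
  proof -
    have "(\<Sum>i=1..j. coef i) = - sum pp {1..j}"
      unfolding sum_negf[symmetric] by (intro sum.cong) (auto simp: coef_def)
    then show ?thesis by (simp add: sum.atLeast_Suc_atMost coef_def)
  qed
  then have "Abs_fps (\<lambda>j. 1 - sum pp {1..j}) = Abs_fps coef * Abs_fps (\<lambda>_. 1)"
    by (simp add: fps_eq_iff fps_mult_nth)
  then have "Abs_fps (\<lambda>j. 1 - sum pp {1..j}) * Abs_fps \<phi> = Abs_fps (\<lambda>_. 1) * (Abs_fps coef * Abs_fps \<phi>)"
    by (simp add: mult_ac)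
  also have "\<dots> = Abs_fps (\<lambda>_. 1)" by (simp add: coef_fps)
  finally have "fps_nth (Abs_fps (\<lambda>j. 1 - sum pp {1..j}) * Abs_fps \<phi>) n = fps_nth (Abs_fps (\<lambda>_. 1)) n"
    by (rule arg_cong)
  then show ?thesis by (simp add: fps_mult_nth)
qed

definition \<mu> :: real where "\<mu> = (\<Sum>l=1..k. real l * p l)"

text \<open>Every value is an average of the \<open>k\<close> preceding ones with weights at least
  \<open>p k\<close>, so the oscillation contracts by \<open>1 - p k\<close> over each block of
  length \<open>k\<close>. This gives a limit and a rate; the value of the limit follows from the
  renewal identity, whose weights are then the tails of \<open>p\<close>.\<close>

lemma \<phi>_geometric:
  assumes s: "(\<Sum>l=1..k. p l) = 1"
  shows "\<exists>C \<theta>. 0 \<le> C \<and> 0 < \<theta> \<and> \<theta> < 1 \<and> 1 \<le> \<mu> \<and> (\<forall>n. \<bar>\<phi> n - 1 / \<mu>\<bar> \<le> C * \<theta> ^ n)"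
proof -
  define \<beta> where "\<beta> = p k"
  have \<beta>: "0 < \<beta>" using p_pos by (simp add: \<beta>_def)
  have "(\<Sum>l\<in>{1, k}. p l) \<le> (\<Sum>l=1..k. p l)"
    using k2 p_positive by (intro sum_mono2) (auto intro: less_imp_le)
  then have "p 1 + \<beta> \<le> 1" using k2 s by (simp add: \<beta>_def)
  then have \<beta>1: "\<beta> < 1" using p_positive[of 1] k2 by simp
  have \<beta>_le: "\<beta> \<le> p l" if "1 \<le> l" "l \<le> k" for l
    using p_decreasing[of l k] that by (simp add: \<beta>_def)
  text \<open>The last value \<open>y\<close> of a window enters each of the next \<open>k\<close> averages with weight at least \<open>\<beta>\<close>.\<close>
  have osc: "\<exists>lo hi. hi - lo \<le> (1 - \<beta>) ^ j \<and> (\<forall>n\<ge>j * k. lo \<le> \<phi> n \<and> \<phi> n \<le> hi)" for j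
  proof (induction j)
    case 0
    show ?case by (rule exI[of _ 0], rule exI[of _ 1]) (auto simp: \<phi>_nonneg \<phi>_le_1)
  next
    case (Suc j)
    then obtain lo hi where d: "hi - lo \<le> (1 - \<beta>) ^ j" and b: "\<And>n. n \<ge> j * k \<Longrightarrow> lo \<le> \<phi> n \<and> \<phi> n \<le> hi" by blast
    define y where "y = \<phi> (j * k + k - 1)"
    have y: "lo \<le> y" "y \<le> hi" unfolding y_def using b k2 by auto
    define lo' where "lo' = (1 - \<beta>) * lo + \<beta> * y"
    define hi' where "hi' = (1 - \<beta>) * hi + \<beta> * y"
    have *: "lo' \<le> \<phi> n \<and> \<phi> n \<le> hi'" if "n \<ge> Suc j * k" for n
      using that
    proof (induction n rule: less_induct)
      case (less n)
      have w: "\<phi> n = (\<Sum>l=1..k. p l * \<phi> (n - l))" using less.prems by (intro \<phi>_window) simp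
      \<comment> \<open>The first \<open>k\<close> values after the block contain \<open>y\<close>
        explicitly in their average. Later ones average values already known to lie between
        \<open>lo'\<close> and \<open>hi'\<close>.\<close>
      show ?case
      proof (cases "n < Suc j * k + k")
        case True
        define l0 where "l0 = n - (j * k + k - 1)"
        have l0: "l0 \<in> {1..k}" "n - l0 = j * k + k - 1" using True less.prems k2 by (auto simp: l0_def)
        have wt: "\<beta> \<le> p l0" using \<beta>_le l0 by auto
        have split: "(\<Sum>l=1..k. p l * v l) = p l0 * v l0 + (\<Sum>l\<in>{1..k} - {l0}. p l * v l)" for v :: "nat \<Rightarrow> real"
          using l0 by (intro sum.remove) auto
        have rest: "(\<Sum>l\<in>{1..k} - {l0}. p l) = 1 - p l0"
          using split[of "\<lambda>_. 1"] s by simp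
        have up: "(\<Sum>l\<in>{1..k} - {l0}. p l * \<phi> (n - l)) \<le> (\<Sum>l\<in>{1..k} - {l0}. p l * hi)"
          using b less.prems p_positive by (intro sum_mono mult_left_mono) (auto intro: less_imp_le)
        have lw: "(\<Sum>l\<in>{1..k} - {l0}. p l * lo) \<le> (\<Sum>l\<in>{1..k} - {l0}. p l * \<phi> (n - l))"
          using b less.prems p_positive by (intro sum_mono mult_left_mono) (auto intro: less_imp_le)
        have "\<phi> n \<le> p l0 * y + (1 - p l0) * hi"
          using w split[of "\<lambda>l. \<phi> (n - l)"] up l0(2) rest by (simp add: y_def flip: sum_distrib_right)
        moreover have "p l0 * y + (1 - p l0) * hi \<le> hi'"
          using mult_right_mono[OF wt, of "hi - y"] y by (simp add: hi'_def algebra_simps)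
        moreover have "p l0 * y + (1 - p l0) * lo \<le> \<phi> n"
          using w split[of "\<lambda>l. \<phi> (n - l)"] lw l0(2) rest by (simp add: y_def flip: sum_distrib_right)
        moreover have "lo' \<le> p l0 * y + (1 - p l0) * lo"
          using mult_right_mono[OF wt, of "y - lo"] y by (simp add: lo'_def algebra_simps)
        ultimately show ?thesis by linarith
      next
        case False
        have IH: "lo' \<le> \<phi> (n - l) \<and> \<phi> (n - l) \<le> hi'" if "l \<in> {1..k}" for l
          using less.IH[of "n - l"] that False k2 by auto
        have "\<phi> n \<le> (\<Sum>l=1..k. p l * hi')"
          unfolding w using IH p_positive by (intro sum_mono mult_left_mono) (auto intro: less_imp_le)
        moreover have "(\<Sum>l=1..k. p l * lo') \<le> \<phi> n"
          unfolding w using IH p_positive by (intro sum_mono mult_left_mono) (auto intro: less_imp_le)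
        ultimately show ?thesis using s by (simp flip: sum_distrib_right)
      qed
    qed
    moreover have "hi' - lo' \<le> (1 - \<beta>) ^ Suc j"
      using mult_left_mono[OF d, of "1 - \<beta>"] \<beta>1 by (simp add: hi'_def lo'_def algebra_simps)
    ultimately show ?case by blast
  qed
  \<comment> \<open>The contraction per block spread over its \<open>k\<close> steps; the prefactor
    \<open>1 / (1 - \<beta>)\<close> below pays for rounding in \<open>n div k\<close>.\<close>
  define \<theta> where "\<theta> = (1 - \<beta>) powr (1 / k)"
  have \<theta>: "0 < \<theta>" "\<theta> < 1" using \<beta> \<beta>1 k2 powr_less_mono2[of "1 / k" "1 - \<beta>" 1] by (auto simp: \<theta>_def)
  have pow: "(1 - \<beta>) ^ (n div k) \<le> (1 / (1 - \<beta>)) * \<theta> ^ n" for n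
  proof -
    have "real n / k - 1 \<le> real (n div k)"
      using floor_divide_of_nat_eq[where 'a=real, of n k] by linarith
    then have "(1 - \<beta>) powr real (n div k) \<le> (1 - \<beta>) powr (real n / k - 1)"
      using \<beta> \<beta>1 by (intro powr_mono') auto
    also have "\<dots> = (1 / (1 - \<beta>)) * \<theta> ^ n"
      using \<beta>1 by (simp add: powr_diff \<theta>_def powr_powr flip: powr_realpow)
    finally show ?thesis using \<beta>1 by (simp add: powr_realpow)
  qed
  have close: "\<bar>\<phi> n - \<phi> m\<bar> \<le> (1 / (1 - \<beta>)) * \<theta> ^ n" if "n \<le> m" for n m
  proof -
    obtain lo hi where "hi - lo \<le> (1 - \<beta>) ^ (n div k)" "\<And>m. m \<ge> (n div k) * k \<Longrightarrow> lo \<le> \<phi> m \<and> \<phi> m \<le> hi"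
      using osc[of "n div k"] by blast
    moreover have "(n div k) * k \<le> n" by simp
    ultimately have "\<bar>\<phi> n - \<phi> m\<bar> \<le> (1 - \<beta>) ^ (n div k)"
      using that by (smt (verit) order_trans)
    with pow[of n] show ?thesis by linarith
  qed
  have \<theta>0: "(\<lambda>n. (1 / (1 - \<beta>)) * \<theta> ^ n) \<longlonglongrightarrow> 0"
    using \<theta> by (intro tendsto_mult_right_zero LIMSEQ_realpow_zero) auto
  have "Cauchy \<phi>"
  proof (rule metric_CauchyI)
    fix e :: real assume e: "0 < e"
    from order_tendstoD(2)[OF \<theta>0, of "e / 2"] e obtain N where N: "(1 / (1 - \<beta>)) * \<theta> ^ N < e / 2"
      by (auto simp: eventually_sequentially)
    show "\<exists>N. \<forall>m\<ge>N. \<forall>n\<ge>N. dist (\<phi> m) (\<phi> n) < e"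
    proof (intro exI[of _ N] allI impI)
      fix m n assume "N \<le> m" "N \<le> n"
      then show "dist (\<phi> m) (\<phi> n) < e"
        unfolding dist_real_def using close[of N m] close[of N n] N by linarith
    qed
  qed
  then obtain lim\<phi> where lim\<phi>: "\<phi> \<longlonglongrightarrow> lim\<phi>" using Cauchy_convergent_iff convergent_def by blast
  have tail_sum: "1 - sum pp {1..j} = sum pp {Suc j..k}" for j
  proof -
    have "sum pp {1..k} = 1" using s by (simp add: pp_def)
    moreover have "sum pp {1..k} = sum pp {1..j} + sum pp {Suc j..k}" if "j \<le> k"
      using sum.ub_add_nat[of 1 j pp "k - j"] that by simp
    moreover have "sum pp {1..j} = sum pp {1..k}" if "k < j"
      using that by (intro sum.mono_neutral_right) (auto simp: pp_def)
    ultimately show ?thesis by (cases "j \<le> k") auto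
  qed
  \<comment> \<open>The mean of a positive integer law as the sum of its tails.\<close>
  have "(\<Sum>j<k. sum pp {Suc j..k}) = \<mu>"
  proof -
    have "(\<Sum>j<k. sum pp {Suc j..k}) = (\<Sum>j=0..<k. \<Sum>l=Suc j..k. pp l)"
      by (simp add: atLeast0LessThan)
    also have "\<dots> = (\<Sum>j=1..k. \<Sum>l=j..k. pp l)"
      by (rule sum.reindex_bij_witness[where i="\<lambda>j. j - 1" and j=Suc]) auto
    also have "\<dots> = (\<Sum>l=1..k. \<Sum>j=1..l. pp l)"
      by (rule sum_triangle_swap[symmetric])
    also have "\<dots> = \<mu>" by (simp add: \<mu>_def pp_def)
    finally show ?thesis .
  qed
  moreover have "(\<lambda>n. \<Sum>j<k. sum pp {Suc j..k} * \<phi> (n - j)) \<longlonglongrightarrow> (\<Sum>j<k. sum pp {Suc j..k} * lim\<phi>)"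
  proof (intro tendsto_sum tendsto_mult tendsto_const)
    fix j
    show "(\<lambda>n. \<phi> (n - j)) \<longlonglongrightarrow> lim\<phi>"
      by (rule LIMSEQ_offset[where k=j]) (simp add: lim\<phi>)
  qed
  moreover have "eventually (\<lambda>n. (\<Sum>j<k. sum pp {Suc j..k} * \<phi> (n - j)) = 1) sequentially"
    using eventually_ge_at_top[of k]
  proof eventually_elim
    case (elim n)
    have "1 = (\<Sum>j=0..n. sum pp {Suc j..k} * \<phi> (n - j))"
      using renewal_identity[of n] unfolding tail_sum by simp
    also have "\<dots> = (\<Sum>j<k. sum pp {Suc j..k} * \<phi> (n - j))"
      using elim by (intro sum.mono_neutral_right) auto
    finally show ?case by simp
  qed
  then have "(\<lambda>n. \<Sum>j<k. sum pp {Suc j..k} * \<phi> (n - j)) \<longlonglongrightarrow> 1"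
    by (rule tendsto_eventually)
  ultimately have "\<mu> * lim\<phi> = 1"
    using LIMSEQ_unique by (fastforce simp flip: sum_distrib_right)
  moreover have \<mu>: "1 \<le> \<mu>"
  proof -
    have "(\<Sum>l=1..k. 1 * p l) \<le> \<mu>"
      unfolding \<mu>_def using p_positive by (intro sum_mono mult_right_mono) (auto intro: less_imp_le)
    then show ?thesis using s by simp
  qed
  ultimately have lim\<phi>_eq: "lim\<phi> = 1 / \<mu>" by (simp add: field_simps)
  have "\<bar>\<phi> n - 1 / \<mu>\<bar> \<le> (1 / (1 - \<beta>)) * \<theta> ^ n" for n
  proof (rule LIMSEQ_le_const2)
    show "(\<lambda>m. \<bar>\<phi> n - \<phi> m\<bar>) \<longlonglongrightarrow> \<bar>\<phi> n - 1 / \<mu>\<bar>"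
      using lim\<phi> unfolding lim\<phi>_eq by (intro tendsto_intros)
  qed (use close in blast)
  then show ?thesis
    using \<theta> \<mu> \<beta>1 by (intro exI[of _ "1 / (1 - \<beta>)"] exI[of _ \<theta>]) auto
qed

text \<open>Geometric convergence makes the deviations of the squares
  \<open>(\<phi> n)\<^sup>2\<close> from their limit and the increments of \<open>\<phi>\<close>
  absolutely summable. The first yields the diagonal up to a bounded error, the second a Lipschitz
  bound uniform in the other index, as the chaining requires.\<close>

lemma green_critical:
  assumes s: "(\<Sum>l=1..k. p l) = 1"
  shows "\<exists>C. \<forall>j n. \<bar>green j j - real j / \<mu>\<^sup>2\<bar> \<le> C \<and> \<bar>green (Suc j) n - green j n\<bar> \<le> C"
proof -
  obtain C \<theta> where C: "0 \<le> C" and \<theta>: "0 < \<theta>" "\<theta> < 1" and \<mu>: "1 \<le> \<mu>"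
    and close: "\<And>n. \<bar>\<phi> n - 1 / \<mu>\<bar> \<le> C * \<theta> ^ n"
    using \<phi>_geometric[OF s] by blast
  have geo: "(\<Sum>n<j. C * \<theta> ^ n) \<le> C / (1 - \<theta>)" for j
  proof -
    have "(\<Sum>n<j. \<theta> ^ n) \<le> 1 / (1 - \<theta>)"
      using sum_le_suminf[OF summable_geometric[of \<theta>], of "{..<j}"] \<theta> suminf_geometric[of \<theta>] by simp
    then show ?thesis using C mult_left_mono[of "\<Sum>n<j. \<theta> ^ n" "1 / (1 - \<theta>)" C]
      by (simp add: sum_distrib_left)
  qed
  define C' where "C' = 2 * (C / (1 - \<theta>)) + 1"
  have diag: "\<bar>green j j - real j / \<mu>\<^sup>2\<bar> \<le> C'" for j
  proof -
    have "green j j - real j / \<mu>\<^sup>2 = (\<Sum>n<j. (\<phi> n)\<^sup>2 - 1 / \<mu>\<^sup>2)"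
      by (simp add: green_diag sum_subtractf)
    also have "\<bar>\<dots>\<bar> \<le> (\<Sum>n<j. \<bar>(\<phi> n)\<^sup>2 - 1 / \<mu>\<^sup>2\<bar>)" by (rule sum_abs)
    also have "\<dots> \<le> (\<Sum>n<j. 2 * (C * \<theta> ^ n))"
    proof (rule sum_mono)
      fix n
      have "(\<phi> n)\<^sup>2 - 1 / \<mu>\<^sup>2 = (\<phi> n - 1 / \<mu>) * (\<phi> n + 1 / \<mu>)"
        by (simp add: power2_eq_square algebra_simps)
      moreover have "\<bar>\<phi> n + 1 / \<mu>\<bar> \<le> 2"
      proof -
        have "0 \<le> 1 / \<mu>" "1 / \<mu> \<le> 1" using \<mu> by auto
        then show ?thesis using \<phi>_nonneg[of n] \<phi>_le_1[of n] by linarith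
      qed
      ultimately have "\<bar>(\<phi> n)\<^sup>2 - 1 / \<mu>\<^sup>2\<bar> \<le> (C * \<theta> ^ n) * 2"
        unfolding abs_mult[symmetric] using close[of n] C \<theta>
        by (simp only: abs_mult) (intro mult_mono, auto)
      then show "\<bar>(\<phi> n)\<^sup>2 - 1 / \<mu>\<^sup>2\<bar> \<le> 2 * (C * \<theta> ^ n)" by simp
    qed
    also have "\<dots> \<le> 2 * (C / (1 - \<theta>))"
      using geo[of j] by (simp flip: sum_distrib_left)
    finally show ?thesis by (simp add: C'_def)
  qed
  have lip: "\<bar>green (Suc j) n - green j n\<bar> \<le> C'" for j n
  proof -
    define d where "d m = \<Phi> (Suc j) m - \<Phi> j m" for m
    have "green (Suc j) n - green j n = (\<Sum>m=1..Suc j. d m * \<Phi> n m)"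
      using green_\<Phi>[of "Suc j" "Suc j" n] green_\<Phi>[of j "Suc j" n]
      by (simp add: d_def sum_subtractf left_diff_distrib)
    then have "\<bar>green (Suc j) n - green j n\<bar> \<le> (\<Sum>m=1..Suc j. \<bar>d m * \<Phi> n m\<bar>)"
      by (simp only: sum_abs)
    also have "\<dots> \<le> (\<Sum>m=1..Suc j. \<bar>d m\<bar>)"
    proof (rule sum_mono)
      fix m
      have "\<bar>\<Phi> n m\<bar> \<le> 1" using \<phi>_nonneg \<phi>_le_1 by (simp add: \<Phi>_def)
      then show "\<bar>d m * \<Phi> n m\<bar> \<le> \<bar>d m\<bar>"
        unfolding abs_mult by (intro mult_left_le) auto
    qed
    also have "\<dots> = (\<Sum>m=1..j. \<bar>d m\<bar>) + \<bar>d (Suc j)\<bar>"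
      by (rule sum.cl_ivl_Suc[THEN trans]) simp
    also have "\<bar>d (Suc j)\<bar> = 1" by (simp add: d_def \<Phi>_def)
    also have "(\<Sum>m=1..j. \<bar>d m\<bar>) = (\<Sum>n<j. \<bar>\<phi> (Suc n) - \<phi> n\<bar>)"
    proof (rule sum.reindex_bij_witness[where i="\<lambda>n. j - n" and j="\<lambda>m. j - m"])
      fix m assume "m \<in> {1..j}"
      then show "\<bar>\<phi> (Suc (j - m)) - \<phi> (j - m)\<bar> = \<bar>d m\<bar>"
        by (simp add: d_def \<Phi>_def Suc_diff_le)
    qed auto
    also have "\<dots> \<le> (\<Sum>n<j. 2 * (C * \<theta> ^ n))"
    proof (rule sum_mono)
      fix n
      have "C * \<theta> ^ Suc n \<le> C * \<theta> ^ n"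
        using C \<theta> by (intro mult_left_mono power_decreasing) auto
      then show "\<bar>\<phi> (Suc n) - \<phi> n\<bar> \<le> 2 * (C * \<theta> ^ n)"
        using close[of n] close[of "Suc n"] by linarith
    qed
    also have "\<dots> \<le> 2 * (C / (1 - \<theta>))"
      using geo[of j] by (simp flip: sum_distrib_left)
    finally show ?thesis by (simp add: C'_def)
  qed
  show ?thesis using diag lip by blast
qed

text \<open>All \<open>\<phi> n\<close> are positive with a positive limit, so they have a positive
  lower bound; its square serves as \<open>c\<close>.\<close>

lemma green_critical_lower:
  assumes s: "(\<Sum>l=1..k. p l) = 1"
  shows "\<exists>c>0. \<forall>i j. c * real (min i j) \<le> green i j"
proof -
  obtain C \<theta> where C: "0 \<le> C" and \<theta>: "0 < \<theta>" "\<theta> < 1" and \<mu>: "1 \<le> \<mu>"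
    and close: "\<And>n. \<bar>\<phi> n - 1 / \<mu>\<bar> \<le> C * \<theta> ^ n"
    using \<phi>_geometric[OF s] by blast
  have "(\<lambda>n. C * \<theta> ^ n) \<longlonglongrightarrow> 0"
    using \<theta> by (intro tendsto_mult_right_zero LIMSEQ_realpow_zero) auto
  then have "eventually (\<lambda>n. C * \<theta> ^ n < 1 / (2 * \<mu>)) sequentially"
    using \<mu> by (intro order_tendstoD) auto
  then obtain N where N: "\<And>n. n \<ge> N \<Longrightarrow> C * \<theta> ^ n < 1 / (2 * \<mu>)" by (auto simp: eventually_sequentially)
  define c where "c = Min (insert (1 / (2 * \<mu>)) (\<phi> ` {..<N}))"
  have c0: "0 < c" unfolding c_def using \<mu> \<phi>_pos by (subst Min_gr_iff) auto
  have c: "c \<le> \<phi> n" for n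
  proof (cases "n < N")
    case True
    then show ?thesis unfolding c_def by (intro Min_le) auto
  next
    case False
    have "c \<le> 1 / (2 * \<mu>)" unfolding c_def by (intro Min_le) auto
    moreover have "1 / \<mu> = 1 / (2 * \<mu>) + 1 / (2 * \<mu>)" using \<mu> by (simp add: field_simps)
    ultimately show ?thesis using N[of n] False close[of n] by linarith
  qed
  have "c\<^sup>2 * real (min i j) \<le> green i j" for i j
  proof -
    have "(\<Sum>m=1..min i j. c\<^sup>2) \<le> green i j"
      unfolding green_def power2_eq_square using c c0 by (intro sum_mono mult_mono) (auto simp: \<phi>_nonneg)
    then show ?thesis by (simp add: mult.commute)
  qed
  then show ?thesis using c0 by (intro exI[of _ "c\<^sup>2"]) auto
qed

end

section \<open>Upper bounds for permanental sequences\<close>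

lemma permanental_laplace_one:
  assumes perm: "permanental_sequence a K M Z" and j: "1 \<le> j" and s: "0 < s"
  shows "(LINT \<omega>|M. exp (- (s * Z j \<omega>))) = (1 + K j j * s) powr (- a)"
proof -
  have "(LINT \<omega>|M. exp (- (\<Sum>m<(1::nat). s * Z j \<omega>))) =
        Determinant.det (1\<^sub>m 1 + Matrix.mat 1 1 (\<lambda>(a, b). K j j) * mat_diag 1 (\<lambda>_. s)) powr (- a)"
    using perm j s unfolding permanental_sequence_def
    by (elim conjE allE[of _ "1::nat"] allE[of _ "\<lambda>_. j"] allE[of _ "\<lambda>_. s"]) (auto simp: inj_on_def)
  also have "Determinant.det (1\<^sub>m 1 + Matrix.mat 1 1 (\<lambda>(a, b). K j j) * mat_diag 1 (\<lambda>_. s)) = 1 + K j j * s"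
    by (subst det_single) (auto simp: mat_diag_def scalar_prod_def)
  finally show ?thesis by simp
qed

lemma permanental_laplace_two:
  assumes perm: "permanental_sequence a K M Z" and ij: "1 \<le> i" "1 \<le> j" "i \<noteq> j" and s: "0 < s" and t: "0 < t"
    and Kj: "0 \<le> K j j"
  shows "(LINT \<omega>|M. exp (- (s * Z i \<omega> + t * Z j \<omega>))) =
    ((1 + K i i * s) * (1 + K j j * t) - K i j * K j i * s * t) powr (- a)"
proof -
  define e :: "nat \<Rightarrow> nat" where "e m = (if m = 0 then i else j)" for m
  define r :: "nat \<Rightarrow> real" where "r m = (if m = 0 then s else t)" for m
  have two: "{..<2::nat} = {0, 1}" by auto
  have "(LINT \<omega>|M. exp (- (\<Sum>m<(2::nat). r m * Z (e m) \<omega>))) =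
        Determinant.det (1\<^sub>m 2 + Matrix.mat 2 2 (\<lambda>(a, b). K (e a) (e b)) * mat_diag 2 r) powr (- a)"
  proof -
    have "inj_on e {..<2} \<and> (\<forall>m<2. 1 \<le> e m \<and> 0 < r m)"
      using ij s t by (auto simp: inj_on_def e_def r_def two)
    then show ?thesis using perm unfolding permanental_sequence_def by blast
  qed
  moreover have "1\<^sub>m 2 + Matrix.mat 2 2 (\<lambda>(a, b). K (e a) (e b)) * mat_diag 2 r =
      Matrix.mat (Suc 1) (Suc 1) (\<lambda>(a, b). (if a = b then 1 else 0) + K (e a) (e b) * r b)"
    by (subst mat_diag_mult_right[of _ 2]) (auto simp: numeral_2_eq_2)
  moreover have "Determinant.det (Matrix.mat (Suc 1) (Suc 1) (\<lambda>(a, b). (if a = b then 1 else 0) + K (e a) (e b) * r b)) =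
      (1 + K i i * s) * (1 + K j j * t) - K i j * K j i * s * t"
  proof -
    define N :: "nat \<Rightarrow> nat \<Rightarrow> real" where "N a b = (if a = b then 1 else 0) + K (e a) (e b) * r b" for a b
    have N11: "0 < N 1 1" using Kj t by (simp add: N_def e_def r_def add_pos_nonneg)
    have "Determinant.det (Matrix.mat (Suc 1) (Suc 1) (\<lambda>(a, b). N a b)) =
        N 1 1 * Determinant.det (Matrix.mat 1 1 (\<lambda>(a, b). N a b - N a 1 * N 1 b / N 1 1))"
      by (rule det_eliminate_last) (use N11 in simp)
    also have "Determinant.det (Matrix.mat 1 1 (\<lambda>(a, b). N a b - N a 1 * N 1 b / N 1 1)) = N 0 0 - N 0 1 * N 1 0 / N 1 1"
      by (subst det_single) auto
    also have "N 1 1 * (N 0 0 - N 0 1 * N 1 0 / N 1 1) = N 0 0 * N 1 1 - N 0 1 * N 1 0"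
      using N11 by (simp add: right_diff_distrib)
    finally show ?thesis by (simp add: N_def e_def r_def)
  qed
  ultimately show ?thesis by (simp add: two e_def r_def)
qed

text \<open>Chernoff's bound: the marginal law is gamma of shape \<open>a\<close> and rate
  \<open>1 / K j j\<close>, so the exponential moment is explicit below that rate.\<close>

lemma permanental_tail:
  assumes perm: "permanental_sequence a K M Z" and a: "a > 0" and j: "1 \<le> j"
    and K: "0 < K j j" and \<theta>: "0 \<le> \<theta>" "\<theta> * K j j < 1"
  shows "measure M {\<omega> \<in> space M. b < Z j \<omega>} \<le> exp (- \<theta> * b) * (1 - K j j * \<theta>) powr (- a)"
proof -
  have M: "prob_space M" and Z [measurable]: "Z j \<in> borel_measurable M"
    and Z0: "\<And>\<omega>. \<omega> \<in> space M \<Longrightarrow> 0 \<le> Z j \<omega>"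
    using perm j unfolding permanental_sequence_def by blast+
  interpret prob_space M by fact
  have "(\<integral>\<^sup>+\<omega>. ennreal (1 * exp (\<theta> * Z j \<omega>)) \<partial>M) = ennreal ((1 - K j j * \<theta>) powr (- a))"
  proof (rule exp_moment_of_laplace)
    fix s :: real assume s: "0 < s"
    have "integrable M (\<lambda>\<omega>. exp (- (s * Z j \<omega>)))"
      by (rule integrable_const_bound[of _ 1]) (use s Z0 in \<open>auto intro!: AE_I2 mult_nonneg_nonneg\<close>)
    then have "(\<integral>\<^sup>+\<omega>. ennreal (exp (- (s * Z j \<omega>))) \<partial>M) = ennreal ((1 + K j j * s) powr (- a))"
      by (subst nn_integral_eq_integral) (auto simp: permanental_laplace_one[OF perm j s])
    then show "(\<integral>\<^sup>+\<omega>. ennreal (1 * exp (- s * Z j \<omega>)) \<partial>M) = ennreal ((1 + K j j * s) powr (- a))" by simp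
  qed (use Z0 K a \<theta> in auto)
  then have eq: "(\<integral>\<^sup>+\<omega>. ennreal (exp (\<theta> * Z j \<omega>)) \<partial>M) = ennreal ((1 - K j j * \<theta>) powr (- a))" by simp
  have "ennreal (prob {\<omega> \<in> space M. b < Z j \<omega>}) = (\<integral>\<^sup>+\<omega>. indicator {\<omega> \<in> space M. b < Z j \<omega>} \<omega> \<partial>M)"
    by (simp add: emeasure_eq_measure)
  also have "\<dots> \<le> (\<integral>\<^sup>+\<omega>. ennreal (exp (- \<theta> * b)) * ennreal (exp (\<theta> * Z j \<omega>)) \<partial>M)"
  proof (rule nn_integral_mono)
    fix \<omega>
    have "1 \<le> exp (- \<theta> * b) * exp (\<theta> * Z j \<omega>)" if "b < Z j \<omega>"
    proof -
      have "0 \<le> \<theta> * (Z j \<omega> - b)" using \<theta>(1) that by simp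
      then show ?thesis by (simp add: right_diff_distrib flip: exp_add)
    qed
    then show "indicator {\<omega> \<in> space M. b < Z j \<omega>} \<omega> \<le> ennreal (exp (- \<theta> * b)) * ennreal (exp (\<theta> * Z j \<omega>))"
      by (auto simp: indicator_def ennreal_mult''[symmetric])
  qed
  also have "\<dots> = ennreal (exp (- \<theta> * b) * (1 - K j j * \<theta>) powr (- a))"
    by (subst nn_integral_cmult) (auto simp: eq ennreal_mult''[symmetric])
  finally show ?thesis by (simp add: ennreal_le_iff)
qed

text \<open>
  Exponential tilting by \<open>exp (- \<theta> (1 + \<kappa>) Z\<^sub>j)\<close> leaves \<open>Z\<^sub>i\<close> with a gamma law, which replaces the
  Gaussian increment estimate in the chaining argument.
\<close>

lemma permanental_increment_tail:
  assumes perm: "permanental_sequence a K M Z" and a: "a > 0" and ij: "1 \<le> i" "1 \<le> j" "i \<noteq> j"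
    and K: "0 < K i i" "0 < K j j" and D: "0 \<le> K i i * K j j - K i j * K j i"
    and \<theta>: "0 < \<theta>" and \<kappa>: "0 \<le> \<kappa>"
    and small: "\<theta> * (1 + \<kappa>) * (K i i * K j j - K i j * K j i) \<le> K j j * (1 + \<kappa>) - K i i"
  shows "measure M {\<omega> \<in> space M. (1 + \<kappa>) * Z j \<omega> + v < Z i \<omega>} \<le> exp (- \<theta> * v)"
proof -
  have M: "prob_space M" and Zm: "Z i \<in> borel_measurable M" "Z j \<in> borel_measurable M"
    and Z0: "\<And>\<omega>. \<omega> \<in> space M \<Longrightarrow> 0 \<le> Z i \<omega>" "\<And>\<omega>. \<omega> \<in> space M \<Longrightarrow> 0 \<le> Z j \<omega>"
    using perm ij unfolding permanental_sequence_def by blast+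
  interpret prob_space M by fact
  note [measurable] = Zm
  define t where "t = \<theta> * (1 + \<kappa>)"
  define d where "d = K i i * K j j - K i j * K j i"
  define A where "A = 1 + K j j * t"
  define B where "B = K i i + d * t"
  have t: "0 < t" using \<theta> \<kappa> by (simp add: t_def)
  have A: "0 < A" and B: "0 < B" using K t D by (auto simp: A_def B_def d_def intro: add_pos_nonneg)
  \<comment> \<open>The condition \<open>small\<close> is exactly what makes
    \<open>A - B * \<theta>\<close> at least one, hence the exponential moment of
    \<open>\<theta> * (Z i - (1 + \<kappa>) * Z j)\<close> at most one. The excess
    \<open>\<kappa> * Z j\<close> pays for both the growth of the diagonal and the 2 by 2
    minor.\<close>
  have "0 \<le> \<theta> * (K j j * (1 + \<kappa>) - K i i - t * d)"
    using small \<theta> by (simp add: t_def d_def)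
  then have AB: "1 \<le> A - B * \<theta>" by (simp add: A_def B_def t_def algebra_simps)
  have "(\<integral>\<^sup>+\<omega>. ennreal (exp (- t * Z j \<omega>) * exp (\<theta> * Z i \<omega>)) \<partial>M) = ennreal ((A - B * \<theta>) powr (- a))"
  proof (rule exp_moment_of_laplace)
    fix s :: real assume s: "0 < s"
    have "integrable M (\<lambda>\<omega>. exp (- (s * Z i \<omega> + t * Z j \<omega>)))"
    proof (rule integrable_const_bound[of _ 1])
      show "AE \<omega> in M. norm (exp (- (s * Z i \<omega> + t * Z j \<omega>))) \<le> 1"
      proof (rule AE_I2)
        fix \<omega> assume "\<omega> \<in> space M"
        then have "0 \<le> s * Z i \<omega> + t * Z j \<omega>"
          using s t Z0 by (intro add_nonneg_nonneg mult_nonneg_nonneg) auto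
        then show "norm (exp (- (s * Z i \<omega> + t * Z j \<omega>))) \<le> 1" by simp
      qed
    qed simp
    then have "(\<integral>\<^sup>+\<omega>. ennreal (exp (- (s * Z i \<omega> + t * Z j \<omega>))) \<partial>M) =
        ennreal (((1 + K i i * s) * (1 + K j j * t) - K i j * K j i * s * t) powr (- a))"
      using permanental_laplace_two[OF perm ij s t] K by (subst nn_integral_eq_integral) auto
    also have "(1 + K i i * s) * (1 + K j j * t) - K i j * K j i * s * t = A + B * s"
      by (simp add: A_def B_def d_def algebra_simps)
    finally show "(\<integral>\<^sup>+\<omega>. ennreal (exp (- t * Z j \<omega>) * exp (- s * Z i \<omega>)) \<partial>M) = ennreal ((A + B * s) powr (- a))"
      by (simp add: add.commute flip: exp_add)
  qed (use Z0 A B a AB in \<open>auto simp: mult.commute\<close>)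
  moreover have "(A - B * \<theta>) powr (- a) \<le> 1"
    using AB a powr_mono2'[of "- a" 1 "A - B * \<theta>"] by simp
  ultimately have le: "(\<integral>\<^sup>+\<omega>. ennreal (exp (- t * Z j \<omega>) * exp (\<theta> * Z i \<omega>)) \<partial>M) \<le> 1"
    by simp
  have "ennreal (prob {\<omega> \<in> space M. (1 + \<kappa>) * Z j \<omega> + v < Z i \<omega>}) =
      (\<integral>\<^sup>+\<omega>. indicator {\<omega> \<in> space M. (1 + \<kappa>) * Z j \<omega> + v < Z i \<omega>} \<omega> \<partial>M)"
    by (simp add: emeasure_eq_measure)
  also have "\<dots> \<le> (\<integral>\<^sup>+\<omega>. ennreal (exp (- \<theta> * v)) * ennreal (exp (- t * Z j \<omega>) * exp (\<theta> * Z i \<omega>)) \<partial>M)"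
  proof (rule nn_integral_mono)
    fix \<omega>
    have "1 \<le> exp (- \<theta> * v) * (exp (- t * Z j \<omega>) * exp (\<theta> * Z i \<omega>))" if "(1 + \<kappa>) * Z j \<omega> + v < Z i \<omega>"
    proof -
      have "0 \<le> \<theta> * (Z i \<omega> - (1 + \<kappa>) * Z j \<omega> - v)" using \<theta> that by simp
      then show ?thesis by (simp add: t_def algebra_simps flip: exp_add)
    qed
    then show "indicator {\<omega> \<in> space M. (1 + \<kappa>) * Z j \<omega> + v < Z i \<omega>} \<omega> \<le>
        ennreal (exp (- \<theta> * v)) * ennreal (exp (- t * Z j \<omega>) * exp (\<theta> * Z i \<omega>))"
      by (auto simp: indicator_def ennreal_mult''[symmetric])
  qed
  also have "\<dots> = ennreal (exp (- \<theta> * v)) * (\<integral>\<^sup>+\<omega>. ennreal (exp (- t * Z j \<omega>) * exp (\<theta> * Z i \<omega>)) \<partial>M)"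
    by (subst nn_integral_cmult) auto
  also have "\<dots> \<le> ennreal (exp (- \<theta> * v)) * 1"
    by (rule mult_left_mono[OF le]) simp
  finally show ?thesis by (simp add: ennreal_le_iff)
qed

text \<open>At the logarithmic scale a union bound over all indices converges without any control of
  increments: the tail at index \<open>j\<close> is of order \<open>j powr (- \<gamma>)\<close> with
  \<open>\<gamma> > 1\<close>.\<close>

lemma permanental_upper_log:
  assumes perm: "permanental_sequence a K M Z" and a: "a > 0"
    and K: "\<And>j. 1 \<le> j \<Longrightarrow> 0 < K j j" and lim: "(\<lambda>j. K j j) \<longlonglongrightarrow> c" and \<epsilon>: "0 < \<epsilon>" and c: "0 \<le> c"
  shows "AE \<omega> in M. eventually (\<lambda>j. Z j \<omega> \<le> (c + \<epsilon>) * ln (real j)) sequentially"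
proof -
  have M: "prob_space M" and Zm: "\<And>j. 1 \<le> j \<Longrightarrow> Z j \<in> borel_measurable M"
    using perm unfolding permanental_sequence_def by blast+
  interpret prob_space M by fact
  have [measurable]: "Z (Suc n) \<in> borel_measurable M" for n using Zm by simp
  \<comment> \<open>Between \<open>1 / (c + \<epsilon>)\<close> and
    \<open>1 / (c + \<epsilon> / 4)\<close>: the first inequality gives \<open>\<gamma> > 1\<close>,
    the second keeps the moments bounded once \<open>K j j < c + \<epsilon> / 4\<close>.\<close>
  define \<theta> where "\<theta> = 1 / (c + \<epsilon> / 2)"
  define \<rho> where "\<rho> = (c + \<epsilon> / 4) * \<theta>"
  have \<theta>: "0 < \<theta>" using c \<epsilon> by (simp add: \<theta>_def)
  have \<rho>: "\<rho> < 1" using c \<epsilon> by (simp add: \<rho>_def \<theta>_def)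
  define \<gamma> where "\<gamma> = \<theta> * (c + \<epsilon>)"
  have \<gamma>: "1 < \<gamma>" using c \<epsilon> by (simp add: \<gamma>_def \<theta>_def)
  have "eventually (\<lambda>j. K j j < c + \<epsilon> / 4) sequentially"
    using \<epsilon> by (intro order_tendstoD(2)[OF lim]) auto
  then have ev: "eventually (\<lambda>n. K (Suc n) (Suc n) < c + \<epsilon> / 4) sequentially"
    by (rule eventually_sequentially_Suc[THEN iffD2])
  define E where "E n = {\<omega> \<in> space M. (c + \<epsilon>) * ln (real (Suc n)) < Z (Suc n) \<omega>}" for n
  have [measurable]: "E n \<in> sets M" for n unfolding E_def by measurable
  have "summable (\<lambda>n. prob (E n))"
  proof (rule summable_comparison_test_ev)
    have "summable (\<lambda>n. real n powr (- \<gamma>))" using \<gamma> by (simp add: summable_real_powr_iff)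
    then have "summable (\<lambda>n. real (Suc n) powr (- \<gamma>))" by (subst summable_Suc_iff)
    then show "summable (\<lambda>n. (1 - \<rho>) powr (- a) * real (Suc n) powr (- \<gamma>))"
      by (rule summable_mult)
    show "eventually (\<lambda>n. norm (prob (E n)) \<le> (1 - \<rho>) powr (- a) * real (Suc n) powr (- \<gamma>)) sequentially"
      using ev
    proof eventually_elim
      case (elim n)
      have le: "K (Suc n) (Suc n) * \<theta> \<le> \<rho>"
        unfolding \<rho>_def using elim \<theta> by (intro mult_right_mono) auto
      have "prob (E n) \<le> exp (- \<theta> * ((c + \<epsilon>) * ln (real (Suc n)))) * (1 - K (Suc n) (Suc n) * \<theta>) powr (- a)"
        unfolding E_def by (rule permanental_tail[OF perm a _ K]) (use \<theta> le \<rho> in \<open>auto simp: mult.commute\<close>)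
      also have "(1 - K (Suc n) (Suc n) * \<theta>) powr (- a) \<le> (1 - \<rho>) powr (- a)"
        using le \<rho> a by (intro powr_mono2') auto
      also have "exp (- \<theta> * ((c + \<epsilon>) * ln (real (Suc n)))) = real (Suc n) powr (- \<gamma>)"
        by (simp add: powr_def \<gamma>_def mult.assoc)
      finally show ?case by (simp add: mult.commute mult_left_mono)
    qed
  qed
  then have "AE \<omega> in M. eventually (\<lambda>n. \<omega> \<in> space M - E n) sequentially"
    by (intro borel_cantelli_AE1) (auto simp: emeasure_eq_measure)
  then show ?thesis
  proof eventually_elim
    case (elim \<omega>)
    then have "eventually (\<lambda>n. Z (Suc n) \<omega> \<le> (c + \<epsilon>) * ln (real (Suc n))) sequentially"
      by eventually_elim (auto simp: E_def)
    then show ?case by (rule eventually_sequentially_Suc[THEN iffD1])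
  qed
qed

section \<open>Dyadic chaining for the iterated logarithm\<close>

lemma sum_three_quarters: "(\<Sum>e=1..d. (3/4::real) ^ e) \<le> 3"
proof -
  have "(\<Sum>e=1..d. (3/4::real) ^ e) = 3 * (1 - (3/4) ^ d)"
    by (induction d) (auto simp: algebra_simps)
  then show ?thesis by simp
qed

text \<open>
  Dyadic chaining: for \<open>2 ^ (q + m) \<le> j < 2 ^ (q + m + 1)\<close> let \<open>J d\<close> be \<open>j\<close> rounded down to a multiple
  of \<open>2 ^ (q - d)\<close>.  The step from \<open>J (d - 1)\<close> to \<open>J d\<close> costs a factor \<open>1 + \<kappa> d\<close> and a summand \<open>v q d\<close>,
  with \<open>\<kappa> d = \<epsilon> * (3/4) ^ d\<close>: since \<open>2 * (3/4)\<^sup>2 > 1\<close>, the tail exponent outgrows the \<open>2 ^ (m + d)\<close>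
  intervals of level \<open>d\<close>, while the errors remain summable in \<open>d\<close>.
\<close>

lemma permanental_upper_loglog:
  assumes perm: "permanental_sequence a K M Z" and a: "a > 0"
    and c: "0 < c" and C: "0 < C"
    and lower: "\<And>j. 1 \<le> j \<Longrightarrow> c * real j \<le> K j j"
    and incr: "\<And>j \<Delta>. 1 \<le> j \<Longrightarrow> 1 \<le> \<Delta> \<Longrightarrow> \<Delta> \<le> j \<Longrightarrow> K (j + \<Delta>) (j + \<Delta>) \<le> K j j + C * real \<Delta>"
    and disc0: "\<And>j \<Delta>. 1 \<le> j \<Longrightarrow> 1 \<le> \<Delta> \<Longrightarrow> \<Delta> \<le> j \<Longrightarrow>
      0 \<le> K (j + \<Delta>) (j + \<Delta>) * K j j - K (j + \<Delta>) j * K j (j + \<Delta>)"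
    and disc: "\<And>j \<Delta>. 1 \<le> j \<Longrightarrow> 1 \<le> \<Delta> \<Longrightarrow> \<Delta> \<le> j \<Longrightarrow>
      K (j + \<Delta>) (j + \<Delta>) * K j j - K (j + \<Delta>) j * K j (j + \<Delta>) \<le> C * real j * real \<Delta>"
    and lim: "(\<lambda>j. K j j / real j) \<longlonglongrightarrow> L" and L: "0 \<le> L" and \<epsilon>: "0 < \<epsilon>" "\<epsilon> \<le> 1"
  shows "AE \<omega> in M. eventually (\<lambda>j. Z j \<omega> \<le>
    exp (3 * \<epsilon>) * ((1 + \<epsilon>) * (L + \<epsilon>) + 3 * \<epsilon>) * (1 + \<epsilon>) * (real j * ln (ln (real j)))) sequentially"
proof -
  have M: "prob_space M" and Zm: "\<And>j. 1 \<le> j \<Longrightarrow> Z j \<in> borel_measurable M"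
    and Z0: "\<And>j \<omega>. 1 \<le> j \<Longrightarrow> \<omega> \<in> space M \<Longrightarrow> 0 \<le> Z j \<omega>"
    using perm unfolding permanental_sequence_def by blast+
  interpret prob_space M by fact
  have Kpos: "0 < K j j" if "1 \<le> j" for j
  proof -
    have "0 < c * real j" using c that by simp
    with lower[OF that] show ?thesis by linarith
  qed
  \<comment> \<open>A coarse level with \<open>2 ^ m\<close> points per dyadic block makes every
    increment small relative to its position. By \<open>m1\<close>, the growth of \<open>K\<close>
    over a step of level \<open>d\<close> uses at most half of \<open>\<kappa> d * K j j\<close>;
    \<open>m2\<close> makes the tail exponent at least \<open>8 + d\<close>.\<close>
  obtain m :: nat where "max (2 * C / (\<epsilon> * c)) (32 * C / (\<epsilon>\<^sup>2 * c)) < 2 ^ m"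
    using real_arch_pow[of 2 "max (2 * C / (\<epsilon> * c)) (32 * C / (\<epsilon>\<^sup>2 * c))"] by auto
  then have m1: "2 * C \<le> \<epsilon> * c * 2 ^ m" and m2: "32 * C \<le> \<epsilon>\<^sup>2 * c * 2 ^ m"
    using \<epsilon> c by (auto simp: field_simps)
  define \<kappa> where "\<kappa> d = \<epsilon> * (3/4) ^ d" for d :: nat
  have \<kappa>: "0 < \<kappa> d" "\<kappa> d \<le> 1" for d
    using \<epsilon> by (auto simp: \<kappa>_def intro!: mult_le_one power_le_one)
  define v where "v q d = \<kappa> d * 2 ^ (q + m) * ln (real q)" for q d :: nat
  \<comment> \<open>The b-th point of level \<open>d - 1\<close> in the block starting at
    \<open>2 ^ (q + m)\<close>; a block has \<open>2 ^ (m + d - 1)\<close> of them, and adding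
    \<open>2 ^ (q - d)\<close> reaches the new point of level \<open>d\<close>. The points of level
    0 form \<open>grid\<close>.\<close>
  define par where "par q d b = (2::nat) ^ (q + m) + b * 2 ^ (q - d + 1)" for q d b :: nat
  define grid where "grid q b = (2::nat) ^ (q + m) + b * 2 ^ q" for q b :: nat
  have par1: "1 \<le> par q d b" "2 ^ (q + m) \<le> par q d b" for q d b
    by (auto simp: par_def Suc_le_eq intro!: trans_le_add1)
  have grid1: "1 \<le> grid q b" for q b
    by (auto simp: grid_def Suc_le_eq intro!: trans_le_add1)
  define S where "S q d b = {\<omega> \<in> space M. (1 + \<kappa> d) * Z (par q d b) \<omega> + v q d < Z (par q d b + 2 ^ (q - d)) \<omega>}" for q d b
  define G where "G q b = {\<omega> \<in> space M. (1 + \<epsilon>) * K (grid q b) (grid q b) * ln (real q) < Z (grid q b) \<omega>}" for q b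
  have S_meas: "S q d b \<in> sets M" for q d b
  proof -
    have [measurable]: "Z (par q d b) \<in> borel_measurable M" "Z (par q d b + 2 ^ (q - d)) \<in> borel_measurable M"
      using par1[of q d b] by (auto intro!: Zm)
    show ?thesis unfolding S_def by measurable
  qed
  have G_meas: "G q b \<in> sets M" for q b
  proof -
    have [measurable]: "Z (grid q b) \<in> borel_measurable M" by (rule Zm[OF grid1])
    show ?thesis unfolding G_def by measurable
  qed
  have S_prob: "prob (S q d b) \<le> 1 / real q ^ (8 + d)" if q: "1 \<le> q" and d: "d \<le> q" for q d b
  proof -
    define \<Delta> :: nat where "\<Delta> = 2 ^ (q - d)"
    define j where "j = par q d b"
    \<comment> \<open>Chosen so that the minor term, at most
      \<open>\<theta> * 2 * (C * real j * real \<Delta>)\<close>, equals half of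
      \<open>\<kappa> d * c * real j\<close>; the other half covers the growth of the
      diagonal.\<close>
    define \<theta> where "\<theta> = \<kappa> d * c / (4 * C * real \<Delta>)"
    have \<Delta>: "1 \<le> \<Delta>" "0 < real \<Delta>" by (auto simp: \<Delta>_def Suc_le_eq)
    have j: "1 \<le> j" "2 ^ (q + m) \<le> j" using par1 by (auto simp: j_def)
    have "\<Delta> \<le> 2 ^ (q + m)" unfolding \<Delta>_def by (rule power_increasing) auto
    then have \<Delta>j: "\<Delta> \<le> j" using j by simp
    have \<theta>: "0 < \<theta>" using \<kappa> c C \<Delta> by (simp add: \<theta>_def)
    have q_split: "(2::real) ^ q = real \<Delta> * 2 ^ d"
      unfolding \<Delta>_def using d by (simp flip: power_add)
    have jr: "real \<Delta> * 2 ^ d * 2 ^ m \<le> real j"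
    proof -
      have "real (2 ^ (q + m)) \<le> real j" using j by (simp only: of_nat_le_iff)
      then show ?thesis by (simp add: power_add q_split)
    qed
    have h: "(1::real) \<le> (3/4) ^ d * 2 ^ d" by (simp flip: power_mult_distrib)
    have "2 * C * real \<Delta> * 1 \<le> (\<epsilon> * c * 2 ^ m) * real \<Delta> * ((3/4) ^ d * 2 ^ d)"
      by (rule mult_mono[OF mult_right_mono[OF m1] h]) (use \<epsilon> c in auto)
    also have "\<dots> = \<kappa> d * c * (real \<Delta> * 2 ^ d * 2 ^ m)" by (simp add: \<kappa>_def)
    also have "\<dots> \<le> \<kappa> d * c * real j" using jr \<kappa>(1)[of d] c by (intro mult_left_mono) auto
    finally have C\<Delta>: "2 * C * real \<Delta> \<le> \<kappa> d * c * real j" by simp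
    have "prob {\<omega> \<in> space M. (1 + \<kappa> d) * Z j \<omega> + v q d < Z (j + \<Delta>) \<omega>} \<le> exp (- \<theta> * v q d)"
    proof (rule permanental_increment_tail[OF perm a])
      show "0 \<le> K (j + \<Delta>) (j + \<Delta>) * K j j - K (j + \<Delta>) j * K j (j + \<Delta>)"
        using j \<Delta> \<Delta>j by (intro disc0) auto
      have "\<theta> * (1 + \<kappa> d) * (K (j + \<Delta>) (j + \<Delta>) * K j j - K (j + \<Delta>) j * K j (j + \<Delta>)) \<le>
          \<theta> * 2 * (C * real j * real \<Delta>)"
      proof (rule mult_mono)
        show "\<theta> * (1 + \<kappa> d) \<le> \<theta> * 2" using \<theta> \<kappa>(2)[of d] by simp
        show "K (j + \<Delta>) (j + \<Delta>) * K j j - K (j + \<Delta>) j * K j (j + \<Delta>) \<le> C * real j * real \<Delta>"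
          using j \<Delta> \<Delta>j by (intro disc) auto
        show "0 \<le> K (j + \<Delta>) (j + \<Delta>) * K j j - K (j + \<Delta>) j * K j (j + \<Delta>)"
          using j \<Delta> \<Delta>j by (intro disc0) auto
      qed (use \<theta> in auto)
      also have "\<dots> = \<kappa> d * c * real j / 2" using C \<Delta> by (simp add: \<theta>_def)
      also have "\<dots> \<le> \<kappa> d * (c * real j) - C * real \<Delta>"
      proof -
        have "\<kappa> d * (c * real j) = \<kappa> d * c * real j" by simp
        with C\<Delta> show ?thesis by linarith
      qed
      also have "\<dots> \<le> \<kappa> d * K j j - C * real \<Delta>"
        using lower[OF j(1)] \<kappa>(1)[of d] by (intro diff_right_mono mult_left_mono) auto
      also have "\<dots> \<le> K j j * (1 + \<kappa> d) - K (j + \<Delta>) (j + \<Delta>)"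
        using incr[OF j(1) \<Delta>(1) \<Delta>j] by (simp add: algebra_simps)
      finally show "\<theta> * (1 + \<kappa> d) * (K (j + \<Delta>) (j + \<Delta>) * K j j - K (j + \<Delta>) j * K j (j + \<Delta>)) \<le>
          K j j * (1 + \<kappa> d) - K (j + \<Delta>) (j + \<Delta>)" .
    qed (use j \<Delta> \<theta> \<kappa>(1)[of d] in \<open>auto intro!: Kpos\<close>)
    also have "exp (- \<theta> * v q d) \<le> exp (- (real (8 + d) * ln (real q)))"
    proof -
      \<comment> \<open>The exponent carries \<open>\<kappa> d\<close> twice, once through
        \<open>\<theta>\<close> and once through \<open>v\<close>, and the ratio
        \<open>2 ^ d\<close> of block to step once: \<open>2 * (3/4)\<^sup>2 = 9/8\<close>.
        Bernoulli's inequality makes this linear in \<open>d\<close>.\<close>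
      have "real (8 + d) \<le> 8 * (1 + 1/8) ^ d"
        using Bernoulli_inequality[of "1/8::real" d] by simp
      also have "\<dots> \<le> (\<epsilon>\<^sup>2 * c * 2 ^ m / (4 * C)) * (1 + 1/8) ^ d"
        using m2 C by (intro mult_right_mono) (auto simp: field_simps)
      also have "\<dots> = \<theta> * (\<kappa> d * 2 ^ (q + m))"
      proof -
        have "(9/8::real) ^ d = (3/4) ^ d * (3/4) ^ d * 2 ^ d"
          by (simp flip: power_mult_distrib)
        then show ?thesis
          using C \<Delta> by (simp add: \<theta>_def \<kappa>_def power_add q_split power2_eq_square)
      qed
      finally have "real (8 + d) * ln (real q) \<le> \<theta> * (\<kappa> d * 2 ^ (q + m)) * ln (real q)"
        using q by (intro mult_right_mono) auto
      then show ?thesis by (simp add: v_def mult.assoc)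
    qed
    also have "exp (- (real (8 + d) * ln (real q))) = 1 / real q ^ (8 + d)"
      using q by (simp only: exp_minus exp_of_nat_mult exp_ln of_nat_0_less_iff inverse_eq_divide)
    finally show ?thesis by (simp only: S_def j_def \<Delta>_def)
  qed
  define \<gamma> where "\<gamma> = (1 + \<epsilon>) / (1 + \<epsilon> / 2)"
  define C1 where "C1 = (1 - 1 / (1 + \<epsilon> / 2)) powr (- a)"
  have \<gamma>: "1 < \<gamma>" using \<epsilon> by (simp add: \<gamma>_def)
  have G_prob: "prob (G q b) \<le> C1 * real q powr (- \<gamma>)" if q: "1 \<le> q" for q b
  proof -
    define g where "g = grid q b"
    have Kg: "0 < K g g" using grid1 by (simp add: g_def Kpos)
    define \<theta> where "\<theta> = 1 / ((1 + \<epsilon> / 2) * K g g)"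
    have "prob (G q b) \<le> exp (- \<theta> * ((1 + \<epsilon>) * K g g * ln (real q))) * (1 - K g g * \<theta>) powr (- a)"
      unfolding G_def g_def[symmetric]
      by (rule permanental_tail[OF perm a _ Kg]) (use Kg \<epsilon> grid1 in \<open>auto simp: \<theta>_def g_def\<close>)
    also have "K g g * \<theta> = 1 / (1 + \<epsilon> / 2)" using Kg by (simp add: \<theta>_def)
    also have "- \<theta> * ((1 + \<epsilon>) * K g g * ln (real q)) = - \<gamma> * ln (real q)"
      using Kg by (simp add: \<theta>_def \<gamma>_def)
    also have "exp (- \<gamma> * ln (real q)) = real q powr (- \<gamma>)" using q by (simp add: powr_def)
    finally show ?thesis by (simp add: C1_def mult.commute)
  qed
  define E where "E q = (\<Union>b<2 ^ m. G q b) \<union> (\<Union>d\<in>{1..q}. \<Union>b<2 ^ (m + d - 1). S q d b)" for q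
  have E_meas: "E q \<in> sets M" for q
    unfolding E_def using S_meas G_meas by (intro sets.Un sets.finite_UN) auto
  have "summable (\<lambda>q. prob (E q))"
  proof (rule summable_comparison_test_ev)
    show "summable (\<lambda>q. 2 ^ m * (C1 * real q powr (- \<gamma>)) + 2 ^ m * real q powr (- 2))"
      using \<gamma> by (intro summable_add summable_mult) (auto simp: summable_real_powr_iff)
    show "eventually (\<lambda>q. norm (prob (E q)) \<le> 2 ^ m * (C1 * real q powr (- \<gamma>)) + 2 ^ m * real q powr (- 2)) sequentially"
      using eventually_ge_at_top[of 2]
    proof eventually_elim
      case (elim q)
      have "prob (\<Union>b<2 ^ m. G q b) \<le> (\<Sum>b<(2::nat) ^ m. prob (G q b))"
        by (rule finite_measure_subadditive_finite) (use G_meas in auto)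
      also have "\<dots> \<le> (\<Sum>b<(2::nat) ^ m. C1 * real q powr (- \<gamma>))"
        using elim by (intro sum_mono G_prob) simp
      finally have 1: "prob (\<Union>b<2 ^ m. G q b) \<le> 2 ^ m * (C1 * real q powr (- \<gamma>))" by simp
      have "prob (\<Union>d\<in>{1..q}. \<Union>b<2 ^ (m + d - 1). S q d b) \<le> (\<Sum>d\<in>{1..q}. prob (\<Union>b<2 ^ (m + d - 1). S q d b))"
        by (rule finite_measure_subadditive_finite) (use S_meas in auto)
      also have "\<dots> \<le> (\<Sum>d\<in>{1..q}. 2 ^ m / real q ^ 3)"
      proof (rule sum_mono)
        fix d assume d: "d \<in> {1..q}"
        have "prob (\<Union>b<2 ^ (m + d - 1). S q d b) \<le> (\<Sum>b<(2::nat) ^ (m + d - 1). prob (S q d b))"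
          by (rule finite_measure_subadditive_finite) (use S_meas in auto)
        also have "\<dots> \<le> (\<Sum>b<(2::nat) ^ (m + d - 1). 1 / real q ^ (8 + d))"
          using elim d by (intro sum_mono S_prob) auto
        also have "\<dots> = 2 ^ (m + d - 1) / real q ^ (8 + d)" by simp
        \<comment> \<open>From \<open>q \<ge> 2\<close>, the number of points is at most
          \<open>2 ^ m * q ^ d\<close>. The summand \<open>d\<close> of the exponent
          \<open>8 + d\<close> cancels it, leaving a bound that can be summed over the
          \<open>q\<close> levels and then over \<open>q\<close>.\<close>
        also have "\<dots> \<le> 2 ^ m * real q ^ d / real q ^ (8 + d)"
        proof (intro divide_right_mono)
          have "(2::real) ^ (m + d - 1) \<le> 2 ^ (m + d)" by (intro power_increasing) auto
          also have "\<dots> \<le> 2 ^ m * real q ^ d"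
            unfolding power_add using elim by (intro mult_left_mono power_mono) auto
          finally show "(2::real) ^ (m + d - 1) \<le> 2 ^ m * real q ^ d" .
        qed simp
        also have "\<dots> = 2 ^ m / real q ^ 8" using elim by (simp add: power_add)
        also have "\<dots> \<le> 2 ^ m / real q ^ 3"
          using elim by (intro divide_left_mono power_increasing) auto
        finally show "prob (\<Union>b<2 ^ (m + d - 1). S q d b) \<le> 2 ^ m / real q ^ 3" .
      qed
      also have "\<dots> = 2 ^ m * real q powr (- 2)"
        using elim by (simp add: powr_minus powr_realpow[of _ 2, simplified] power2_eq_square power3_eq_cube divide_simps)
      finally have 2: "prob (\<Union>d\<in>{1..q}. \<Union>b<2 ^ (m + d - 1). S q d b) \<le> 2 ^ m * real q powr (- 2)" .
      have "prob (E q) \<le> prob (\<Union>b<2 ^ m. G q b) + prob (\<Union>d\<in>{1..q}. \<Union>b<2 ^ (m + d - 1). S q d b)"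
        unfolding E_def using S_meas G_meas by (intro measure_Un_le sets.finite_UN) auto
      with 1 2 show ?case by simp
    qed
  qed
  then have "AE \<omega> in M. eventually (\<lambda>q. \<omega> \<in> space M - E q) sequentially"
    using E_meas by (intro borel_cantelli_AE1) (auto simp: emeasure_eq_measure)
  then show ?thesis
  proof eventually_elim
    case (elim \<omega>)
    have "eventually (\<lambda>j. K j j / real j < L + \<epsilon>) sequentially"
      using \<epsilon> by (intro order_tendstoD(2)[OF lim]) auto
    then obtain j0 where j0: "\<And>j. j0 \<le> j \<Longrightarrow> K j j / real j < L + \<epsilon>" by (auto simp: eventually_sequentially)
    \<comment> \<open>From \<open>2 ^ q \<le> j\<close> one only gets
      \<open>ln q + ln (ln 2)\<close> below \<open>ln (ln j)\<close>, and \<open>ln (ln 2)\<close>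
      is negative. For large \<open>q\<close> a factor \<open>1 + \<epsilon>\<close> absorbs this
      constant.\<close>
    have "eventually (\<lambda>q::nat. ln (real q) \<ge> - ((1 + \<epsilon>) / \<epsilon>) * ln (ln 2)) sequentially"
      by (rule filterlim_at_top[THEN iffD1, rule_format, OF filterlim_compose[OF ln_at_top filterlim_real_sequentially]])
    then obtain q1 where q1: "\<And>q. q1 \<le> q \<Longrightarrow> - ((1 + \<epsilon>) / \<epsilon>) * ln (ln 2) \<le> ln (real q)"
      by (auto simp: eventually_sequentially)
    from elim obtain q2 where q2: "\<And>q. q2 \<le> q \<Longrightarrow> \<omega> \<in> space M - E q" by (auto simp: eventually_sequentially)
    define q0 where "q0 = Max {j0, q1, q2, 1}"
    have q0: "j0 \<le> q0" "q1 \<le> q0" "q2 \<le> q0" "1 \<le> q0" by (auto simp: q0_def)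
    have \<omega>: "\<omega> \<in> space M" using q2[of q2] by auto
    show ?case
      unfolding eventually_sequentially
    proof (intro exI[of _ "2 ^ (q0 + m)"] allI impI)
      fix j :: nat assume j: "2 ^ (q0 + m) \<le> j"
      have "1 \<le> j" using j by (meson one_le_numeral one_le_power order_trans)
      then obtain n where n: "2 ^ n \<le> j" "j < 2 ^ (n + 1)" using ex_power_ivl1[of 2 j] by auto
      have "(2::nat) ^ (q0 + m) < 2 ^ (n + 1)" using j n by simp
      then have "q0 + m < n + 1" by (rule power_less_imp_less_exp[rotated]) simp
      then have "q0 + m \<le> n" by simp
      define q where "q = n - m"
      have qn: "n = q + m" "q0 \<le> q" using \<open>q0 + m \<le> n\<close> by (auto simp: q_def)
      have q: "1 \<le> q" "q1 \<le> q" "q2 \<le> q" "j0 \<le> q" using qn q0 by auto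
      define J where "J d = (j div 2 ^ (q - d)) * 2 ^ (q - d)" for d
      have div_bounds: "2 ^ (m + d) \<le> j div 2 ^ (q - d)" "j div 2 ^ (q - d) < 2 ^ (m + d + 1)" if d: "d \<le> q" for d
      proof -
        have "(2::nat) ^ (m + d) * 2 ^ (q - d) = 2 ^ (q + m)" using d by (simp flip: power_add)
        then have "2 ^ (m + d) * 2 ^ (q - d) \<le> j" using n qn by simp
        then show "2 ^ (m + d) \<le> j div 2 ^ (q - d)" by (simp add: less_eq_div_iff_mult_less_eq)
        have "(2::nat) ^ (m + d + 1) * 2 ^ (q - d) = 2 ^ (q + m + 1)" using d by (simp flip: power_add)
        then have "j < 2 ^ (m + d + 1) * 2 ^ (q - d)" using n qn by simp
        then show "j div 2 ^ (q - d) < 2 ^ (m + d + 1)" by (simp add: less_mult_imp_div_less)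
      qed
      have J1: "1 \<le> J d" if "d \<le> q" for d
        using div_bounds(1)[OF that] by (simp add: J_def Suc_le_eq) (metis less_le_trans zero_less_numeral zero_less_power)
      have J_le: "J d \<le> j" for d by (simp add: J_def)
      have v0: "0 \<le> v q d" for d using q \<kappa>(1)[of d] by (auto simp: v_def)
      have chain: "Z (J d) \<omega> \<le> (\<Prod>e=1..d. 1 + \<kappa> e) * (Z (J 0) \<omega> + (\<Sum>e=1..d. v q e))" if "d \<le> q" for d
        using that
      proof (induction d)
        case (Suc d)
        define x where "x = j div 2 ^ (q - Suc d)"
        have qd: "q - d = Suc (q - Suc d)" using Suc.prems by simp
        have x2: "j div 2 ^ (q - d) = x div 2"
          unfolding qd x_def power_Suc2 by (rule div_mult2_eq)
        define B :: nat where "B = 2 ^ (q - Suc d)"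
        have Jd_eq: "J d = x div 2 * (2 * B)"
          unfolding J_def x2 unfolding qd B_def by simp
        have JS_eq: "J (Suc d) = x * B" by (simp add: J_def x_def B_def)
        \<comment> \<open>The next binary digit of \<open>j\<close> is the parity of
          \<open>x\<close>: if even, the rounded point does not move; if odd, it moves by exactly
          one step of the new level, which the event \<open>S\<close> controls.\<close>
        have step: "Z (J (Suc d)) \<omega> \<le> (1 + \<kappa> (Suc d)) * Z (J d) \<omega> + v q (Suc d)"
        proof (cases "even x")
          case True
          then have "J (Suc d) = J d"
            unfolding JS_eq Jd_eq by (simp add: mult.assoc[symmetric])
          moreover have "0 \<le> \<kappa> (Suc d) * Z (J d) \<omega>"
            using \<kappa>(1)[of "Suc d"] Z0[OF J1 \<omega>] Suc.prems by simp
          ultimately show ?thesis using v0[of "Suc d"] by (simp add: algebra_simps)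
        next
          case False
          define b where "b = x div 2 - 2 ^ (m + d)"
          have xb: "x div 2 = 2 ^ (m + d) + b" "b < 2 ^ (m + d)"
            using div_bounds[of d] Suc.prems by (auto simp: b_def x2)
          have "(2::nat) ^ (m + d) * 2 ^ (q - d) = 2 ^ (q + m)" using Suc.prems by (simp flip: power_add)
          then have Jd: "J d = par q (Suc d) b"
            unfolding J_def x2 xb par_def using Suc.prems by (simp add: add_mult_distrib Suc_diff_Suc)
          define y where "y = x div 2"
          have "x = 2 * y + 1" using False unfolding y_def by presburger
          then have "J (Suc d) = J d + 2 ^ (q - Suc d)"
            unfolding JS_eq Jd_eq y_def[symmetric] by (simp add: B_def)
          then have JS: "J (Suc d) = par q (Suc d) b + 2 ^ (q - Suc d)" using Jd by simp
          have "\<omega> \<notin> S q (Suc d) b"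
            using q2[OF q(3)] xb(2) Suc.prems by (auto simp: E_def)
          then show ?thesis
            using \<omega> by (simp add: S_def JS Jd not_less)
        qed
        define P where "P = (\<Prod>e=1..d. 1 + \<kappa> e)"
        define W where "W = Z (J 0) \<omega> + (\<Sum>e=1..d. v q e)"
        have P1: "1 \<le> P" unfolding P_def using \<kappa>(1) by (intro prod_ge_1) (auto intro: less_imp_le)
        have IH: "Z (J d) \<omega> \<le> P * W" using Suc by (simp add: P_def W_def)
        have "(1 + \<kappa> (Suc d)) * Z (J d) \<omega> + v q (Suc d) \<le> (1 + \<kappa> (Suc d)) * (P * W) + (1 + \<kappa> (Suc d)) * P * v q (Suc d)"
        proof (intro add_mono mult_left_mono IH)
          have "1 * 1 \<le> (1 + \<kappa> (Suc d)) * P" using \<kappa>(1)[of "Suc d"] P1 by (intro mult_mono) auto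
          then show "v q (Suc d) \<le> (1 + \<kappa> (Suc d)) * P * v q (Suc d)"
            using mult_right_mono[OF _ v0[of "Suc d"], of 1] by simp
        qed (use \<kappa>(1)[of "Suc d"] in auto)
        with step show ?case by (simp add: P_def W_def algebra_simps)
      qed simp
      have "Z j \<omega> = Z (J q) \<omega>" by (simp add: J_def)
      also have "\<dots> \<le> (\<Prod>e=1..q. 1 + \<kappa> e) * (Z (J 0) \<omega> + (\<Sum>e=1..q. v q e))" by (rule chain) simp
      also have "\<dots> \<le> exp (3 * \<epsilon>) * ((1 + \<epsilon>) * ((L + \<epsilon>) * real j) * ln (real q) + 3 * \<epsilon> * real j * ln (real q))"
      proof (intro mult_mono add_mono)
        have "(\<Prod>e=1..q. 1 + \<kappa> e) \<le> (\<Prod>e=1..q. exp (\<kappa> e))"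
        proof (intro prod_mono conjI)
          fix e
          show "0 \<le> 1 + \<kappa> e" using \<kappa>(1)[of e] by simp
          show "1 + \<kappa> e \<le> exp (\<kappa> e)" by (rule exp_ge_add_one_self)
        qed
        also have "\<dots> = exp (\<Sum>e=1..q. \<kappa> e)" by (simp add: exp_sum)
        also have "(\<Sum>e=1..q. \<kappa> e) \<le> 3 * \<epsilon>"
          using mult_left_mono[OF sum_three_quarters[of q], of \<epsilon>] \<epsilon> by (simp add: \<kappa>_def sum_distrib_left mult.commute)
        finally show "(\<Prod>e=1..q. 1 + \<kappa> e) \<le> exp (3 * \<epsilon>)" by simp
        define b where "b = j div 2 ^ q - 2 ^ m"
        have jb: "j div 2 ^ q = 2 ^ m + b" "b < 2 ^ m" using div_bounds[of 0] by (auto simp: b_def)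
        have Jg: "J 0 = grid q b" by (simp add: J_def grid_def jb power_add algebra_simps)
        have "\<omega> \<notin> G q b" using q2[OF q(3)] jb(2) by (auto simp: E_def)
        then have "Z (J 0) \<omega> \<le> (1 + \<epsilon>) * K (J 0) (J 0) * ln (real q)" using \<omega> by (simp add: G_def Jg not_less)
        also have "\<dots> \<le> (1 + \<epsilon>) * ((L + \<epsilon>) * real j) * ln (real q)"
        proof (intro mult_right_mono mult_left_mono)
          have "q < 2 ^ q" by simp
          also have "(2::nat) ^ q \<le> J 0" unfolding Jg grid_def by (simp add: power_add trans_le_add1)
          finally have "j0 \<le> J 0" using q by simp
          then have "K (J 0) (J 0) \<le> (L + \<epsilon>) * real (J 0)"
            using j0[of "J 0"] J1[of 0] by (simp add: pos_divide_less_eq less_imp_le)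
          also have "\<dots> \<le> (L + \<epsilon>) * real j" using J_le L \<epsilon> by (intro mult_left_mono) auto
          finally show "K (J 0) (J 0) \<le> (L + \<epsilon>) * real j" .
        qed (use \<epsilon> q in auto)
        finally show "Z (J 0) \<omega> \<le> (1 + \<epsilon>) * ((L + \<epsilon>) * real j) * ln (real q)" .
        have "(\<Sum>e=1..q. v q e) = (\<Sum>e=1..q. (3/4) ^ e) * (\<epsilon> * 2 ^ (q + m) * ln (real q))"
          by (simp add: v_def \<kappa>_def sum_distrib_left sum_distrib_right mult_ac)
        also have "\<dots> \<le> 3 * (\<epsilon> * 2 ^ (q + m) * ln (real q))"
          using sum_three_quarters[of q] \<epsilon> q by (intro mult_right_mono) auto
        also have "\<dots> \<le> 3 * (\<epsilon> * real j * ln (real q))"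
        proof (intro mult_left_mono mult_right_mono)
          have "real (2 ^ (q + m)) \<le> real j" using n qn by (simp only: of_nat_le_iff)
          then show "2 ^ (q + m) \<le> real j" by simp
        qed (use \<epsilon> q in auto)
        finally show "(\<Sum>e=1..q. v q e) \<le> 3 * \<epsilon> * real j * ln (real q)" by (simp add: mult.assoc)
      qed (use Z0[OF J1[of 0] \<omega>] v0 in \<open>auto intro!: add_nonneg_nonneg sum_nonneg\<close>)
      also have "\<dots> = exp (3 * \<epsilon>) * ((1 + \<epsilon>) * (L + \<epsilon>) + 3 * \<epsilon>) * real j * ln (real q)"
        by (simp add: algebra_simps)
      also have "\<dots> \<le> exp (3 * \<epsilon>) * ((1 + \<epsilon>) * (L + \<epsilon>) + 3 * \<epsilon>) * real j * ((1 + \<epsilon>) * ln (ln (real j)))"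
      proof (rule mult_left_mono)
        have "real (2 ^ q) \<le> real j"
          using n qn by (simp only: of_nat_le_iff) (metis le_add1 one_le_numeral order_trans power_increasing)
        then have "ln (2 ^ q) \<le> ln (real j)" using \<open>1 \<le> j\<close> by (subst ln_le_cancel_iff) auto
        then have "real q * ln 2 \<le> ln (real j)" by (simp add: ln_realpow)
        then have "ln (real q * ln 2) \<le> ln (ln (real j))"
          using q by (subst ln_le_cancel_iff) (auto intro: less_le_trans[rotated] mult_pos_pos)
        then have *: "ln (real q) + ln (ln 2) \<le> ln (ln (real j))" using q by (simp add: ln_mult)
        have "ln (real q) \<le> (1 + \<epsilon>) * (ln (real q) + ln (ln 2))"
        proof -
          have "\<epsilon> * (- ((1 + \<epsilon>) / \<epsilon>) * ln (ln 2)) = - ((1 + \<epsilon>) * ln (ln 2))" using \<epsilon> by simp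
          then have "- ((1 + \<epsilon>) * ln (ln 2)) \<le> \<epsilon> * ln (real q)"
            using mult_left_mono[OF q1[OF q(2)], of \<epsilon>] \<epsilon> by simp
          then show ?thesis by (simp add: algebra_simps)
        qed
        also have "\<dots> \<le> (1 + \<epsilon>) * ln (ln (real j))" using * \<epsilon> by (intro mult_left_mono) auto
        finally show "ln (real q) \<le> (1 + \<epsilon>) * ln (ln (real j))" .
      qed (use \<epsilon> L in auto)
      finally show "Z j \<omega> \<le> exp (3 * \<epsilon>) * ((1 + \<epsilon>) * (L + \<epsilon>) + 3 * \<epsilon>) * (1 + \<epsilon>) * (real j * ln (ln (real j)))"
        by (simp add: mult_ac)
    qed
  qed
qed

section \<open>The covariance of the Gaussian sequence\<close>

context autoregression
begin

text \<open>The recursion is solved pointwise, without probability. Terms at times at most 0 vanish,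
  so \<open>p\<close> may be replaced by \<open>pp\<close> up to lag \<open>n\<close>, and the
  renewal equation of \<open>\<phi>\<close> collects the coefficient of each
  \<open>g i\<close>.\<close>

lemma autoregressive_moving_average:
  assumes \<xi>: "autoregressive k p N g \<xi>" and \<omega>: "\<omega> \<in> space N"
  shows "\<xi> (int n) \<omega> = (\<Sum>i=1..n. \<phi> (n - i) * g i \<omega>)"
proof (induction n rule: less_induct)
  case (less n)
  have zero: "\<xi> i \<omega> = 0" if "i \<le> 0" for i using \<xi> \<omega> that by (auto simp: autoregressive_def)
  consider "n = 0" | "n = 1" | "2 \<le> n" by linarith
  then show ?case
  proof cases
    case 1
    then show ?thesis using zero[of 0] by simp
  next
    case 2
    then show ?thesis using \<xi> \<omega> by (auto simp: autoregressive_def)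
  next
    case 3
    have "(\<Sum>l=1..k. p l * \<xi> (int n - int l) \<omega>) = (\<Sum>l\<in>{1..k} \<inter> {1..n}. p l * \<xi> (int n - int l) \<omega>)"
      by (intro sum.mono_neutral_right) (auto simp: zero)
    also have "\<dots> = (\<Sum>l=1..n. pp l * \<xi> (int n - int l) \<omega>)"
      by (intro sum.mono_neutral_cong_left) (auto simp: pp_def)
    also have "\<dots> = (\<Sum>l=1..n. \<Sum>i=1..n - l. pp l * \<phi> (n - l - i) * g i \<omega>)"
    proof (intro sum.cong refl)
      fix l assume l: "l \<in> {1..n}"
      have "int n - int l = int (n - l)" using l by simp
      moreover have "\<xi> (int (n - l)) \<omega> = (\<Sum>i=1..n - l. \<phi> (n - l - i) * g i \<omega>)"
        by (rule less.IH) (use l in auto)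
      ultimately show "pp l * \<xi> (int n - int l) \<omega> = (\<Sum>i=1..n - l. pp l * \<phi> (n - l - i) * g i \<omega>)"
        by (simp only: sum_distrib_left mult.assoc)
    qed
    also have "\<dots> = (\<Sum>i=1..n. \<Sum>l=1..n - i. pp l * \<phi> (n - l - i) * g i \<omega>)"
      by (simp add: sum.Sigma)
        (rule sum.reindex_bij_witness[where i="\<lambda>(a, b). (b, a)" and j="\<lambda>(a, b). (b, a)"], auto)
    also have "\<dots> = (\<Sum>i=1..n. (if i = n then 0 else \<phi> (n - i) * g i \<omega>))"
    proof (intro sum.cong refl)
      fix i assume i: "i \<in> {1..n}"
      show "(\<Sum>l=1..n - i. pp l * \<phi> (n - l - i) * g i \<omega>) = (if i = n then 0 else \<phi> (n - i) * g i \<omega>)"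
      proof (cases "i = n")
        case False
        then have "\<phi> (n - i) = (\<Sum>l=1..n - i. pp l * \<phi> (n - i - l))"
          using i by (intro \<phi>_rec) auto
        also have "\<dots> = (\<Sum>l=1..n - i. pp l * \<phi> (n - l - i))"
          by (simp add: add.commute)
        finally show ?thesis using False by (simp only: sum_distrib_right if_False)
      qed simp
    qed
    also have "\<dots> = (\<Sum>i\<in>{1..n} - {n}. \<phi> (n - i) * g i \<omega>)"
      by (intro sum.mono_neutral_cong_right) auto
    finally have "\<xi> (int n) \<omega> = (\<Sum>i\<in>{1..n} - {n}. \<phi> (n - i) * g i \<omega>) + g n \<omega>"
      using \<xi> \<omega> 3 by (auto simp: autoregressive_def)
    also have "\<dots> = (\<Sum>i=1..n. \<phi> (n - i) * g i \<omega>)"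
      using 3 by (subst sum.remove[of "{1..n}" n]) auto
    finally show ?thesis .
  qed
qed

text \<open>The \<open>g i\<close> are centred and orthonormal, so only the diagonal of the double
  sum survives. This is the bridge by which \<open>V\<close> becomes \<open>green\<close>.\<close>

lemma covariance_autoregressive:
  assumes g: "iid_std_normal N g" and \<xi>: "autoregressive k p N g \<xi>"
  shows "covariance N (\<xi> (int m)) (\<xi> (int n)) = green m n"
proof -
  have N: "prob_space N" and ind: "prob_space.indep_vars N (\<lambda>_. borel) g {1..}"
    and dist: "\<And>i. 1 \<le> i \<Longrightarrow> distributed N lborel (g i) std_normal_density"
    using g by (auto simp: iid_std_normal_def)
  interpret prob_space N by fact
  have mean: "expectation (g i) = 0" if "1 \<le> i" for i
    using standard_normal_distributed_expectation[OF dist[OF that]] .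
  have meas [measurable]: "g i \<in> borel_measurable N" if "1 \<le> i" for i
    using distributed_measurable[OF dist[OF that]] by simp
  have int1: "integrable N (g i)" if "1 \<le> i" for i
    using distributed_integrable[OF dist[OF that], of "\<lambda>x. x"] integrable_std_normal_moment[of 1] by simp
  have int2: "integrable N (\<lambda>\<omega>. (g i \<omega>)\<^sup>2)" if "1 \<le> i" for i
    using distributed_integrable[OF dist[OF that], of "\<lambda>x. x\<^sup>2"] integrable_std_normal_moment[of 2] by simp
  have var: "expectation (\<lambda>\<omega>. (g i \<omega>)\<^sup>2) = 1" if "1 \<le> i" for i
    using distributed_integral[OF dist[OF that], of "\<lambda>x. x\<^sup>2"] integral_std_normal_moment_even[of 1] by simp
  have prod: "integrable N (\<lambda>\<omega>. g i \<omega> * g j \<omega>) \<and> expectation (\<lambda>\<omega>. g i \<omega> * g j \<omega>) = (if i = j then 1 else 0)"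
    if ij: "1 \<le> i" "1 \<le> j" for i j
  proof (cases "i = j")
    case True
    then show ?thesis using int2[OF ij(1)] var[OF ij(1)] by (simp add: power2_eq_square)
  next
    case False
    have "indep_vars (\<lambda>_. borel) g {i, j}"
      by (rule indep_vars_subset[OF ind]) (use ij in auto)
    then have "expectation (\<lambda>\<omega>. \<Prod>l\<in>{i, j}. g l \<omega>) = (\<Prod>l\<in>{i, j}. expectation (g l))"
      and "integrable N (\<lambda>\<omega>. \<Prod>l\<in>{i, j}. g l \<omega>)"
      using ij int1 by (auto intro!: indep_vars_lebesgue_integral indep_vars_integrable)
    then show ?thesis using False mean ij by simp
  qed
  define X where "X n \<omega> = (\<Sum>i=1..n. \<phi> (n - i) * g i \<omega>)" for n \<omega>
  have X: "\<xi> (int n) \<omega> = X n \<omega>" if "\<omega> \<in> space N" for n \<omega>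
    using autoregressive_moving_average[OF \<xi> that] by (simp add: X_def)
  have EX: "expectation (\<xi> (int n)) = 0" for n
  proof -
    have "expectation (\<xi> (int n)) = expectation (X n)" by (intro Bochner_Integration.integral_cong) (auto simp: X)
    also have "\<dots> = (\<Sum>i=1..n. \<phi> (n - i) * expectation (g i))"
      unfolding X_def by (subst Bochner_Integration.integral_sum) (auto intro!: integrable_mult_right int1)
    finally show ?thesis by (simp add: mean)
  qed
  have "covariance N (\<xi> (int m)) (\<xi> (int n)) = expectation (\<lambda>\<omega>. X m \<omega> * X n \<omega>)"
    unfolding covariance_def EX by (intro Bochner_Integration.integral_cong) (auto simp: X)
  also have "\<dots> = expectation (\<lambda>\<omega>. \<Sum>i=1..m. \<Sum>j=1..n. \<phi> (m - i) * \<phi> (n - j) * (g i \<omega> * g j \<omega>))"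
    by (simp add: X_def sum_product mult_ac)
  also have "\<dots> = (\<Sum>i=1..m. \<Sum>j=1..n. \<phi> (m - i) * \<phi> (n - j) * expectation (\<lambda>\<omega>. g i \<omega> * g j \<omega>))"
  proof -
    have int: "integrable N (\<lambda>\<omega>. \<phi> (m - i) * \<phi> (n - j) * (g i \<omega> * g j \<omega>))" if "i \<in> {1..m}" "j \<in> {1..n}" for i j
      using prod[of i j] that by (intro integrable_mult_right) auto
    show ?thesis
    proof (subst Bochner_Integration.integral_sum)
      show "integrable N (\<lambda>\<omega>. \<Sum>j=1..n. \<phi> (m - i) * \<phi> (n - j) * (g i \<omega> * g j \<omega>))" if "i \<in> {1..m}" for i
        using int that by (intro Bochner_Integration.integrable_sum) auto
      show "(\<Sum>i=1..m. expectation (\<lambda>\<omega>. \<Sum>j=1..n. \<phi> (m - i) * \<phi> (n - j) * (g i \<omega> * g j \<omega>))) =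
          (\<Sum>i=1..m. \<Sum>j=1..n. \<phi> (m - i) * \<phi> (n - j) * expectation (\<lambda>\<omega>. g i \<omega> * g j \<omega>))"
        using int by (intro sum.cong refl) (subst Bochner_Integration.integral_sum, auto)
    qed
  qed
  also have "\<dots> = (\<Sum>i=1..m. \<Sum>j=1..n. if i = j then \<phi> (m - i) * \<phi> (n - i) else 0)"
    using prod by (intro sum.cong refl) auto
  also have "\<dots> = (\<Sum>i=1..m. if i \<le> n then \<phi> (m - i) * \<phi> (n - i) else 0)"
    by (intro sum.cong refl) auto
  also have "\<dots> = green m n"
    unfolding green_def by (intro sum.mono_neutral_cong_right) auto
  finally show ?thesis .
qed

end

section \<open>Partial fractions and the constant in the subcritical case\<close>

lemma degree_eq_sum_order:
  fixes P :: "complex poly"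
  assumes P: "P \<noteq> 0"
  shows "degree P = (\<Sum>q | poly P q = 0. Polynomial.order q P)"
proof -
  have "degree P = degree (Polynomial.smult (lead_coeff P) (\<Prod>q | poly P q = 0. [:- q, 1:] ^ Polynomial.order q P))"
    by (simp only: complex_poly_decompose)
  also have "\<dots> = degree (\<Prod>q | poly P q = 0. [:- q, 1:] ^ Polynomial.order q P)"
    using P by simp
  also have "\<dots> = (\<Sum>q | poly P q = 0. degree ([:- q, 1:] ^ Polynomial.order q P))"
    by (rule degree_prod_eq_sum_degree) simp
  also have "\<dots> = (\<Sum>q | poly P q = 0. Polynomial.order q P)"
    by (simp add: degree_linear_power)
  finally show ?thesis .
qed

text \<open>\<open>T\<close> is the Taylor polynomial of \<open>X / Q\<close> at \<open>q\<close>,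
  built one coefficient at a time; \<open>poly Q q \<noteq> 0\<close> lets each new coefficient be
  solved for.\<close>

lemma taylor_quotient_exists:
  fixes X Q :: "complex poly"
  assumes Q: "poly Q q \<noteq> 0"
  shows "\<exists>T. [:- q, 1:] ^ d dvd X - T * Q \<and> (T = 0 \<or> degree T < d)"
proof (induction d)
  case 0
  show ?case by (rule exI[of _ 0]) simp
next
  case (Suc d)
  then obtain T where T: "[:- q, 1:] ^ d dvd X - T * Q" "T = 0 \<or> degree T < d" by blast
  from T(1) obtain S where S: "X - T * Q = [:- q, 1:] ^ d * S" by (auto elim: dvdE)
  define c where "c = poly S q / poly Q q"
  define T' where "T' = T + Polynomial.smult c ([:- q, 1:] ^ d)"
  have "poly (S - Polynomial.smult c Q) q = 0" using Q by (simp add: c_def)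
  then have "[:- q, 1:] dvd S - Polynomial.smult c Q" by (simp only: poly_eq_0_iff_dvd)
  then have "[:- q, 1:] ^ d * [:- q, 1:] dvd [:- q, 1:] ^ d * (S - Polynomial.smult c Q)"
    by (intro mult_dvd_mono) auto
  also have "[:- q, 1:] ^ d * (S - Polynomial.smult c Q) = X - T' * Q"
  proof -
    have "X - T' * Q = (X - T * Q) - Polynomial.smult c ([:- q, 1:] ^ d) * Q"
      by (simp add: T'_def algebra_simps)
    then show ?thesis unfolding S by (simp add: right_diff_distrib)
  qed
  finally have "[:- q, 1:] ^ Suc d dvd X - T' * Q" by (simp only: power_Suc2)
  moreover have "degree T' < Suc d"
  proof -
    have "degree T' \<le> max (degree T) (degree (Polynomial.smult c ([:- q, 1:] ^ d)))"
      unfolding T'_def by (rule degree_add_le_max)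
    also have "\<dots> \<le> d"
      using T(2) degree_smult_le[of c "[:- q, 1:] ^ d"] by (auto simp: degree_linear_power)
    finally show ?thesis by simp
  qed
  ultimately show ?case by blast
qed

text \<open>Dividing by \<open>P\<close> gives the usual expansion, with \<open>T q\<close> the
  numerator over the power of \<open>x - q\<close>. The difference of the two sides is divisible by
  every such power, so a non-zero difference would have degree at least that of \<open>P\<close>,
  whereas all terms have smaller degree.\<close>

lemma partial_fractions_complex:
  fixes P X :: "complex poly"
  assumes P: "P \<noteq> 0" and deg: "degree X < degree P"
  shows "\<exists>T Q. (\<forall>q\<in>{q. poly P q = 0}. P = [:- q, 1:] ^ Polynomial.order q P * Q q \<and> poly (Q q) q \<noteq> 0 \<and>
      [:- q, 1:] ^ Polynomial.order q P dvd X - T q * Q q) \<and> X = (\<Sum>q | poly P q = 0. T q * Q q) \<and>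
      (\<forall>q\<in>{q. poly P q = 0}. T q = 0 \<or> degree (T q) < Polynomial.order q P)"
proof -
  define R where "R = {q. poly P q = 0}"
  have R: "finite R" unfolding R_def using P by (rule poly_roots_finite)
  have "\<exists>T Q. P = [:- q, 1:] ^ Polynomial.order q P * Q \<and> poly Q q \<noteq> 0 \<and>
      [:- q, 1:] ^ Polynomial.order q P dvd X - T * Q \<and> (T = 0 \<or> degree T < Polynomial.order q P)" for q
  proof -
    obtain Q where Q: "P = [:- q, 1:] ^ Polynomial.order q P * Q" "\<not> [:- q, 1:] dvd Q"
      using order_decomp[OF P, of q] by blast
    have Qq: "poly Q q \<noteq> 0" using Q(2) by (simp add: poly_eq_0_iff_dvd)
    with Q(1) taylor_quotient_exists[OF Qq, of "Polynomial.order q P" X] show ?thesis by blast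
  qed
  then obtain T Q where TQ: "\<And>q. P = [:- q, 1:] ^ Polynomial.order q P * Q q"
      "\<And>q. poly (Q q) q \<noteq> 0" "\<And>q. [:- q, 1:] ^ Polynomial.order q P dvd X - T q * Q q"
      "\<And>q. T q = 0 \<or> degree (T q) < Polynomial.order q P"
    by metis
  define N where "N = X - (\<Sum>q\<in>R. T q * Q q)"
  have other: "[:- q, 1:] ^ Polynomial.order q P dvd Q r" if "q \<noteq> r" for q r
  proof -
    have "Polynomial.order q P = Polynomial.order q ([:- r, 1:] ^ Polynomial.order r P) + Polynomial.order q (Q r)"
      using TQ(1)[of r] P by (metis order_mult)
    also have "Polynomial.order q ([:- r, 1:] ^ Polynomial.order r P) = 0"
      using that by (intro order_0I) simp
    finally show ?thesis by (simp add: order_1)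
  qed
  have dvd: "[:- q, 1:] ^ Polynomial.order q P dvd N" if q: "q \<in> R" for q
  proof -
    have "N = (X - T q * Q q) - (\<Sum>r\<in>R - {q}. T r * Q r)"
      unfolding N_def using R q by (subst sum.remove[of R q]) auto
    moreover have "[:- q, 1:] ^ Polynomial.order q P dvd (\<Sum>r\<in>R - {q}. T r * Q r)"
      using other[of q] by (intro dvd_sum) (auto intro: dvd_mult)
    ultimately show ?thesis using TQ(3)[of q] by (simp only: dvd_diff)
  qed
  have degN: "degree N < degree P"
  proof -
    have "degree (T q * Q q) < degree P" for q
    proof (cases "T q = 0")
      case True
      then show ?thesis using deg by simp
    next
      case False
      have Q0: "Q q \<noteq> 0" using TQ(2)[of q] by auto
      have "degree P = degree ([:- q, 1:] ^ Polynomial.order q P * Q q)" using TQ(1)[of q] by simp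
      also have "\<dots> = Polynomial.order q P + degree (Q q)"
        using Q0 by (subst degree_mult_eq) (auto simp: degree_linear_power)
      finally show ?thesis using TQ(4)[of q] False Q0 by (simp add: degree_mult_eq)
    qed
    then have "degree (\<Sum>q\<in>R. T q * Q q) < degree P"
      using deg by (intro degree_sum_less) auto
    then show ?thesis unfolding N_def using deg by (intro degree_diff_less)
  qed
  have "N = 0"
  proof (rule ccontr)
    assume N: "N \<noteq> 0"
    have ord: "Polynomial.order q P \<le> Polynomial.order q N" if "q \<in> R" for q
      using dvd[OF that] N by (simp add: order_divides)
    have sub: "R \<subseteq> {q. poly N q = 0}"
    proof
      fix q assume q: "q \<in> R"
      then have "0 < Polynomial.order q P" using P by (simp add: R_def order_root)
      then have "0 < Polynomial.order q N" using ord[OF q] by simp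
      then show "q \<in> {q. poly N q = 0}" by (simp add: order_root)
    qed
    have "degree P = (\<Sum>q\<in>R. Polynomial.order q P)" unfolding R_def by (rule degree_eq_sum_order[OF P])
    also have "\<dots> \<le> (\<Sum>q\<in>R. Polynomial.order q N)" by (intro sum_mono ord)
    also have "\<dots> \<le> (\<Sum>q | poly N q = 0. Polynomial.order q N)"
      using sub poly_roots_finite[OF N] by (intro sum_mono2) auto
    also have "\<dots> = degree N" by (rule degree_eq_sum_order[OF N, symmetric])
    finally show False using degN by simp
  qed
  then have "X = (\<Sum>q | poly P q = 0. T q * Q q)" by (simp add: N_def R_def)
  with TQ show ?thesis by blast
qed

section \<open>Taylor coefficients at a root, and expansions of its negative powers\<close>

lemma pcompose_power_poly: "pcompose (p ^ n) r = pcompose p r ^ n" for p r :: "complex poly"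
  by (induction n) (simp_all add: pcompose_mult pcompose_1)

lemma pcompose_monom: "pcompose (Polynomial.monom c n) r = Polynomial.smult c (r ^ n)" for r :: "complex poly"
  by (simp add: monom_altdef pcompose_smult pcompose_power_poly pcompose_pCons)

lemma has_fps_expansion_poly_shift:
  fixes W :: "complex poly"
  shows "(\<lambda>z. poly W (q + z)) has_fps_expansion fps_of_poly (pcompose W [:q, 1:])"
proof -
  have "(\<lambda>z. poly (pcompose W [:q, 1:]) z) has_fps_expansion fps_of_poly (pcompose W [:q, 1:])"
    by (simp add: has_fps_expansion_def eval_fps_of_poly fps_conv_radius_fps_of_poly)
  then show ?thesis by (simp add: poly_pcompose)
qed

text \<open>Off \<open>q\<close> the function coincides with the quotient of \<open>X\<close> by
  \<open>Q\<close>, which is holomorphic at \<open>q\<close>. So the limit is a derivative of that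
  quotient, and its Taylor coefficients below order \<open>d\<close> are those of
  \<open>T\<close>.\<close>

lemma Lim_higher_deriv_root:
  fixes P X T Q :: "complex poly"
  assumes P: "P = [:- q, 1:] ^ d * Q" and Q: "poly Q q \<noteq> 0"
    and T: "[:- q, 1:] ^ d dvd X - T * Q" and i: "i < d"
  shows "Lim (at q) ((deriv ^^ i) (\<lambda>x. poly X x * (x - q) ^ d / poly P x)) =
    fact i * poly.coeff (pcompose T [:q, 1:]) i"
proof -
  define G where "G x = poly X x / poly Q x" for x
  define U where "U = {x. poly Q x \<noteq> 0}"
  have U: "open U" "q \<in> U"
    using Q by (auto simp: U_def intro!: open_Collect_neq continuous_intros)
  have G: "G holomorphic_on U"
    unfolding G_def U_def by (auto intro!: holomorphic_intros)
  \<comment> \<open>Equality is claimed away from \<open>q\<close> only, where the original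
    expression reads \<open>0 / 0 = 0\<close>; the limit ignores that point.\<close>
  have eq: "(deriv ^^ i) (\<lambda>x. poly X x * (x - q) ^ d / poly P x) x = (deriv ^^ i) G x" if "x \<in> U - {q}" for x
  proof (rule higher_deriv_cong_ev)
    have "open (U - {q})" using U by auto
    then show "eventually (\<lambda>x. poly X x * (x - q) ^ d / poly P x = G x) (nhds x)"
      unfolding eventually_nhds using that
      by (intro exI[of _ "U - {q}"]) (auto simp: P G_def U_def poly_power)
  qed simp
  have "((deriv ^^ i) G \<longlongrightarrow> (deriv ^^ i) G q) (at q)"
  proof -
    have "(deriv ^^ i) G holomorphic_on U" by (rule holomorphic_higher_deriv[OF G U(1)])
    then have "continuous_on U ((deriv ^^ i) G)" by (rule holomorphic_on_imp_continuous_on)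
    then have "isCont ((deriv ^^ i) G) q" using U by (simp add: continuous_on_eq_continuous_at)
    then show ?thesis by (simp add: isCont_def)
  qed
  moreover have "eventually (\<lambda>x. (deriv ^^ i) G x = (deriv ^^ i) (\<lambda>x. poly X x * (x - q) ^ d / poly P x) x) (at q)"
    unfolding eventually_at_topological using U eq by (intro exI[of _ U]) auto
  ultimately have "((deriv ^^ i) (\<lambda>x. poly X x * (x - q) ^ d / poly P x) \<longlongrightarrow> (deriv ^^ i) G q) (at q)"
    by (rule Lim_transform_eventually)
  then have lim: "Lim (at q) ((deriv ^^ i) (\<lambda>x. poly X x * (x - q) ^ d / poly P x)) = (deriv ^^ i) G q"
    by (intro tendsto_Lim) auto
  from T obtain S where S: "X - T * Q = [:- q, 1:] ^ d * S" by (auto elim: dvdE)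
  define FX where "FX W = fps_of_poly (pcompose W [:q, 1:])" for W :: "complex poly"
  have Q0: "fps_nth (FX Q) 0 \<noteq> 0"
    using Q by (simp add: FX_def poly_pcompose flip: poly_0_coeff_0)
  have "(\<lambda>z. poly X (q + z) / poly Q (q + z)) has_fps_expansion FX X / FX Q"
    unfolding FX_def by (intro has_fps_expansion_divide' has_fps_expansion_poly_shift) (use Q0 in \<open>simp add: FX_def\<close>)
  then have "(\<lambda>z. G (q + z)) has_fps_expansion FX X / FX Q" by (simp add: G_def)
  then have "fps_nth (FX X / FX Q) i = (deriv ^^ i) (\<lambda>z. G (q + z)) 0 / fact i"
    by (rule fps_nth_fps_expansion)
  moreover have "(deriv ^^ i) (\<lambda>z. G (q + z)) 0 = (deriv ^^ i) G q"
    using higher_deriv_shift_0[of i G q] by (simp add: o_def)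
  moreover have "FX X = FX T * FX Q + fps_X ^ d * FX S"
  proof -
    have "X = T * Q + [:- q, 1:] ^ d * S" using S by (simp add: algebra_simps)
    then have "pcompose X [:q, 1:] = pcompose T [:q, 1:] * pcompose Q [:q, 1:] + pcompose ([:- q, 1:] ^ d) [:q, 1:] * pcompose S [:q, 1:]"
      by (simp add: pcompose_add pcompose_mult)
    also have "pcompose ([:- q, 1:] ^ d) [:q, 1:] = [:0, 1:] ^ d"
      by (simp add: pcompose_power_poly pcompose_pCons)
    finally show ?thesis by (simp add: FX_def fps_of_poly_add fps_of_poly_mult fps_of_poly_power)
  qed
  then have "FX X / FX Q = FX T + fps_X ^ d * (FX S / FX Q)"
    using Q0 by (simp add: fps_divide_unit inverse_mult_eq_1' algebra_simps)
  then have "fps_nth (FX X / FX Q) i = poly.coeff (pcompose T [:q, 1:]) i"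
    using i by (simp add: FX_def fps_X_power_mult_nth)
  ultimately show ?thesis using lim by (simp add: field_simps)
qed

text \<open>Pulling \<open>- q\<close> out of \<open>x - q\<close> leaves a negative binomial series
  in \<open>x / q\<close>. This is the origin of the factor \<open>(- 1) ^ j / q ^ j\<close> in
  \<open>B_coeff\<close> and of the binomial coefficients in \<open>F_series\<close>.\<close>

lemma fps_inverse_linear_power:
  fixes q :: complex
  assumes q: "q \<noteq> 0" and j: "1 \<le> j"
  shows "inverse (fps_of_poly [:- q, 1:] ^ j) =
    Abs_fps (\<lambda>n. (- 1) ^ j / q ^ j * of_nat ((j - 1 + n) choose (j - 1)) / q ^ n)"
proof -
  define c where "c = 1 / q"
  have "fps_of_poly [:- q, 1:] = fps_const (- q) * (1 - fps_const c * fps_X)"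
    using q by (intro fps_ext) (auto simp: c_def coeff_pCons split: nat.split)
  then have "fps_of_poly [:- q, 1:] ^ j = fps_const ((- q) ^ j) * (1 - fps_const c * fps_X) ^ j"
    by (simp only: power_mult_distrib fps_const_power)
  then have "inverse (fps_of_poly [:- q, 1:] ^ j) = fps_const (inverse ((- q) ^ j)) * inverse ((1 - fps_const c * fps_X) ^ j)"
    by (simp only: fps_inverse_mult fps_const_inverse)
  also have "inverse ((1 - fps_const c * fps_X) ^ j) = Abs_fps (\<lambda>n. of_nat ((j + n - 1) choose n) * c ^ n)"
    using j by (intro one_minus_const_fps_X_neg_power') simp
  finally show ?thesis
  proof (simp only:, intro fps_ext)
    fix n
    have "(j + n - 1) choose n = (j - 1 + n) choose (j - 1)"
      using j binomial_symmetric[of n "j + n - 1"] by simp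
    moreover have "inverse ((- q) ^ j) = (- 1) ^ j / q ^ j"
      by (simp add: uminus_power_if inverse_eq_divide)
    ultimately show "fps_nth (fps_const (inverse ((- q) ^ j)) * Abs_fps (\<lambda>n. of_nat ((j + n - 1) choose n) * c ^ n)) n =
        fps_nth (Abs_fps (\<lambda>n. (- 1) ^ j / q ^ j * of_nat ((j - 1 + n) choose (j - 1)) / q ^ n)) n"
      by (simp add: c_def power_one_over)
  qed
qed

lemma summable_binomial_geometric:
  fixes z :: complex
  assumes z: "1 < norm z" and j: "1 \<le> j"
  shows "summable (\<lambda>n. norm (of_nat ((j - 1 + n) choose (j - 1)) / z ^ n))"
proof -
  define r where "r = 1 / norm z"
  have "0 < norm z" using z by linarith
  then have r: "0 < r" "r < 1" using z by (simp_all add: r_def)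
  have "(\<lambda>n. ((- real j) gchoose n) * (- r) ^ n) sums (1 + - r) powr (- real j)"
    using r by (intro gen_binomial_real) auto
  moreover have "((- real j) gchoose n) * (- r) ^ n = norm (of_nat ((j - 1 + n) choose (j - 1)) / z ^ n)" for n
  proof -
    have "((- real j) gchoose n) = (- 1) ^ n * of_nat ((j + n - 1) choose n)"
      using j by (simp add: gbinomial_minus binomial_gbinomial of_nat_diff)
    moreover have "(j + n - 1) choose n = (j - 1 + n) choose (j - 1)"
      using j binomial_symmetric[of n "j + n - 1"] by simp
    moreover have "(- 1) ^ n * (- r) ^ n = r ^ n" by (simp flip: power_mult_distrib)
    ultimately have "((- real j) gchoose n) * (- r) ^ n = of_nat ((j - 1 + n) choose (j - 1)) * r ^ n"
      by (metis mult.assoc mult.commute)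
    then show ?thesis by (simp add: r_def norm_divide norm_power power_one_over)
  qed
  ultimately show ?thesis by (simp add: sums_iff)
qed

context autoregression
begin

lemma coeff_char_poly: "poly.coeff (char_poly_P k p) n = of_real (coef n)"
proof -
  have "(\<Sum>l=1..k. poly.coeff (Polynomial.monom (complex_of_real (p l)) l) n) = of_real (pp n)"
    by (simp add: pp_def if_distrib cong: if_cong)
  then show ?thesis by (simp add: char_poly_P_def coeff_sum coef_def pp_def)
qed

lemma char_poly_props:
  shows "char_poly_P k p \<noteq> 0" and "degree (char_poly_P k p) = k"
    and "fps_of_poly (char_poly_P k p) * Abs_fps (\<lambda>n. of_real (\<phi> n)) = 1"
proof -
  have "poly.coeff (char_poly_P k p) 0 = 1" by (simp add: coeff_char_poly coef_def)
  then show "char_poly_P k p \<noteq> 0" by auto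
  show "degree (char_poly_P k p) = k"
  proof (rule antisym)
    show "degree (char_poly_P k p) \<le> k"
      using k2 by (intro degree_le) (auto simp: coeff_char_poly coef_def pp_def)
    show "k \<le> degree (char_poly_P k p)"
      using k2 p_pos by (intro le_degree) (auto simp: coeff_char_poly coef_def pp_def)
  qed
  show "fps_of_poly (char_poly_P k p) * Abs_fps (\<lambda>n. of_real (\<phi> n)) = 1"
  proof (rule fps_ext)
    fix n
    have "(\<Sum>i=0..n. complex_of_real (coef i) * of_real (\<phi> (n - i))) = of_real (\<Sum>i=0..n. coef i * \<phi> (n - i))"
      by simp
    also have "\<dots> = fps_nth 1 n" unfolding coef_\<phi> by simp
    finally show "fps_nth (fps_of_poly (char_poly_P k p) * Abs_fps (\<lambda>n. of_real (\<phi> n))) n = fps_nth 1 n"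
      by (simp add: fps_mult_nth coeff_char_poly)
  qed
qed

lemma char_poly_root_norm:
  assumes s: "(\<Sum>l=1..k. p l) < 1" and q: "poly (char_poly_P k p) q = 0"
  shows "1 < norm q"
proof (rule ccontr)
  assume "\<not> 1 < norm q"
  then have q1: "norm q \<le> 1" by simp
  have "1 = (\<Sum>l=1..k. complex_of_real (p l) * q ^ l)"
    using q by (simp add: char_poly_P_def poly_sum poly_monom)
  then have "1 = norm (\<Sum>l=1..k. complex_of_real (p l) * q ^ l)" by (metis norm_one)
  also have "\<dots> \<le> (\<Sum>l=1..k. norm (complex_of_real (p l) * q ^ l))" by (rule norm_sum)
  also have "\<dots> \<le> (\<Sum>l=1..k. p l)"
    using q1 p_positive by (intro sum_mono) (auto simp: norm_mult norm_power less_imp_le intro!: mult_left_le power_le_one)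
  finally show False using s by simp
qed

text \<open>The factor \<open>x\<close> in the numerator of \<open>B_coeff\<close> means that
  \<open>x / P\<close>, not \<open>1 / P\<close>, is expanded. Hence the index shift by one and the
  value 0 at \<open>n = 0\<close>. The Taylor coefficient of order \<open>d - j\<close> at a root of
  multiplicity \<open>d\<close> multiplies the pole of order \<open>j\<close>.\<close>

lemma shifted_\<phi>_expansion:
  fixes P :: "complex poly"
  defines "P \<equiv> char_poly_P k p"
  assumes s: "(\<Sum>l=1..k. p l) < 1"
  shows "(\<Sum>q | poly P q = 0. \<Sum>j=1..order q P. B_coeff P j q * of_nat ((j - 1 + n) choose (j - 1)) / q ^ n) =
    (if n = 0 then 0 else of_real (\<phi> (n - 1)))"
proof -
  define R where "R = {q. poly P q = 0}"
  note props = char_poly_props[folded P_def]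
  have R: "finite R" unfolding R_def using props(1) by (rule poly_roots_finite)
  define X :: "complex poly" where "X = [:0, 1:]"
  have "degree X < degree P" using props(2) k2 by (simp add: X_def)
  then obtain T Q where PQ: "\<And>q. q \<in> R \<Longrightarrow> P = [:- q, 1:] ^ Polynomial.order q P * Q q"
      and Qq: "\<And>q. q \<in> R \<Longrightarrow> poly (Q q) q \<noteq> 0" and dvd: "\<And>q. q \<in> R \<Longrightarrow> [:- q, 1:] ^ Polynomial.order q P dvd X - T q * Q q"
      and X: "X = (\<Sum>q\<in>R. T q * Q q)" and degT: "\<And>q. q \<in> R \<Longrightarrow> T q = 0 \<or> degree (T q) < Polynomial.order q P"
    using partial_fractions_complex[OF props(1), of X] unfolding R_def by blast
  define F where "F = Abs_fps (\<lambda>n. complex_of_real (\<phi> n))"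
  define E where "E q = fps_of_poly [:- q, 1:]" for q :: complex
  have q0: "q \<noteq> 0" if "q \<in> R" for q using char_poly_root_norm[OF s, of q] that by (auto simp: R_def P_def)
  have E_unit: "inverse (E q ^ j) * E q ^ j = 1" if "q \<in> R" for q j
    by (rule inverse_mult_eq_1) (use q0[OF that] in \<open>simp add: E_def fps_power_zeroth\<close>)
  have QF: "fps_of_poly (Q q) * F = inverse (E q ^ Polynomial.order q P)" if q: "q \<in> R" for q
  proof -
    have "fps_of_poly P = E q ^ Polynomial.order q P * fps_of_poly (Q q)"
      using PQ[OF q] by (metis E_def fps_of_poly_mult fps_of_poly_power)
    then have "E q ^ Polynomial.order q P * (fps_of_poly (Q q) * F) = 1"
      using props(3) by (simp add: F_def mult.assoc)
    then have "inverse (E q ^ Polynomial.order q P) * E q ^ Polynomial.order q P * (fps_of_poly (Q q) * F) = inverse (E q ^ Polynomial.order q P)"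
      by (simp add: mult.assoc)
    then show ?thesis using E_unit[OF q] by simp
  qed
  define c where "c q i = poly.coeff (pcompose (T q) [:q, 1:]) i" for q i
  have TE: "fps_of_poly (T q) = (\<Sum>i<Polynomial.order q P. fps_const (c q i) * E q ^ i)" if q: "q \<in> R" for q
  proof -
    define W where "W = pcompose (T q) [:q, 1:]"
    have ord: "0 < Polynomial.order q P" using q props(1) by (simp add: R_def order_root)
    have degW: "degree W < Polynomial.order q P"
      using degT[OF q] ord by (auto simp: W_def degree_pcompose)
    have "T q = pcompose W [:- q, 1:]"
      by (simp add: W_def pcompose_assoc[symmetric] pcompose_pCons pcompose_idR)
    also have "W = (\<Sum>i<Polynomial.order q P. Polynomial.monom (c q i) i)"
    proof (rule poly_eqI)
      fix n
      show "poly.coeff W n = poly.coeff (\<Sum>i<Polynomial.order q P. Polynomial.monom (c q i) i) n"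
        using coeff_eq_0[of W n] degW by (auto simp: coeff_sum c_def W_def[symmetric])
    qed
    finally have "T q = (\<Sum>i<Polynomial.order q P. Polynomial.smult (c q i) ([:- q, 1:] ^ i))"
      by (simp add: pcompose_sum pcompose_monom)
    then show ?thesis
      by (simp add: fps_of_poly_sum fps_of_poly_smult fps_of_poly_power E_def)
  qed
  have TF: "fps_of_poly (T q) * inverse (E q ^ Polynomial.order q P) = (\<Sum>j=1..order q P. fps_const (c q (Polynomial.order q P - j)) * inverse (E q ^ j))"
    if q: "q \<in> R" for q
  proof -
    have "fps_of_poly (T q) * inverse (E q ^ Polynomial.order q P) = (\<Sum>i<Polynomial.order q P. fps_const (c q i) * (E q ^ i * inverse (E q ^ Polynomial.order q P)))"
      by (simp add: TE[OF q] sum_distrib_right mult.assoc)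
    also have "\<dots> = (\<Sum>i<Polynomial.order q P. fps_const (c q i) * inverse (E q ^ (Polynomial.order q P - i)))"
    proof (intro sum.cong refl arg_cong2[where f="(*)"])
      fix i assume "i \<in> {..<Polynomial.order q P}"
      then have "E q ^ Polynomial.order q P = E q ^ i * E q ^ (Polynomial.order q P - i)" by (simp flip: power_add)
      then have "E q ^ i * inverse (E q ^ Polynomial.order q P) = (inverse (E q ^ i) * E q ^ i) * inverse (E q ^ (Polynomial.order q P - i))"
        by (simp add: fps_inverse_mult mult_ac)
      then show "E q ^ i * inverse (E q ^ Polynomial.order q P) = inverse (E q ^ (Polynomial.order q P - i))"
        using E_unit[OF q] by simp
    qed
    also have "\<dots> = (\<Sum>j=1..order q P. fps_const (c q (Polynomial.order q P - j)) * inverse (E q ^ j))"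
      by (rule sum.reindex_bij_witness[where i="\<lambda>j. Polynomial.order q P - j" and j="\<lambda>i. Polynomial.order q P - i"]) auto
    finally show ?thesis .
  qed
  have "fps_X * F = fps_of_poly X * F" by (simp add: X_def)
  also have "\<dots> = (\<Sum>q\<in>R. fps_of_poly (T q) * (fps_of_poly (Q q) * F))"
    by (subst X) (simp add: fps_of_poly_sum fps_of_poly_mult sum_distrib_right mult.assoc)
  also have "\<dots> = (\<Sum>q\<in>R. \<Sum>j=1..order q P. fps_const (c q (Polynomial.order q P - j)) * inverse (E q ^ j))"
    by (intro sum.cong refl) (simp only: QF TF)
  finally have "fps_nth (fps_X * F) n = (\<Sum>q\<in>R. \<Sum>j=1..order q P. c q (Polynomial.order q P - j) * fps_nth (inverse (E q ^ j)) n)"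
    by (simp add: fps_sum_nth)
  also have "\<dots> = (\<Sum>q\<in>R. \<Sum>j=1..order q P. B_coeff P j q * of_nat ((j - 1 + n) choose (j - 1)) / q ^ n)"
  proof (intro sum.cong refl)
    fix q j assume q: "q \<in> R" and j: "j \<in> {1..order q P}"
    have "Lim (at q) ((deriv ^^ (Polynomial.order q P - j)) (\<lambda>x. poly X x * (x - q) ^ Polynomial.order q P / poly P x)) =
        fact (Polynomial.order q P - j) * c q (Polynomial.order q P - j)"
      unfolding c_def using j by (intro Lim_higher_deriv_root[OF PQ[OF q] Qq[OF q] dvd[OF q]]) auto
    then have "B_coeff P j q = (- 1) ^ j / q ^ j * c q (Polynomial.order q P - j)"
      by (simp add: B_coeff_def Let_def X_def)
    moreover have "fps_nth (inverse (E q ^ j)) n = (- 1) ^ j / q ^ j * of_nat ((j - 1 + n) choose (j - 1)) / q ^ n"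
      unfolding E_def using fps_inverse_linear_power[OF q0[OF q], of j] j by simp
    ultimately show "c q (Polynomial.order q P - j) * fps_nth (inverse (E q ^ j)) n = B_coeff P j q * of_nat ((j - 1 + n) choose (j - 1)) / q ^ n"
      by simp
  qed
  also have "fps_nth (fps_X * F) n = (if n = 0 then 0 else of_real (\<phi> (n - 1)))"
    by (simp add: F_def)
  finally show ?thesis by (simp add: R_def)
qed

lemma c_star_eq:
  assumes s: "(\<Sum>l=1..k. p l) < 1"
  shows "c_star k p = of_real (\<Sum>n. (\<phi> n)\<^sup>2)"
proof -
  define P where "P = char_poly_P k p"
  define R where "R = {q. poly P q = 0}"
  define b :: "complex \<Rightarrow> nat \<Rightarrow> nat \<Rightarrow> complex" where "b q j n = of_nat ((j - 1 + n) choose (j - 1)) / q ^ n" for q j n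
  have R1: "1 < norm q" if "q \<in> R" for q
    using char_poly_root_norm[OF s, of q] that by (simp add: R_def P_def)
  have F: "(\<lambda>n. b q j n * b q' j' n) sums F_series j j' (q * q')"
    if "q \<in> R" "q' \<in> R" "j \<in> {1..order q P}" "j' \<in> {1..order q' P}" for q q' j j'
  proof -
    have sm: "summable (\<lambda>n. norm (b q j n))" "summable (\<lambda>n. norm (b q' j' n))"
      unfolding b_def using summable_binomial_geometric R1 that by auto
    have "summable (\<lambda>n. norm (b q j n * b q' j' n))"
      unfolding norm_mult
    proof (rule summable_comparison_test_ev)
      have "(\<lambda>n. norm (b q' j' n)) \<longlonglongrightarrow> 0" by (rule summable_LIMSEQ_zero[OF sm(2)])
      then have "eventually (\<lambda>n. norm (b q' j' n) < 1) sequentially" by (rule order_tendstoD) simp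
      then show "eventually (\<lambda>n. norm (norm (b q j n) * norm (b q' j' n)) \<le> norm (b q j n)) sequentially"
        by eventually_elim (simp add: mult_left_le)
    qed (rule sm)
    then have "(\<lambda>n. b q j n * b q' j' n) sums (\<Sum>n. b q j n * b q' j' n)"
      by (rule summable_sums[OF summable_norm_cancel])
    moreover have "(\<Sum>n. b q j n * b q' j' n) = F_series j j' (q * q')"
      unfolding F_series_def b_def by (simp add: power_mult_distrib)
    ultimately show ?thesis by simp
  qed
  have cs: "c_star k p = (\<Sum>q\<in>R. \<Sum>q'\<in>R. \<Sum>j=1..order q P. \<Sum>j'=1..order q' P.
      B_coeff P j q * B_coeff P j' q' * F_series j j' (q * q'))"
    by (simp add: c_star_def Let_def P_def R_def)
  have "(\<lambda>n. \<Sum>q\<in>R. \<Sum>q'\<in>R. \<Sum>j=1..order q P. \<Sum>j'=1..order q' P.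
      B_coeff P j q * B_coeff P j' q' * (b q j n * b q' j' n)) sums c_star k p"
    unfolding cs by (intro sums_sum sums_mult F) auto
  moreover have "(\<Sum>q\<in>R. \<Sum>q'\<in>R. \<Sum>j=1..order q P. \<Sum>j'=1..order q' P.
      B_coeff P j q * B_coeff P j' q' * (b q j n * b q' j' n)) = of_real (if n = 0 then 0 else (\<phi> (n - 1))\<^sup>2)" for n
  proof -
    \<comment> \<open>The quadruple sum factors as the square of one expansion. Its value is real,
      so no complex conjugate has to appear in the formula for the constant.\<close>
    define \<psi> where "\<psi> = (\<Sum>q\<in>R. \<Sum>j=1..order q P. B_coeff P j q * b q j n)"
    have "(\<Sum>q\<in>R. \<Sum>q'\<in>R. \<Sum>j=1..order q P. \<Sum>j'=1..order q' P.
        B_coeff P j q * B_coeff P j' q' * (b q j n * b q' j' n)) =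
        (\<Sum>q\<in>R. \<Sum>q'\<in>R. (\<Sum>j=1..order q P. B_coeff P j q * b q j n) * (\<Sum>j'=1..order q' P. B_coeff P j' q' * b q' j' n))"
      by (simp add: sum_product mult_ac)
    also have "\<dots> = \<psi> * \<psi>" unfolding \<psi>_def by (rule sum_product[symmetric])
    also have "\<psi> = (if n = 0 then 0 else of_real (\<phi> (n - 1)))"
      using shifted_\<phi>_expansion[OF s, of n] by (simp add: \<psi>_def b_def R_def P_def)
    finally show ?thesis by (simp add: power2_eq_square)
  qed
  ultimately have 1: "(\<lambda>n. complex_of_real (if n = 0 then 0 else (\<phi> (n - 1))\<^sup>2)) sums c_star k p" by simp
  have "(\<lambda>n. (\<phi> n)\<^sup>2) sums (\<Sum>n. (\<phi> n)\<^sup>2)"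
    by (rule summable_sums[OF \<phi>_squares_summable[OF s]])
  then have "(\<lambda>n. if n = 0 then 0 else (\<phi> (n - 1))\<^sup>2) sums (\<Sum>n. (\<phi> n)\<^sup>2)"
    using sums_Suc_iff[of "\<lambda>n. if n = 0 then 0 else (\<phi> (n - 1))\<^sup>2" "\<Sum>n. (\<phi> n)\<^sup>2"] by simp
  then have 2: "(\<lambda>n. complex_of_real (if n = 0 then 0 else (\<phi> (n - 1))\<^sup>2)) sums of_real (\<Sum>n. (\<phi> n)\<^sup>2)"
    by (rule sums_of_real)
  show ?thesis by (rule sums_unique2[OF 1 2])
qed

section \<open>Excessive functions and potentials\<close>

lemma has_sum_sum_finite:
  fixes f :: "'i \<Rightarrow> 'c \<Rightarrow> real"
  assumes "finite I" "\<And>i. i \<in> I \<Longrightarrow> (f i has_sum s i) A"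
  shows "((\<lambda>x. \<Sum>i\<in>I. f i x) has_sum (\<Sum>i\<in>I. s i)) A"
  using assms by (induction I rule: finite_induct) (auto intro: has_sum_add)

text \<open>Here \<open>u\<close> is the transpose of \<open>\<Phi>\<close> applied to
  \<open>h\<close>, and \<open>f = \<Phi> u\<close>. The renewal equation reduces \<open>u i\<close>
  minus its look-ahead average to \<open>h i\<close>, hence the inequality. The series for
  \<open>u i\<close> is dominated by the one for \<open>f i\<close>, through the term
  \<open>m = i\<close> of \<open>green\<close>, where \<open>\<phi> 0 = 1\<close>.\<close>

lemma potential_has_half:
  assumes V: "\<And>i j. 1 \<le> i \<Longrightarrow> 1 \<le> j \<Longrightarrow> V i j = green i j"
    and h: "\<And>n. 1 \<le> n \<Longrightarrow> 0 \<le> h n" and pot: "is_potential_of V h f"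
  shows "\<exists>u. potential_half u f \<and> (\<forall>i\<ge>1. ((\<lambda>n. \<Phi> n i * h n) has_sum u i) {1..})"
proof -
  have hs: "((\<lambda>n. green j n * h n) has_sum f j) {1..}" if "1 \<le> j" for j
    using pot that V by (subst has_sum_cong[where g="\<lambda>n. V j n * h n"]) (auto simp: is_potential_of_def)
  have \<Phi>0: "0 \<le> \<Phi> i j" for i j by (simp add: \<Phi>_def \<phi>_nonneg)
  define u where "u i = infsum (\<lambda>n. \<Phi> n i * h n) {1..}" for i
  have u: "((\<lambda>n. \<Phi> n i * h n) has_sum u i) {1..}" if i: "1 \<le> i" for i
  proof -
    have "(\<lambda>n. \<Phi> n i * h n) summable_on {1..}"
    proof (rule summable_on_comparison_test)
      show "(\<lambda>n. green i n * h n) summable_on {1..}" using hs[OF i] by (rule has_sum_imp_summable)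
      fix n :: nat assume n: "n \<in> {1..}"
      have "\<Phi> n i \<le> green i n"
      proof -
        have "(\<Sum>m\<in>{i}. \<Phi> i m * \<Phi> n m) \<le> (\<Sum>m=1..i. \<Phi> i m * \<Phi> n m)"
          using i \<Phi>0 by (intro sum_mono2) auto
        then show ?thesis using green_\<Phi>[of i i n] by (simp add: \<Phi>_def)
      qed
      then show "\<Phi> n i * h n \<le> green i n * h n" using h n by (intro mult_right_mono) auto
      show "0 \<le> \<Phi> n i * h n" using h n \<Phi>0 by auto
    qed
    then show ?thesis unfolding u_def by (rule has_sum_infsum)
  qed
  have "potential_half u f"
    unfolding potential_half_def
  proof (intro conjI allI impI)
    fix i :: nat assume i: "1 \<le> i"
    show "0 \<le> u i" by (rule has_sum_nonneg[OF u[OF i]]) (use h \<Phi>0 in auto)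
    show "(\<Sum>l=1..k. p l * u (i + l)) \<le> u i"
    proof (rule has_sum_mono)
      show "((\<lambda>n. \<Sum>l=1..k. p l * (\<Phi> n (i + l) * h n)) has_sum (\<Sum>l=1..k. p l * u (i + l))) {1..}"
        using i by (intro has_sum_sum_finite has_sum_cmult_right u) auto
      show "((\<lambda>n. \<Phi> n i * h n) has_sum u i) {1..}" by (rule u[OF i])
      fix n :: nat assume n: "n \<in> {1..}"
      have "(\<Sum>l=1..k. p l * \<Phi> n (i + l)) \<le> \<Phi> n i"
      proof (cases "i < n")
        case True
        have "(\<Sum>l=1..k. p l * \<Phi> n (i + l)) = (\<Sum>l\<in>{1..k} \<inter> {1..n - i}. p l * \<Phi> n (i + l))"
          by (intro sum.mono_neutral_right) (auto simp: \<Phi>_def)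
        also have "\<dots> = (\<Sum>l=1..n - i. pp l * \<phi> (n - i - l))"
          by (intro sum.mono_neutral_cong_left) (auto simp: pp_def \<Phi>_def)
        also have "\<dots> = \<phi> (n - i)" using True by (intro \<phi>_rec[symmetric]) simp
        finally show ?thesis using True by (simp add: \<Phi>_def)
      next
        case False
        then have "(\<Sum>l=1..k. p l * \<Phi> n (i + l)) = 0" by (intro sum.neutral) (auto simp: \<Phi>_def)
        then show ?thesis using \<Phi>0 by simp
      qed
      then have "(\<Sum>l=1..k. p l * \<Phi> n (i + l)) * h n \<le> \<Phi> n i * h n"
        using h n by (intro mult_right_mono) auto
      then show "(\<Sum>l=1..k. p l * (\<Phi> n (i + l) * h n)) \<le> \<Phi> n i * h n"
        by (simp add: sum_distrib_right mult.assoc)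
    qed
  next
    fix j :: nat assume j: "1 \<le> j"
    have "((\<lambda>n. \<Sum>m=1..j. \<phi> (j - m) * (\<Phi> n m * h n)) has_sum (\<Sum>m=1..j. \<phi> (j - m) * u m)) {1..}"
      by (intro has_sum_sum_finite has_sum_cmult_right u) auto
    moreover have "(\<Sum>m=1..j. \<phi> (j - m) * (\<Phi> n m * h n)) = green j n * h n" for n
    proof -
      have "(\<Sum>m=1..j. \<phi> (j - m) * (\<Phi> n m * h n)) = (\<Sum>m=1..j. \<Phi> j m * \<Phi> n m) * h n"
        unfolding sum_distrib_right by (intro sum.cong) (auto simp: \<Phi>_def)
      then show ?thesis using green_\<Phi>[of j j n] by simp
    qed
    ultimately show "f j = (\<Sum>m=1..j. \<phi> (j - m) * u m)"
      using has_sum_unique[OF hs[OF j]] by simp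
  qed
  then show ?thesis using u by blast
qed

lemma potential_half_nonneg: "potential_half u f \<Longrightarrow> 1 \<le> j \<Longrightarrow> 0 \<le> f j"
  unfolding potential_half_def by (auto intro!: sum_nonneg mult_nonneg_nonneg \<phi>_nonneg)

lemma convolution_tendsto_0:
  assumes s: "(\<Sum>l=1..k. p l) < 1" and u: "u \<longlonglongrightarrow> 0"
  shows "(\<lambda>j. \<Sum>m=1..j. \<phi> (j - m) * u m) \<longlonglongrightarrow> 0"
proof (rule LIMSEQ_I)
  fix \<epsilon> :: real assume \<epsilon>: "0 < \<epsilon>"
  define S where "S = (\<Sum>n. \<phi> n)"
  have sm: "summable \<phi>" by (rule \<phi>_summable[OF s])
  have S0: "0 \<le> S" unfolding S_def by (intro suminf_nonneg sm \<phi>_nonneg)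
  define \<delta> where "\<delta> = \<epsilon> / (2 * (S + 1))"
  have \<delta>: "0 < \<delta>" using \<epsilon> S0 by (simp add: \<delta>_def)
  from LIMSEQ_D[OF u \<delta>] obtain M where M: "\<And>m. M \<le> m \<Longrightarrow> \<bar>u m\<bar> < \<delta>" by auto
  have "(\<lambda>j. \<Sum>m<M. \<bar>\<phi> (j - m) * u m\<bar>) \<longlonglongrightarrow> (\<Sum>m<M. \<bar>0 * u m\<bar>)"
  proof (intro tendsto_sum tendsto_rabs tendsto_mult tendsto_const)
    fix m
    show "(\<lambda>j. \<phi> (j - m)) \<longlonglongrightarrow> 0"
      by (rule LIMSEQ_offset[where k=m]) (simp add: summable_LIMSEQ_zero[OF sm])
  qed
  then have "(\<lambda>j. \<Sum>m<M. \<bar>\<phi> (j - m) * u m\<bar>) \<longlonglongrightarrow> 0" by simp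
  from order_tendstoD(2)[OF this, of "\<epsilon> / 2"] \<epsilon> obtain J
    where J: "\<And>j. J \<le> j \<Longrightarrow> (\<Sum>m<M. \<bar>\<phi> (j - m) * u m\<bar>) < \<epsilon> / 2" by (auto simp: eventually_sequentially)
  show "\<exists>no. \<forall>n\<ge>no. norm ((\<Sum>m=1..n. \<phi> (n - m) * u m) - 0) < \<epsilon>"
  proof (intro exI[of _ J] allI impI)
    fix j assume j: "J \<le> j"
    have "\<bar>\<Sum>m=1..j. \<phi> (j - m) * u m\<bar> \<le> (\<Sum>m=1..j. \<bar>\<phi> (j - m) * u m\<bar>)" by (rule sum_abs)
    also have "\<dots> \<le> (\<Sum>m\<in>{..<M} \<union> {1..j}. \<bar>\<phi> (j - m) * u m\<bar>)" by (intro sum_mono2) auto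
    also have "{..<M} \<union> {1..j} = {..<M} \<union> ({1..j} - {..<M})" by auto
    also have "(\<Sum>m\<in>\<dots>. \<bar>\<phi> (j - m) * u m\<bar>) = (\<Sum>m<M. \<bar>\<phi> (j - m) * u m\<bar>) + (\<Sum>m\<in>{1..j} - {..<M}. \<bar>\<phi> (j - m) * u m\<bar>)"
      by (intro sum.union_disjoint) auto
    also have "(\<Sum>m\<in>{1..j} - {..<M}. \<bar>\<phi> (j - m) * u m\<bar>) \<le> (\<Sum>m\<in>{1..j} - {..<M}. \<phi> (j - m) * \<delta>)"
      unfolding abs_mult using M by (intro sum_mono mult_mono) (auto simp: \<phi>_nonneg intro: less_imp_le)
    also have "\<dots> \<le> (\<Sum>m=1..j. \<phi> (j - m) * \<delta>)"
      using \<delta> by (intro sum_mono2) (auto simp: \<phi>_nonneg)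
    also have "\<dots> = (\<Sum>n<j. \<phi> n) * \<delta>"
      unfolding sum_distrib_right
      by (rule sum.reindex_bij_witness[where i="\<lambda>n. j - n" and j="\<lambda>m. j - m"]) auto
    also have "\<dots> \<le> S * \<delta>"
      unfolding S_def using \<delta> by (intro mult_right_mono sum_le_suminf sm) (auto simp: \<phi>_nonneg)
    also have "\<dots> \<le> \<epsilon> / 2" using S0 \<epsilon> by (simp add: \<delta>_def field_simps)
    finally show "norm ((\<Sum>m=1..j. \<phi> (j - m) * u m) - 0) < \<epsilon>" using J[OF j] by simp
  qed
qed

text \<open>Both triangular halves of \<open>V\<close> are convolutions with the summable sequence
  \<open>\<phi>\<close>, and each preserves convergence to 0: the first looks ahead and uses the
  supremum of the tail of \<open>h\<close>, the second looks back.\<close>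

lemma potential_tendsto_0:
  assumes s: "(\<Sum>l=1..k. p l) < 1"
    and V: "\<And>i j. 1 \<le> i \<Longrightarrow> 1 \<le> j \<Longrightarrow> V i j = green i j"
    and h: "h \<in> c0_plus" and pot: "is_potential_of V h f"
  shows "f \<in> c0_plus"
proof -
  have h0: "\<And>n. 1 \<le> n \<Longrightarrow> 0 \<le> h n" and hlim: "h \<longlonglongrightarrow> 0" using h by (auto simp: c0_plus_def)
  obtain u where half: "potential_half u f" and u: "\<And>i. 1 \<le> i \<Longrightarrow> ((\<lambda>n. \<Phi> n i * h n) has_sum u i) {1..}"
    using potential_has_half[OF V h0 pot] by blast
  define S where "S = (\<Sum>n. \<phi> n)"
  have sm: "summable \<phi>" by (rule \<phi>_summable[OF s])
  have S0: "0 \<le> S" unfolding S_def by (intro suminf_nonneg sm \<phi>_nonneg)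
  have "u \<longlonglongrightarrow> 0"
  proof (rule LIMSEQ_I)
    fix \<epsilon> :: real assume \<epsilon>: "0 < \<epsilon>"
    define \<delta> where "\<delta> = \<epsilon> / (S + 1)"
    have \<delta>: "0 < \<delta>" using \<epsilon> S0 by (simp add: \<delta>_def)
    from LIMSEQ_D[OF hlim \<delta>] obtain M where M: "\<And>m. M \<le> m \<Longrightarrow> \<bar>h m\<bar> < \<delta>" by auto
    show "\<exists>no. \<forall>n\<ge>no. norm (u n - 0) < \<epsilon>"
    proof (intro exI[of _ "max M 1"] allI impI)
      fix i assume i: "max M 1 \<le> i"
      have "u i \<le> S * \<delta>"
      proof (rule has_sum_le_finite_sums[OF u])
        fix F :: "nat set" assume F: "finite F" "F \<subseteq> {1..}"
        have "(\<Sum>n\<in>F. \<Phi> n i * h n) \<le> (\<Sum>n\<in>F \<inter> {i..}. \<phi> (n - i) * \<delta>)"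
        proof -
          have "(\<Sum>n\<in>F. \<Phi> n i * h n) = (\<Sum>n\<in>F \<inter> {i..}. \<phi> (n - i) * h n)"
            using F by (intro sum.mono_neutral_cong_right) (auto simp: \<Phi>_def)
          also have "\<dots> \<le> (\<Sum>n\<in>F \<inter> {i..}. \<phi> (n - i) * \<delta>)"
          proof (intro sum_mono mult_left_mono \<phi>_nonneg)
            fix n assume "n \<in> F \<inter> {i..}"
            then show "h n \<le> \<delta>" using M[of n] i by auto
          qed
          finally show ?thesis .
        qed
        also have "\<dots> = sum \<phi> ((\<lambda>n. n - i) ` (F \<inter> {i..})) * \<delta>"
          by (subst sum.reindex) (auto simp: inj_on_def sum_distrib_right)
        also have "\<dots> \<le> S * \<delta>"
          unfolding S_def using \<delta> F by (intro mult_right_mono sum_le_suminf sm) (auto simp: \<phi>_nonneg)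
        finally show "(\<Sum>n\<in>F. \<Phi> n i * h n) \<le> S * \<delta>" .
      qed (use i in simp)
      also have "\<dots> < \<epsilon>" using S0 \<epsilon> by (simp add: \<delta>_def field_simps)
      finally have "u i < \<epsilon>" .
      moreover have "0 \<le> u i" using half i by (auto simp: potential_half_def)
      ultimately show "norm (u i - 0) < \<epsilon>" by simp
    qed
  qed
  from convolution_tendsto_0[OF s this] have "f \<longlonglongrightarrow> 0"
  proof (rule Lim_transform_eventually)
    show "eventually (\<lambda>j. (\<Sum>m=1..j. \<phi> (j - m) * u m) = f j) sequentially"
      using eventually_ge_at_top[of 1]
      by eventually_elim (use half in \<open>auto simp: potential_half_def\<close>)
  qed
  then show ?thesis using potential_half_nonneg[OF half] by (simp add: c0_plus_def)
qed

text \<open>\<open>L r n\<close> vanishes for \<open>r > n + k\<close>, so cutting the product at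
  \<open>R \<ge> n + k\<close> loses nothing in row \<open>n\<close>. Away from the corner the
  inverse is the Toeplitz matrix of the chain.\<close>

lemma A_matrix_eq_green_inv:
  assumes n: "1 \<le> n" and m: "1 \<le> m" and R: "n + k \<le> R"
  shows "A_matrix k p n m = green_inv R n m"
proof -
  have off: "A_matrix k p i j = green_inv R i j \<and> A_matrix k p j i = green_inv R i j" if ij: "1 \<le> i" "i < j" "i + k \<le> R" for i j
  proof -
    define d where "d = j - i"
    have d: "1 \<le> d" "j = i + d" "nat \<bar>int i - int j\<bar> = d" "nat \<bar>int j - int i\<bar> = d" using ij by (auto simp: d_def)
    have A: "A_matrix k p i j = (if d \<le> k then - p d + (\<Sum>l=1..k - d. p l * p (d + l)) else 0)"
      "A_matrix k p j i = A_matrix k p i j"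
      using d by (auto simp: A_matrix_def Let_def)
    have g: "green_inv R i j = (\<Sum>r=j..R. coef (r - i) * coef (r - j))"
      unfolding green_inv_def L_def using ij by (intro sum.mono_neutral_cong_right) auto
    show ?thesis
    proof (cases "d \<le> k")
      case False
      then have "green_inv R i j = 0"
        unfolding g by (intro sum.neutral) (auto simp: coef_def pp_def d)
      then show ?thesis using A False by simp
    next
      case True
      have "green_inv R i j = coef d + (\<Sum>r=Suc j..R. coef (r - i) * coef (r - j))"
        unfolding g using ij d True by (subst sum.atLeast_Suc_atMost) (auto simp: coef_def)
      also have "(\<Sum>r=Suc j..R. coef (r - i) * coef (r - j)) = (\<Sum>l=1..R - j. pp l * pp (d + l))"
        by (rule sum.reindex_bij_witness[where i="\<lambda>l. j + l" and j="\<lambda>r. r - j"]) (auto simp: coef_def d)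
      also have "\<dots> = (\<Sum>l=1..k - d. p l * p (d + l))"
        using ij d True by (intro sum.mono_neutral_cong_right) (auto simp: pp_def)
      finally show ?thesis using A True d by (simp add: coef_def pp_def)
    qed
  qed
  show ?thesis
  proof (cases n m rule: linorder_cases)
    case less
    then show ?thesis using off[of n m] n R by simp
  next
    case greater
    then show ?thesis using off[of m n] m R green_inv_sym[of R n m] by simp
  next
    case equal
    have "green_inv R n n = (\<Sum>r=n..R. coef (r - n) * coef (r - n))"
      unfolding green_inv_def L_def using n by (intro sum.mono_neutral_cong_right) auto
    also have "\<dots> = 1 + (\<Sum>r=Suc n..R. coef (r - n) * coef (r - n))"
      using R by (subst sum.atLeast_Suc_atMost) (auto simp: coef_def)
    also have "(\<Sum>r=Suc n..R. coef (r - n) * coef (r - n)) = (\<Sum>l=1..R - n. (pp l)\<^sup>2)"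
      by (rule sum.reindex_bij_witness[where i="\<lambda>l. n + l" and j="\<lambda>r. r - n"]) (auto simp: coef_def power2_eq_square)
    also have "\<dots> = (\<Sum>l=1..k. (p l)\<^sup>2)"
      using R by (intro sum.mono_neutral_cong_right) (auto simp: pp_def)
    finally show ?thesis using equal by (simp add: A_matrix_def)
  qed
qed

text \<open>Differentiating \<open>P\<^sub>t f \<le> f\<close> at time 0. Non-negative terms beyond
  \<open>j + k\<close> are dropped before the limit, so the derivative is taken in a finite sum;
  this costs nothing because \<open>A\<close> vanishes there.\<close>

lemma excessive_generator_nonneg:
  assumes chain: "transition_function pt" and Q: "has_Q_matrix pt (\<lambda>m n. - A_matrix k p m n)"
    and f: "excessive pt f" and j: "1 \<le> j"
  shows "0 \<le> (\<Sum>n=1..j + k. A_matrix k p j n * f n)"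
proof -
  have f0: "\<And>n. 1 \<le> n \<Longrightarrow> 0 \<le> f n"
    and sm: "\<And>t. 0 < t \<Longrightarrow> (\<lambda>n. pt t j n * f n) summable_on {1..}"
    and anti: "antimono_on {0<..} (\<lambda>t. semigroup_apply pt t f j)"
    and lim: "((\<lambda>t. semigroup_apply pt t f j) \<longlongrightarrow> f j) (at_right 0)"
    using f j by (auto simp: excessive_def)
  have pt0: "\<And>t m n. 0 \<le> t \<Longrightarrow> 1 \<le> m \<Longrightarrow> 1 \<le> n \<Longrightarrow> 0 \<le> pt t m n"
    and pt_0: "\<And>m n. 1 \<le> m \<Longrightarrow> 1 \<le> n \<Longrightarrow> pt 0 m n = (if m = n then 1 else 0)"
    using chain by (auto simp: transition_function_def)
  have le: "semigroup_apply pt t f j \<le> f j" if t: "0 < t" for t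
  proof (rule tendsto_lowerbound[OF lim])
    show "eventually (\<lambda>s. semigroup_apply pt t f j \<le> semigroup_apply pt s f j) (at_right 0)"
      unfolding eventually_at_right_field
      using t anti by (intro exI[of _ t]) (auto simp: monotone_on_def)
  qed simp
  have quot: "(\<Sum>n=1..j + k. (pt t j n - pt 0 j n) / (t - 0) * f n) \<le> 0" if t: "0 < t" for t
  proof -
    have "(\<Sum>n=1..j + k. pt t j n * f n) \<le> semigroup_apply pt t f j"
      unfolding semigroup_apply_def using sm[OF t] pt0 f0 t j by (intro finite_sum_le_infsum) auto
    also have "\<dots> \<le> f j" by (rule le[OF t])
    also have "f j = (\<Sum>n=1..j + k. pt 0 j n * f n)"
      using j by (simp add: pt_0 if_distrib[where f="\<lambda>c. c * _"] cong: if_cong)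
    finally have "(\<Sum>n=1..j + k. pt t j n * f n) - (\<Sum>n=1..j + k. pt 0 j n * f n) \<le> 0" by simp
    then have "((\<Sum>n=1..j + k. pt t j n * f n) - (\<Sum>n=1..j + k. pt 0 j n * f n)) / t \<le> 0"
      using t by (simp add: divide_nonpos_pos)
    then show ?thesis by (simp add: sum_subtractf sum_divide_distrib diff_divide_distrib left_diff_distrib)
  qed
  have "((\<lambda>t. \<Sum>n=1..j + k. (pt t j n - pt 0 j n) / (t - 0) * f n) \<longlongrightarrow> (\<Sum>n=1..j + k. - A_matrix k p j n * f n)) (at_right 0)"
  proof (intro tendsto_sum tendsto_mult tendsto_const)
    fix n assume "n \<in> {1..j + k}"
    then have "((\<lambda>t. pt t j n) has_real_derivative - A_matrix k p j n) (at 0 within {0..})"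
      using Q j by (auto simp: has_Q_matrix_def)
    then show "((\<lambda>t. (pt t j n - pt 0 j n) / (t - 0)) \<longlongrightarrow> - A_matrix k p j n) (at_right 0)"
      by (simp add: has_field_derivative_iff at_within_Ici_at_right)
  qed
  then have "(\<Sum>n=1..j + k. - A_matrix k p j n * f n) \<le> 0"
  proof (rule tendsto_upperbound)
    show "eventually (\<lambda>t. (\<Sum>n=1..j + k. (pt t j n - pt 0 j n) / (t - 0) * f n) \<le> 0) (at_right 0)"
      using quot by (auto simp: eventually_at_right_field intro!: exI[of _ 1])
  qed simp
  then show ?thesis by (simp add: sum_negf)
qed

text \<open>Since \<open>A = L\<^sup>T L\<close>, the function \<open>h = A f\<close> is computed from \<open>u = L f\<close>, and \<open>V A f = f\<close> by telescoping.\<close>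

lemma excessive_is_potential:
  assumes s: "(\<Sum>l=1..k. p l) < 1"
    and V: "\<And>i j. 1 \<le> i \<Longrightarrow> 1 \<le> j \<Longrightarrow> V i j = green i j"
    and chain: "transition_function pt" and Q: "has_Q_matrix pt (\<lambda>m n. - A_matrix k p m n)"
    and f: "excessive pt f" and c0: "f \<in> c0_plus"
  shows "\<exists>h\<in>c0_plus. is_potential_of V h f"
proof -
  have flim: "f \<longlonglongrightarrow> 0" using c0 by (auto simp: c0_plus_def)
  define u where "u r = (\<Sum>j=1..r. coef (r - j) * f j)" for r
  define h where "h n = (\<Sum>m=1..n + k. A_matrix k p n m * f m)" for n
  have h0: "0 \<le> h n" if "1 \<le> n" for n
    unfolding h_def by (rule excessive_generator_nonneg[OF chain Q f that])
  have hu: "h n = u n - (\<Sum>l=1..k. p l * u (n + l))" if n: "1 \<le> n" for n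
  proof -
    have "h n = (\<Sum>m=1..n + k. green_inv (n + k) n m * f m)"
      unfolding h_def using n by (intro sum.cong refl) (simp add: A_matrix_eq_green_inv)
    also have "\<dots> = u n - (\<Sum>r=Suc n..n + k. pp (r - n) * u r)"
      by (rule green_inv_apply) (use n in \<open>auto simp: u_def\<close>)
    also have "(\<Sum>r=Suc n..n + k. pp (r - n) * u r) = (\<Sum>l=1..k. p l * u (n + l))"
      by (rule sum.reindex_bij_witness[where i="\<lambda>l. n + l" and j="\<lambda>r. r - n"]) (auto simp: pp_def)
    finally show ?thesis .
  qed
  have u_eq: "u r = f r - (\<Sum>l=1..k. p l * (if l < r then f (r - l) else 0))" if r: "1 \<le> r" for r
  proof -
    have "u r = (\<Sum>l=0..<r. coef l * f (r - l))"
      unfolding u_def by (rule sum.reindex_bij_witness[where i="\<lambda>l. r - l" and j="\<lambda>j. r - j"]) auto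
    also have "\<dots> = f r + (\<Sum>l=1..<r. coef l * f (r - l))"
      using r by (subst sum.atLeast_Suc_lessThan) (auto simp: coef_def)
    also have "(\<Sum>l=1..<r. coef l * f (r - l)) = - (\<Sum>l=1..<r. pp l * f (r - l))"
      unfolding sum_negf[symmetric] by (intro sum.cong) (auto simp: coef_def)
    also have "(\<Sum>l=1..<r. pp l * f (r - l)) = (\<Sum>l\<in>{1..k} \<inter> {1..<r}. p l * f (r - l))"
      by (intro sum.mono_neutral_cong_right) (auto simp: pp_def)
    also have "\<dots> = (\<Sum>l=1..k. p l * (if l < r then f (r - l) else 0))"
      by (intro sum.mono_neutral_cong_left) auto
    finally show ?thesis by simp
  qed
  have ulim: "u \<longlonglongrightarrow> 0"
  proof -
    have "(\<lambda>r. f r - (\<Sum>l=1..k. p l * (if l < r then f (r - l) else 0))) \<longlonglongrightarrow> 0 - (\<Sum>l=1..k. p l * 0)"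
    proof (intro tendsto_diff tendsto_sum tendsto_mult tendsto_const flim)
      fix l
      have "(\<lambda>r. f (r - l)) \<longlonglongrightarrow> 0" by (rule LIMSEQ_offset[where k=l]) (simp add: flim)
      then show "(\<lambda>r. if l < r then f (r - l) else 0) \<longlonglongrightarrow> 0"
      proof (rule Lim_transform_eventually)
        show "eventually (\<lambda>r. f (r - l) = (if l < r then f (r - l) else 0)) sequentially"
          using eventually_gt_at_top[of l] by eventually_elim simp
      qed
    qed
    then have "(\<lambda>r. f r - (\<Sum>l=1..k. p l * (if l < r then f (r - l) else 0))) \<longlonglongrightarrow> 0" by simp
    then show ?thesis
    proof (rule Lim_transform_eventually)
      show "eventually (\<lambda>r. f r - (\<Sum>l=1..k. p l * (if l < r then f (r - l) else 0)) = u r) sequentially"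
        unfolding eventually_sequentially using u_eq by (intro exI[of _ 1]) simp
    qed
  qed
  have "(\<lambda>n. u n - (\<Sum>l=1..k. p l * u (n + l))) \<longlonglongrightarrow> 0 - (\<Sum>l=1..k. p l * 0)"
    by (intro tendsto_diff tendsto_sum tendsto_mult tendsto_const ulim LIMSEQ_ignore_initial_segment)
  then have "(\<lambda>n. u n - (\<Sum>l=1..k. p l * u (n + l))) \<longlonglongrightarrow> 0" by simp
  then have "h \<longlonglongrightarrow> 0"
  proof (rule Lim_transform_eventually)
    show "eventually (\<lambda>n. u n - (\<Sum>l=1..k. p l * u (n + l)) = h n) sequentially"
      unfolding eventually_sequentially using hu by (intro exI[of _ 1]) simp
  qed
  with h0 have hc0: "h \<in> c0_plus" by (simp add: c0_plus_def)
  have "Bseq u" by (rule convergent_imp_Bseq[OF convergentI[OF ulim]])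
  then obtain U where "\<forall>r. norm (u r) \<le> U" unfolding Bseq_def by blast
  then have U: "\<bar>u r\<bar> \<le> U" for r by simp
  have sm: "summable \<phi>" by (rule \<phi>_summable[OF s])
  have \<phi>u: "summable (\<lambda>r. \<phi> r * u (i + r))" for i
  proof (rule summable_comparison_test)
    show "summable (\<lambda>r. \<phi> r * U)" by (rule summable_mult2[OF sm])
    show "\<exists>N. \<forall>r\<ge>N. norm (\<phi> r * u (i + r)) \<le> \<phi> r * U"
      using U \<phi>_nonneg by (auto simp: abs_mult intro!: mult_mono)
  qed
  have \<phi>h: "(\<lambda>r. \<phi> r * h (i + r)) sums u i" if i: "1 \<le> i" for i
  proof -
    \<comment> \<open>The sum of \<open>\<phi> r * h (i + r)\<close> is rearranged so that
      \<open>u (i + r)\<close> is multiplied by \<open>\<phi> r\<close> minus its renewal sum, which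
      is 0 except at \<open>r = 0\<close>. Shifting the series by \<open>l\<close> is legitimate
      since \<open>u\<close> is bounded and \<open>\<phi>\<close> is summable.\<close>
    define b where "b l r = (if l \<le> r then \<phi> (r - l) * u (i + r) else 0)" for l r
    have b: "b l sums (\<Sum>r. \<phi> r * u (i + l + r))" for l
    proof -
      have "(\<lambda>r. b l (r + l)) sums (\<Sum>r. \<phi> r * u (i + l + r))"
        using summable_sums[OF \<phi>u[of "i + l"]] by (simp add: b_def add_ac)
      then show ?thesis by (subst (asm) sums_iff_shift) (simp add: b_def)
    qed
    have "(\<lambda>r. \<phi> r * u (i + r) - (\<Sum>l=1..k. p l * (\<phi> r * u (i + l + r)))) sums
        ((\<Sum>r. \<phi> r * u (i + r)) - (\<Sum>l=1..k. p l * (\<Sum>r. \<phi> r * u (i + l + r))))"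
      by (intro sums_diff sums_sum sums_mult summable_sums \<phi>u)
    moreover have "\<phi> r * u (i + r) - (\<Sum>l=1..k. p l * (\<phi> r * u (i + l + r))) = \<phi> r * h (i + r)" for r
      using i by (simp add: hu right_diff_distrib sum_distrib_left add_ac mult_ac)
    ultimately have 1: "(\<lambda>r. \<phi> r * h (i + r)) sums
        ((\<Sum>r. \<phi> r * u (i + r)) - (\<Sum>l=1..k. p l * (\<Sum>r. \<phi> r * u (i + l + r))))" by simp
    have "(\<lambda>r. \<phi> r * u (i + r) - (\<Sum>l=1..k. p l * b l r)) sums
        ((\<Sum>r. \<phi> r * u (i + r)) - (\<Sum>l=1..k. p l * (\<Sum>r. \<phi> r * u (i + l + r))))"
      by (intro sums_diff sums_sum sums_mult summable_sums \<phi>u b)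
    moreover have "\<phi> r * u (i + r) - (\<Sum>l=1..k. p l * b l r) = (if r = 0 then u i else 0)" for r
    proof (cases "r = 0")
      case True
      then show ?thesis by (simp add: b_def sum.neutral)
    next
      case False
      have "(\<Sum>l=1..k. p l * b l r) = (\<Sum>l\<in>{1..k} \<inter> {1..r}. p l * b l r)"
        by (intro sum.mono_neutral_right) (auto simp: b_def)
      also have "\<dots> = (\<Sum>l=1..r. pp l * \<phi> (r - l)) * u (i + r)"
        unfolding sum_distrib_right by (intro sum.mono_neutral_cong_left) (auto simp: b_def pp_def)
      also have "(\<Sum>l=1..r. pp l * \<phi> (r - l)) = \<phi> r" using False by (intro \<phi>_rec[symmetric]) simp
      finally show ?thesis using False by simp
    qed
    ultimately have 2: "(\<lambda>r. if r = 0 then u i else 0) sums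
        ((\<Sum>r. \<phi> r * u (i + r)) - (\<Sum>l=1..k. p l * (\<Sum>r. \<phi> r * u (i + l + r))))" by simp
    have "(\<Sum>r. \<phi> r * u (i + r)) - (\<Sum>l=1..k. p l * (\<Sum>r. \<phi> r * u (i + l + r))) = u i"
      by (rule sums_unique2[OF 2 sums_single])
    with 1 show ?thesis by simp
  qed
  have \<Phi>h: "((\<lambda>n. \<Phi> n i * h n) has_sum u i) {1..}" if i: "1 \<le> i" for i
  proof -
    have "((\<lambda>r. \<phi> r * h (i + r)) has_sum u i) UNIV"
      by (rule sums_nonneg_imp_has_sum[OF \<phi>h[OF i]]) (use h0 i in \<open>auto intro!: mult_nonneg_nonneg \<phi>_nonneg\<close>)
    then have "((\<lambda>r. (\<lambda>n. \<phi> (n - i) * h n) (i + r)) has_sum u i) UNIV" by simp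
    moreover have "bij_betw (\<lambda>r. i + r) UNIV {i..}"
      by (rule bij_betw_byWitness[where f'="\<lambda>n. n - i"]) auto
    ultimately have "((\<lambda>n. \<phi> (n - i) * h n) has_sum u i) {i..}"
      using has_sum_reindex_bij_betw[of "\<lambda>r. i + r" UNIV "{i..}" "\<lambda>n. \<phi> (n - i) * h n"] by simp
    then show ?thesis
      by (rule has_sum_cong_neutral[THEN iffD1, rotated -1]) (use i in \<open>auto simp: \<Phi>_def\<close>)
  qed
  have "((\<lambda>n. V j n * h n) has_sum f j) {1..}" if j: "1 \<le> j" for j
  proof -
    have hs: "((\<lambda>n. \<Sum>m=1..j. \<Phi> j m * (\<Phi> n m * h n)) has_sum (\<Sum>m=1..j. \<Phi> j m * u m)) {1..}"
      by (intro has_sum_sum_finite has_sum_cmult_right \<Phi>h) auto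
    have V_eq: "(\<Sum>m=1..j. \<Phi> j m * (\<Phi> n m * h n)) = V j n * h n" if "n \<in> {1..}" for n
      using V[OF j, of n] that green_\<Phi>[of j j n] by (simp add: sum_distrib_right mult.assoc)
    have f_eq: "(\<Sum>m=1..j. \<Phi> j m * u m) = f j"
    proof -
      have um: "u m = (\<Sum>i=1..j. L m i * f i)" if "m \<in> {1..j}" for m
        unfolding u_def L_def using that by (intro sum.mono_neutral_cong_left) auto
      have "(\<Sum>m=1..j. \<Phi> j m * u m) = (\<Sum>m=1..j. \<Sum>i=1..j. \<Phi> j m * L m i * f i)"
        by (intro sum.cong refl) (simp add: um sum_distrib_left mult.assoc)
      also have "\<dots> = (\<Sum>i=1..j. (\<Sum>m=1..j. \<Phi> j m * L m i) * f i)"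
        unfolding sum_distrib_right by (rule sum.swap)
      also have "\<dots> = (\<Sum>i=1..j. (if j = i then 1 else 0) * f i)"
      proof (intro sum.cong refl)
        fix i assume "i \<in> {1..j}"
        then show "(\<Sum>m=1..j. \<Phi> j m * L m i) * f i = (if j = i then 1 else 0) * f i"
          using \<Phi>_L[of j j i] j by simp
      qed
      also have "\<dots> = f j" using j by (simp add: if_distrib[where f="\<lambda>c. c * _"] cong: if_cong)
      finally show ?thesis .
    qed
    show ?thesis
      using has_sum_cong[THEN iffD1, OF V_eq hs] unfolding f_eq .
  qed
  then show ?thesis using hc0 by (auto simp: is_potential_of_def)
qed

end

section \<open>The two limit laws\<close>

lemma frequently_subsequence:
  fixes t :: "nat \<Rightarrow> nat"
  assumes "strict_mono t" "\<exists>\<^sub>\<infinity>i. P (t i)"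
  shows "\<exists>\<^sub>F j in sequentially. P j"
proof -
  have "\<exists>n\<ge>m. P n" for m
  proof -
    obtain i where "m \<le> i" "P (t i)" using assms(2) by (auto simp: INFM_nat_le)
    then show ?thesis using seq_suble[OF assms(1), of i] by (auto intro: order_trans)
  qed
  then show ?thesis by (simp add: frequently_sequentially)
qed

lemma AE_limsup_ratio:
  fixes Z :: "nat \<Rightarrow> 'b \<Rightarrow> real" and D :: "nat \<Rightarrow> real" and c :: real
  assumes D: "eventually (\<lambda>j. 0 < D j) sequentially"
    and upper: "\<And>d. 0 < d \<Longrightarrow> AE \<omega> in M. eventually (\<lambda>j. Z j \<omega> \<le> (c + d) * D j) sequentially"
    and lower: "\<And>\<delta>. 0 < \<delta> \<Longrightarrow> \<delta> < 1 \<Longrightarrow>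
      \<exists>t::nat \<Rightarrow> nat. strict_mono t \<and> (AE \<omega> in M. \<exists>\<^sub>\<infinity>i. (1 - \<delta>) * c * D (t i) < Z (t i) \<omega>)"
  shows "AE \<omega> in M. limsup (\<lambda>j. ereal (Z j \<omega> / D j)) = ereal c"
proof -
  \<comment> \<open>Countably many tolerances allow the exceptional null sets to be united; the
    double \<open>Suc\<close> keeps every \<open>e n\<close> below one, as \<open>lower\<close>
    demands.\<close>
  define e :: "nat \<Rightarrow> real" where "e n = inverse (real (Suc (Suc n)))" for n
  have e: "0 < e n" "e n < 1" for n by (auto simp: e_def field_simps)
  have e0: "e \<longlonglongrightarrow> 0"
    unfolding e_def using LIMSEQ_Suc[OF LIMSEQ_inverse_real_of_nat] by simp
  have up: "AE \<omega> in M. \<forall>n. eventually (\<lambda>j. Z j \<omega> \<le> (c + e n) * D j) sequentially"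
    using upper e by (simp add: AE_all_countable)
  have lo: "AE \<omega> in M. \<forall>n. \<exists>\<^sub>F j in sequentially. (1 - e n) * c * D j < Z j \<omega>"
  proof (subst AE_all_countable, intro allI)
    fix n
    obtain t :: "nat \<Rightarrow> nat" where t: "strict_mono t" "AE \<omega> in M. \<exists>\<^sub>\<infinity>i. (1 - e n) * c * D (t i) < Z (t i) \<omega>"
      using lower[OF e(1)[of n] e(2)[of n]] by blast
    from t(2) show "AE \<omega> in M. \<exists>\<^sub>F j in sequentially. (1 - e n) * c * D j < Z j \<omega>"
    proof eventually_elim
      case (elim \<omega>)
      show ?case by (rule frequently_subsequence[OF t(1)]) (rule elim)
    qed
  qed
  from up lo show ?thesis
  proof eventually_elim
    case (elim \<omega>)
    let ?l = "limsup (\<lambda>j. ereal (Z j \<omega> / D j))"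
    have "?l \<le> ereal (c + e n)" for n
    proof (rule Limsup_bounded)
      from elim(1) have "eventually (\<lambda>j. Z j \<omega> \<le> (c + e n) * D j) sequentially" by blast
      with D show "eventually (\<lambda>j. ereal (Z j \<omega> / D j) \<le> ereal (c + e n)) sequentially"
        by eventually_elim (simp add: pos_divide_le_eq)
    qed
    moreover have "(\<lambda>n. ereal (c + e n)) \<longlonglongrightarrow> ereal (c + 0)"
      unfolding lim_ereal by (intro tendsto_intros e0)
    ultimately have A: "?l \<le> ereal (c + 0)"
      by (intro LIMSEQ_le_const[of "\<lambda>n. ereal (c + e n)"]) auto
    have "ereal ((1 - e n) * c) \<le> ?l" for n
    proof (rule ccontr)
      assume "\<not> ereal ((1 - e n) * c) \<le> ?l"
      then have "eventually (\<lambda>j. ereal (Z j \<omega> / D j) < ereal ((1 - e n) * c)) sequentially"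
        by (intro Limsup_lessD) simp
      with D have "eventually (\<lambda>j. \<not> (1 - e n) * c * D j < Z j \<omega>) sequentially"
        by eventually_elim (simp add: pos_divide_less_eq)
      moreover have "\<exists>\<^sub>F j in sequentially. (1 - e n) * c * D j < Z j \<omega>" using elim(2) by blast
      ultimately show False by (simp add: frequently_def)
    qed
    moreover have "(\<lambda>n. ereal ((1 - e n) * c)) \<longlonglongrightarrow> ereal ((1 - 0) * c)"
      unfolding lim_ereal by (intro tendsto_intros e0)
    ultimately have B: "ereal ((1 - 0) * c) \<le> ?l"
      by (intro LIMSEQ_le_const2[of "\<lambda>n. ereal ((1 - e n) * c)"]) auto
    from A B show "?l = ereal c" by (simp add: antisym)
  qed
qed

text \<open>The terms are \<open>(\<rho> * i) powr (- (1 - \<delta>))\<close> over a logarithm,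
  eventually larger than the harmonic ones: the room left by \<open>\<delta>\<close> pays for the
  logarithm. One lemma covers both laws, with \<open>\<rho>\<close> the step of the arithmetic
  progression or the logarithm of the ratio of the geometric one.\<close>

lemma not_summable_exp_neg_ln:
  fixes \<rho> \<delta> :: real
  assumes "0 < \<rho>" "0 < \<delta>" "\<delta> < 1"
  shows "\<not> summable (\<lambda>i. exp (- ((1 - \<delta>) * ln (\<rho> * real (Suc i)))) / ((1 - \<delta>) * ln (\<rho> * real (Suc i)) + 1))"
    (is "\<not> summable ?a")
proof
  assume "summable ?a"
  moreover have "eventually (\<lambda>i. norm (inverse (real (Suc i))) \<le> ?a i) sequentially"
  proof -
    have "filterlim (\<lambda>i. ?a i * real (Suc i)) at_top sequentially"
      using assms by real_asymp
    then have "eventually (\<lambda>i. 1 \<le> ?a i * real (Suc i)) sequentially"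
      by (simp only: filterlim_at_top)
    then show ?thesis by eventually_elim (simp add: field_simps)
  qed
  ultimately have "summable (\<lambda>i. inverse (real (Suc i)))"
    by (rule summable_comparison_test_ev[rotated])
  then show False using not_summable_harmonic[where 'a=real] by (simp only: summable_Suc_iff[of "\<lambda>i. inverse (real i)"] not_True_eq_False)
qed

context autoregression
begin

text \<open>A maximum principle: the inverse of the restriction of \<open>green\<close> to two points is an
  M-matrix with non-negative row sums.\<close>

lemma green_le_diag:
  assumes i: "1 \<le> i" and j: "1 \<le> j"
  shows "green i j \<le> green i i"
proof (cases "i = j")
  case False
  define n where "n = max i j"
  have off: "green_inv n a b \<le> 0" if "a \<in> {1..n}" "b \<in> {1..n}" "a \<noteq> b" for a b
    using that green_inv_nonpos[of a n b] green_inv_nonpos[of b n a] green_inv_sym[of n a b]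
    by (cases "a < b") auto
  have diag: "0 < green a a" if "a \<in> {1..n}" for a using green_diag_ge_1[of a] that by simp
  have T: "{i, j} \<subseteq> {1..n}" using i j by (auto simp: n_def)
  obtain B where B: "left_inverse_on {i, j} B green" "\<And>a b. B a b = B b a"
    and B0: "\<And>a b. a \<in> {i, j} \<Longrightarrow> b \<in> {i, j} \<Longrightarrow> a \<noteq> b \<Longrightarrow> B a b \<le> 0"
    and Bu: "\<And>u. (\<forall>i\<in>{1..n}. 0 \<le> (\<Sum>j\<in>{1..n}. green_inv n i j * u j)) \<Longrightarrow>
      \<forall>a\<in>{i, j}. 0 \<le> (\<Sum>b\<in>{i, j}. B a b * u b)"
    using mmatrix_restrict[OF finite_atLeastAtMost T left_inverse_green green_inv_sym off green_nonneg diag] by blast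
  have pos: "0 < B j j"
    by (rule mmatrix_inverse_diag_pos[OF _ B(1) B0 green_nonneg]) (use T diag in auto)
  have "\<forall>a\<in>{i, j}. 0 \<le> (\<Sum>b\<in>{i, j}. B a b * 1)"
    by (rule Bu[of "\<lambda>_. 1"]) (use green_inv_one in blast)
  then have row: "0 \<le> B j i + B j j" using False by simp
  have "(\<Sum>b\<in>{i, j}. B j b * green b i) = (if j = i then 1 else 0)"
    using B(1) unfolding left_inverse_on_def by blast
  then have "B j i * green i i + B j j * green j i = 0" using False by simp
  then have "B j j * green j i = (- B j i) * green i i" by simp
  also have "\<dots> \<le> B j j * green i i"
    using row green_nonneg[of i i] by (intro mult_right_mono) auto
  finally show ?thesis using pos by (simp add: green_sym[of i j])
qed simp

section \<open>The law at the logarithmic scale\<close>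

lemma permanental_limsup_subcritical:
  fixes Z :: "nat \<Rightarrow> 'b \<Rightarrow> real"
  assumes s: "(\<Sum>l=1..k. p l) < 1"
    and V: "\<And>i j. 1 \<le> i \<Longrightarrow> 1 \<le> j \<Longrightarrow> V i j = green i j"
    and f: "f \<in> c0_plus" "potential_half u f"
    and perm: "permanental_sequence a (\<lambda>i j. V i j + f j) M Z" and a: "a > 0"
  shows "AE \<omega> in M. limsup (\<lambda>j. ereal (Z j \<omega> / ln (real j))) = ereal (\<Sum>n. (\<phi> n)\<^sup>2)"
proof (rule AE_limsup_ratio)
  define c where "c = (\<Sum>n. (\<phi> n)\<^sup>2)"
  have c: "1 \<le> c" using \<phi>_square_norm_bounds(1)[OF s] zero_le_power2[of "p 1"] unfolding c_def by linarith
  have f0: "0 \<le> f j" if "1 \<le> j" for j using f(1) that by (simp add: c0_plus_def)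
  show "eventually (\<lambda>j. 0 < ln (real j)) sequentially" by real_asymp
  show "AE \<omega> in M. eventually (\<lambda>j. Z j \<omega> \<le> ((\<Sum>n. (\<phi> n)\<^sup>2) + d) * ln (real j)) sequentially"
    if d: "0 < d" for d
  proof (rule permanental_upper_log[OF perm a _ _ d])
    show "0 < V j j + f j" if "1 \<le> j" for j
      using green_diag_ge_1[OF that] f0[OF that] V[OF that that] by simp
    have "(\<lambda>j. green j j + f j) \<longlonglongrightarrow> c + 0"
      using f(1) green_diag_tendsto[OF s] by (intro tendsto_add) (auto simp: c0_plus_def c_def)
    then have "(\<lambda>j. green j j + f j) \<longlonglongrightarrow> (\<Sum>n. (\<phi> n)\<^sup>2)" by (simp add: c_def)
    moreover have "eventually (\<lambda>j. green j j + f j = V j j + f j) sequentially"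
      using eventually_ge_at_top[of 1] by eventually_elim (simp add: V)
    ultimately show "(\<lambda>j. V j j + f j) \<longlonglongrightarrow> (\<Sum>n. (\<phi> n)\<^sup>2)"
      by (rule Lim_transform_eventually)
    show "0 \<le> (\<Sum>n. (\<phi> n)\<^sup>2)" using c by (simp add: c_def)
  qed
  show "\<exists>t::nat \<Rightarrow> nat. strict_mono t \<and> (AE \<omega> in M. \<exists>\<^sub>\<infinity>i. (1 - \<delta>) * (\<Sum>n. (\<phi> n)\<^sup>2) * ln (real (t i)) < Z (t i) \<omega>)"
    if \<delta>: "0 < \<delta>" "\<delta> < 1" for \<delta> :: real
  proof -
    \<comment> \<open>Spent twice, on the off-diagonal entries and on the distance of the diagonal
      from \<open>c\<close>, so that \<open>c - 2 * \<eta> = (1 - \<delta> / 2) * c\<close>.\<close>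
    define \<eta> where "\<eta> = c * \<delta> / 4"
    have \<eta>: "0 < \<eta>" using c \<delta> by (simp add: \<eta>_def)
    obtain r0 where r0: "\<And>i j. i + r0 \<le> j \<Longrightarrow> green i j \<le> \<eta>"
      using green_offdiag_small[OF s \<eta>] by blast
    define r where "r = Suc r0"
    define t where "t i = r * Suc i" for i
    have "0 < r" by (simp add: r_def)
    then have t_mono: "strict_mono t" by (intro strict_monoI) (simp add: t_def)
    have t1: "Suc 0 \<le> t i" for i by (simp add: t_def r_def)
    \<comment> \<open>The other half of \<open>\<delta>\<close> is kept for the divergence of the
      series; the two halves combine through
      \<open>1 - \<delta> \<le> (1 - \<delta> / 2) * (1 - \<delta> / 2)\<close>.\<close>
    define x where "x i = (1 - \<delta> / 2) * ln (real (t i))" for i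
    have x_eq: "x i = (1 - \<delta> / 2) * ln (real r * real (Suc i))" for i
      by (simp only: x_def t_def of_nat_mult)
    have t_top: "filterlim t at_top sequentially" by (rule filterlim_subseq[OF t_mono])
    have "filterlim x at_top sequentially"
      unfolding x_eq using \<delta> by (simp only: r_def) real_asymp
    then have "eventually (\<lambda>i. 1 \<le> x i) sequentially" by (simp only: filterlim_at_top)
    moreover have "eventually (\<lambda>i. c - \<eta> < green (t i) (t i)) sequentially"
    proof -
      have "(\<lambda>i. green (t i) (t i)) \<longlonglongrightarrow> c"
        using filterlim_compose[OF green_diag_tendsto[OF s] t_top] by (simp add: c_def)
      then show ?thesis by (rule order_tendstoD) (use \<eta> in simp)
    qed
    ultimately have "eventually (\<lambda>i. 1 \<le> x i \<and> c - \<eta> < green (t i) (t i)) sequentially"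
      by (rule eventually_conj)
    then obtain m where m: "\<And>i. m \<le> i \<Longrightarrow> 1 \<le> x i" "\<And>i. m \<le> i \<Longrightarrow> c - \<eta> < green (t i) (t i)"
      by (auto simp: eventually_sequentially)
    have sep: "green (t j) (t i) \<le> \<eta>" if "j \<noteq> i" for i j
    proof -
      have *: "green (t a) (t b) \<le> \<eta>" if "a < b" for a b
      proof (rule r0)
        have "t a + r \<le> t b" using that mult_le_mono2[of "Suc (Suc a)" "Suc b" r] by (simp add: t_def)
        then show "t a + r0 \<le> t b" by (simp add: r_def)
      qed
      show ?thesis using that *[of i j] *[of j i] green_sym[of "t i" "t j"] by (cases "i < j") auto
    qed
    have "AE \<omega> in M. \<exists>\<^sub>\<infinity>i. (1 - \<delta>) * c * ln (real (t i)) < Z (t i) \<omega>"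
    proof (rule permanental_infinitely_often[OF perm a V f(2) f0 t_mono t1, where m = m and x = x
          and \<eta> = "\<lambda>_. \<eta>" and \<kappa> = "\<lambda>_. 0"])
      show "1 \<le> x i" if "m \<le> i" for i by (rule m(1)[OF that])
      show "green (t j) (t i) \<le> \<eta> + 0 * green (t j) (t N)" if "j \<noteq> i" for i j N
        using sep[OF that] by simp
      show "(1 - \<delta>) * c * ln (real (t i)) \<le> x i * (green (t i) (t i) - \<eta> - 0 * green (t i) (t N))"
        if "m \<le> i" for i N
      proof -
        have l0: "0 \<le> ln (real (t i))" using t1[of i] by simp
        have "(1 - \<delta>) * c * ln (real (t i)) \<le> ((1 - \<delta> / 2) * (1 - \<delta> / 2)) * c * ln (real (t i))"
        proof -
          have "1 - \<delta> \<le> (1 - \<delta> / 2) * (1 - \<delta> / 2)"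
            using zero_le_square[of \<delta>] by (simp add: field_simps)
          then show ?thesis using l0 c by (intro mult_right_mono) auto
        qed
        also have "\<dots> = x i * (c - 2 * \<eta>)" by (simp add: x_def \<eta>_def field_simps)
        also have "\<dots> \<le> x i * (green (t i) (t i) - \<eta>)"
          using m(1,2)[OF that] by (intro mult_left_mono) auto
        finally show ?thesis by simp
      qed
      show "\<not> summable (\<lambda>i. exp (- x i) / (x i + 1))"
        unfolding x_eq using \<delta> by (intro not_summable_exp_neg_ln) (auto simp: r_def)
    qed (use \<eta> in auto)
    then show ?thesis using t_mono unfolding c_def by blast
  qed
qed

section \<open>The law of the iterated logarithm\<close>

lemma green_lipschitz:
  assumes "\<And>j n. \<bar>green (Suc j) n - green j n\<bar> \<le> C"
  shows "\<bar>green (j + d) n - green j n\<bar> \<le> C * real d"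
proof (induction d)
  case (Suc d)
  then show ?case using assms[of "j + d" n] by (simp add: algebra_simps)
qed simp

text \<open>\<open>H\<close> is the sum of \<open>h\<close>. For the sublinear growth
  \<open>h\<close> is split: its first \<open>N\<close> terms contribute at most
  \<open>N * H\<close>, by the bound of \<open>green\<close> through its smaller index, and the rest
  at most \<open>j\<close> times a small tail sum. The Lipschitz bound passes through the series
  termwise.\<close>

lemma potential_l1_growth:
  assumes V: "\<And>i j. 1 \<le> i \<Longrightarrow> 1 \<le> j \<Longrightarrow> V i j = green i j"
    and h: "h \<in> l1_plus" and pot: "is_potential_of V h f"
    and C: "\<And>j n. \<bar>green (Suc j) n - green j n\<bar> \<le> C"
  shows "\<exists>H\<ge>0. (\<forall>j\<ge>1. f j \<le> real j * H \<and> \<bar>f (Suc j) - f j\<bar> \<le> C * H)"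
    and "(\<lambda>j. f j / real j) \<longlonglongrightarrow> 0"
proof -
  have h0: "0 \<le> h (Suc n)" for n using h by (simp add: l1_plus_def)
  have shift: "(\<lambda>n. g (Suc n)) sums S" if "(g has_sum S) {1..}" for g :: "nat \<Rightarrow> real" and S
  proof -
    have "range Suc = {1..}" by (auto simp: image_iff Suc_le_eq gr0_conv_Suc)
    then have "((g \<circ> Suc) has_sum S) UNIV"
      using that has_sum_reindex[of Suc UNIV g S] by simp
    then show ?thesis by (auto dest: has_sum_imp_sums simp: o_def)
  qed
  obtain H where "(h has_sum H) {1..}" using h by (auto simp: l1_plus_def summable_on_def)
  then have H: "(\<lambda>n. h (Suc n)) sums H" by (rule shift)
  have H0: "0 \<le> H" using sums_le[OF _ sums_zero H] h0 by blast
  have fs: "(\<lambda>n. green j (Suc n) * h (Suc n)) sums f j" if "1 \<le> j" for j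
  proof -
    have "((\<lambda>n. V j n * h n) has_sum f j) {1..}" using pot that by (simp add: is_potential_of_def)
    from shift[OF this] show ?thesis using V[OF that] by simp
  qed
  have f0: "0 \<le> f j" if "1 \<le> j" for j
    using sums_le[OF _ sums_zero fs[OF that]] h0 green_nonneg by (meson mult_nonneg_nonneg)
  have f1: "f j \<le> real j * H" if "1 \<le> j" for j
  proof (rule sums_le[OF _ fs[OF that] sums_mult[OF H]])
    fix n
    have "green j (Suc n) \<le> real j" using green_le_min[of j "Suc n"] by linarith
    then show "green j (Suc n) * h (Suc n) \<le> real j * h (Suc n)" by (rule mult_right_mono[OF _ h0])
  qed
  have f2: "\<bar>f (Suc j) - f j\<bar> \<le> C * H" if j: "1 \<le> j" for j
  proof -
    have D: "(\<lambda>n. (green (Suc j) (Suc n) - green j (Suc n)) * h (Suc n)) sums (f (Suc j) - f j)"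
      using sums_diff[OF fs[of "Suc j"] fs[OF j]] by (simp add: algebra_simps)
    have *: "\<bar>green (Suc j) (Suc n) - green j (Suc n)\<bar> * h (Suc n) \<le> C * h (Suc n)" for n
      by (rule mult_right_mono[OF C h0])
    have "f (Suc j) - f j \<le> C * H"
    proof (rule sums_le[OF _ D sums_mult[OF H]])
      fix n show "(green (Suc j) (Suc n) - green j (Suc n)) * h (Suc n) \<le> C * h (Suc n)"
        using C[of j "Suc n"] by (intro mult_right_mono[OF _ h0]) linarith
    qed
    moreover have "- (C * H) \<le> f (Suc j) - f j"
    proof (rule sums_le[OF _ sums_minus[OF sums_mult[OF H]] D])
      fix n
      have "(- C) * h (Suc n) \<le> (green (Suc j) (Suc n) - green j (Suc n)) * h (Suc n)"
        using C[of j "Suc n"] by (intro mult_right_mono[OF _ h0]) linarith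
      then show "- (C * h (Suc n)) \<le> (green (Suc j) (Suc n) - green j (Suc n)) * h (Suc n)" by simp
    qed
    ultimately show ?thesis by linarith
  qed
  show "\<exists>H\<ge>0. (\<forall>j\<ge>1. f j \<le> real j * H \<and> \<bar>f (Suc j) - f j\<bar> \<le> C * H)"
    using H0 f1 f2 by blast
  show "(\<lambda>j. f j / real j) \<longlonglongrightarrow> 0"
  proof (rule tendstoI)
    fix e :: real assume e: "0 < e"
    have "(\<lambda>N. \<Sum>n<N. h (Suc n)) \<longlonglongrightarrow> H" using H by (simp add: sums_def)
    then have "eventually (\<lambda>N. H - e / 2 < (\<Sum>n<N. h (Suc n))) sequentially"
      by (rule order_tendstoD) (use e in simp)
    then obtain N where N: "H - e / 2 < (\<Sum>n<N. h (Suc n))" by (auto simp: eventually_sequentially)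
    have T: "(\<lambda>n. h (Suc n) - (if n \<in> {..<N} then h (Suc n) else 0)) sums (H - (\<Sum>n<N. h (Suc n)))"
      by (intro sums_diff H sums_If_finite_set) simp
    have bound: "f j \<le> real N * H + real j * (e / 2)" if j: "1 \<le> j" for j
    proof -
      have "f j \<le> real N * H + real j * (H - (\<Sum>n<N. h (Suc n)))"
      proof (rule sums_le[OF _ fs[OF j] sums_add[OF sums_mult[OF H] sums_mult[OF T]]])
        fix n
        show "green j (Suc n) * h (Suc n) \<le> real N * h (Suc n) +
          real j * (h (Suc n) - (if n \<in> {..<N} then h (Suc n) else 0))"
        proof (cases "n < N")
          case True
          have "green j (Suc n) \<le> real N" using green_le_min[of j "Suc n"] True by linarith
          then show ?thesis using True by (simp add: mult_right_mono[OF _ h0])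
        next
          case False
          have "green j (Suc n) \<le> real j" using green_le_min[of j "Suc n"] by linarith
          then have "green j (Suc n) * h (Suc n) \<le> real j * h (Suc n)" by (rule mult_right_mono[OF _ h0])
          moreover have "0 \<le> real N * h (Suc n)" using h0[of n] by simp
          ultimately show ?thesis using False by simp
        qed
      qed
      also have "\<dots> \<le> real N * H + real j * (e / 2)"
        using N by (intro add_left_mono mult_left_mono) auto
      finally show ?thesis .
    qed
    have "(\<lambda>j. real N * H / real j) \<longlonglongrightarrow> 0" by (rule lim_const_over_n)
    then have "eventually (\<lambda>j. real N * H / real j < e / 2) sequentially"
      by (rule order_tendstoD) (use e in simp)
    with eventually_ge_at_top[of 1] show "eventually (\<lambda>j. dist (f j / real j) 0 < e) sequentially"
    proof eventually_elim
      case (elim j)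
      have "f j / real j \<le> (real N * H + real j * (e / 2)) / real j"
        using bound[OF elim(1)] by (rule divide_right_mono) simp
      also have "\<dots> = real N * H / real j + e / 2" using elim(1) by (simp add: add_divide_distrib)
      also have "\<dots> < e" using elim(2) by linarith
      finally show ?case using f0[OF elim(1)] by simp
    qed
  qed
qed

text \<open>The chaining requires 2 by 2 minors at \<open>j\<close> and \<open>j + d\<close> of
  order \<open>j * d\<close>. The maximum principle and the Lipschitz bound provide this for
  \<open>green\<close>; \<open>f\<close> grows at most linearly, so it only enlarges the constant,
  and \<open>f j / real j\<close> tends to 0, so the limit of the diagonal is unaffected.\<close>

lemma permanental_upper_critical:
  fixes Z :: "nat \<Rightarrow> 'b \<Rightarrow> real"
  assumes s: "(\<Sum>l=1..k. p l) = 1"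
    and V: "\<And>i j. 1 \<le> i \<Longrightarrow> 1 \<le> j \<Longrightarrow> V i j = green i j"
    and h: "h \<in> l1_plus" and pot: "is_potential_of V h f" and f0: "\<And>j. 1 \<le> j \<Longrightarrow> 0 \<le> f j"
    and perm: "permanental_sequence a (\<lambda>i j. V i j + f j) M Z" and a: "a > 0"
    and \<epsilon>: "0 < \<epsilon>" "\<epsilon> \<le> 1"
  shows "AE \<omega> in M. eventually (\<lambda>j. Z j \<omega> \<le>
    exp (3 * \<epsilon>) * ((1 + \<epsilon>) * (1 / \<mu>\<^sup>2 + \<epsilon>) + 3 * \<epsilon>) * (1 + \<epsilon>) * (real j * ln (ln (real j)))) sequentially"
proof -
  obtain C where C: "\<And>j. \<bar>green j j - real j / \<mu>\<^sup>2\<bar> \<le> C" "\<And>j n. \<bar>green (Suc j) n - green j n\<bar> \<le> C"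
    using green_critical[OF s] by blast
  have C0: "0 \<le> C" using C(1)[of 0] by linarith
  obtain c where c: "0 < c" "\<And>i j. c * real (min i j) \<le> green i j"
    using green_critical_lower[OF s] by blast
  obtain H where H: "0 \<le> H" "\<And>j. 1 \<le> j \<Longrightarrow> f j \<le> real j * H"
    and fL: "\<And>j. 1 \<le> j \<Longrightarrow> \<bar>f (Suc j) - f j\<bar> \<le> C * H"
    using potential_l1_growth(1)[OF V h pot C(2)] by blast
  have fD: "\<bar>f (j + d) - f j\<bar> \<le> C * H * real d" if "1 \<le> j" for j d
  proof (induction d)
    case (Suc d)
    then show ?case using fL[of "j + d"] that by (simp add: algebra_simps)
  qed simp
  have G1: "\<bar>green (j + d) n - green j n\<bar> \<le> C * real d" for j d n
    by (rule green_lipschitz[OF C(2)])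
  have G2: "\<bar>green n (j + d) - green n j\<bar> \<le> C * real d" for j d n
    using G1[of j d n] by (simp add: green_sym)
  \<comment> \<open>The Green part of the minor contributes \<open>2 * C\<close>, the two terms with
    \<open>f\<close> contribute \<open>H * C\<close> and \<open>2 * H * C\<close>, since
    \<open>f (j + d) \<le> 2 * real j * H\<close>; the summand 1 ensures positivity.\<close>
  define C' where "C' = 2 * C + 3 * (H * C) + 1"
  have HC: "0 \<le> H * C" using H(1) C0 by simp
  have C'0: "0 < C'" using HC C0 by (simp add: C'_def)
  have disc: "0 \<le> D \<and> D \<le> C' * real j * real d"
    if j: "1 \<le> j" "1 \<le> d" "d \<le> j" and D: "D = (V (j + d) (j + d) + f (j + d)) * (V j j + f j) -
      (V (j + d) j + f j) * (V j (j + d) + f (j + d))" for j d D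
  proof -
    let ?i = "j + d"
    have i: "1 \<le> ?i" using j by simp
    define v w x where "v = green ?i ?i" and "w = green j j" and "x = green ?i j"
    \<comment> \<open>The product of the two values of \<open>f\<close> cancels in the minor, and
      \<open>v * w - x * x\<close> is split by inserting \<open>x * w\<close>. Every summand then
      has a factor \<open>v - x\<close> or \<open>w - x\<close>, which is non-negative and of order
      \<open>d\<close>.\<close>
    have D': "D = ((v - x) * w + x * (w - x)) + f j * (v - x) + f ?i * (w - x)"
    proof -
      have "D = (v + f ?i) * (w + f j) - (x + f j) * (x + f ?i)"
        unfolding D V[OF i i] V[OF i j(1)] V[OF j(1) i] V[OF j(1) j(1)] v_def w_def x_def green_sym[of j ?i] ..
      then show ?thesis by (simp add: algebra_simps)
    qed
    have vx: "0 \<le> v - x" "v - x \<le> C * real d"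
      using green_le_diag[OF i j(1)] G2[of ?i j d] by (auto simp: v_def x_def)
    have wx: "0 \<le> w - x" "w - x \<le> C * real d"
      using green_le_diag[OF j(1) i] G1[of j d j] green_sym[of j ?i] by (auto simp: w_def x_def)
    have w: "0 \<le> w" "w \<le> real j" using green_nonneg green_le_min[of j j] by (auto simp: w_def)
    have x: "0 \<le> x" "x \<le> real j" using green_nonneg wx w by (auto simp: x_def)
    have fi: "0 \<le> f ?i" "f ?i \<le> 2 * real j * H"
    proof -
      show "0 \<le> f ?i" by (rule f0[OF i])
      have "f ?i \<le> real ?i * H" by (rule H(2)[OF i])
      also have "\<dots> \<le> 2 * real j * H" using j H(1) by (intro mult_right_mono) auto
      finally show "f ?i \<le> 2 * real j * H" .
    qed
    have "0 \<le> D" unfolding D' using vx wx w x fi f0[OF j(1)] by (intro add_nonneg_nonneg mult_nonneg_nonneg)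
    moreover have "D \<le> ((C * real d) * real j + real j * (C * real d)) + (real j * H) * (C * real d) + (2 * real j * H) * (C * real d)"
      unfolding D' using vx wx w x fi f0[OF j(1)] H(2)[OF j(1)] H(1) C0
      by (intro add_mono mult_mono) auto
    moreover have "\<dots> \<le> C' * real j * real d"
      using mult_nonneg_nonneg[of "real j" "real d"] by (simp add: C'_def algebra_simps)
    ultimately show ?thesis by linarith
  qed
  show ?thesis
  proof (rule permanental_upper_loglog[OF perm a c(1) C'0])
    fix j :: nat assume j: "1 \<le> j"
    show "c * real j \<le> V j j + f j" using c(2)[of j j] f0[OF j] V[OF j j] by simp
  next
    fix j d :: nat assume j: "1 \<le> j" "1 \<le> d" "d \<le> j"
    have i: "1 \<le> j + d" using j by simp
    have "green (j + d) (j + d) \<le> green j j + 2 * (C * real d)"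
      using G1[of j d "j + d"] G2[of j j d] by linarith
    moreover have "f (j + d) \<le> f j + C * H * real d" using fD[OF j(1), of d] by linarith
    moreover have "2 * (C * real d) + C * H * real d \<le> C' * real d"
      using mult_nonneg_nonneg[OF HC, of "real d"] by (simp add: C'_def algebra_simps)
    ultimately show "V (j + d) (j + d) + f (j + d) \<le> V j j + f j + C' * real d"
      unfolding V[OF i i] V[OF j(1) j(1)] by linarith
    show "0 \<le> (V (j + d) (j + d) + f (j + d)) * (V j j + f j) -
      (V (j + d) j + f j) * (V j (j + d) + f (j + d))"
      using disc[OF j refl] by blast
    show "(V (j + d) (j + d) + f (j + d)) * (V j j + f j) -
      (V (j + d) j + f j) * (V j (j + d) + f (j + d)) \<le> C' * real j * real d"
      using disc[OF j refl] by blast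
  next
    have "(\<lambda>j. green j j / real j) \<longlonglongrightarrow> 1 / \<mu>\<^sup>2"
    proof (rule tendsto_sandwich[of "\<lambda>j. 1 / \<mu>\<^sup>2 - C / real j" _ _ "\<lambda>j. 1 / \<mu>\<^sup>2 + C / real j"])
      show "(\<lambda>j. 1 / \<mu>\<^sup>2 - C / real j) \<longlonglongrightarrow> 1 / \<mu>\<^sup>2"
        by (auto intro!: tendsto_eq_intros lim_const_over_n)
      show "(\<lambda>j. 1 / \<mu>\<^sup>2 + C / real j) \<longlonglongrightarrow> 1 / \<mu>\<^sup>2"
        by (auto intro!: tendsto_eq_intros lim_const_over_n)
      have *: "1 / \<mu>\<^sup>2 - C / real j \<le> green j j / real j \<and> green j j / real j \<le> 1 / \<mu>\<^sup>2 + C / real j"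
        if j: "1 \<le> j" for j
      proof -
        have "(real j / \<mu>\<^sup>2 - C) / real j \<le> green j j / real j" "green j j / real j \<le> (real j / \<mu>\<^sup>2 + C) / real j"
          using C(1)[of j] by (auto intro!: divide_right_mono)
        then show ?thesis using j by (simp add: add_divide_distrib diff_divide_distrib)
      qed
      show "eventually (\<lambda>j. 1 / \<mu>\<^sup>2 - C / real j \<le> green j j / real j) sequentially"
        using eventually_ge_at_top[of 1] by eventually_elim (use * in blast)
      show "eventually (\<lambda>j. green j j / real j \<le> 1 / \<mu>\<^sup>2 + C / real j) sequentially"
        using eventually_ge_at_top[of 1] by eventually_elim (use * in blast)
    qed
    from tendsto_add[OF this potential_l1_growth(2)[OF V h pot C(2)]]
    have "(\<lambda>j. green j j / real j + f j / real j) \<longlonglongrightarrow> 1 / \<mu>\<^sup>2" by simp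
    moreover have "eventually (\<lambda>j. green j j / real j + f j / real j = (V j j + f j) / real j) sequentially"
      using eventually_ge_at_top[of 1] by eventually_elim (simp add: V add_divide_distrib)
    ultimately show "(\<lambda>j. (V j j + f j) / real j) \<longlonglongrightarrow> 1 / \<mu>\<^sup>2"
      by (rule Lim_transform_eventually)
  qed (use \<epsilon> in auto)
qed

text \<open>Along a geometric progression the diagonal grows by the factor \<open>r\<close>, so the
  influence of neighbouring points is of relative order \<open>1 / r\<close>; since
  \<open>ln (ln (t i))\<close> grows like \<open>ln i\<close>, the subsequence is still dense enough
  for divergence.\<close>

lemma permanental_lower_critical:
  fixes Z :: "nat \<Rightarrow> 'b \<Rightarrow> real"
  assumes s: "(\<Sum>l=1..k. p l) = 1"
    and V: "\<And>i j. 1 \<le> i \<Longrightarrow> 1 \<le> j \<Longrightarrow> V i j = green i j"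
    and f: "potential_half u f"
    and perm: "permanental_sequence a (\<lambda>i j. V i j + f j) M Z" and a: "a > 0"
    and \<delta>: "0 < \<delta>" "\<delta> < 1"
  shows "\<exists>t::nat \<Rightarrow> nat. strict_mono t \<and>
    (AE \<omega> in M. \<exists>\<^sub>\<infinity>i. (1 - \<delta>) * (1 / \<mu>\<^sup>2) * (real (t i) * ln (ln (real (t i)))) < Z (t i) \<omega>)"
proof -
  define c where "c = 1 / \<mu>\<^sup>2"
  have "1 \<le> \<mu>" using \<phi>_geometric[OF s] by blast
  then have c: "0 < c" by (simp add: c_def)
  obtain C where C: "\<And>j. \<bar>green j j - real j / \<mu>\<^sup>2\<bar> \<le> C" using green_critical[OF s] by blast
  have C0: "0 \<le> C" using C[of 0] by linarith
  obtain c0 where c0: "0 < c0" "\<And>i j. c0 * real (min i j) \<le> green i j"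
    using green_critical_lower[OF s] by blast
  \<comment> \<open>Three losses are measured in units of \<open>t i / r\<close>: \<open>C\<close>
    from the diagonal, 1 from the constant and \<open>1 / c0\<close> from the comparison column.
    Together they must stay below \<open>\<delta> / 2 * c * t i\<close>.\<close>
  obtain r where r: "max 3 ((C + 1 + 1 / c0) * 2 / (\<delta> * c)) < real r" using reals_Archimedean2 by blast
  then have r3: "3 < real r" and "(C + 1 + 1 / c0) * 2 / (\<delta> * c) < real r" by auto
  then have rC: "(C + 1 + 1 / c0) * 2 < real r * (\<delta> * c)"
    using \<delta> c by (simp add: pos_divide_less_eq)
  have r0: "1 < r" using r3 by linarith
  define t where "t i = r ^ Suc i" for i
  have t_mono: "strict_mono t" using r0 by (intro strict_monoI) (simp add: t_def)
  have t_r: "r \<le> t i" for i using r0 by (simp add: t_def)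
  have t1: "Suc 0 \<le> t i" for i using t_r[of i] r0 by linarith
  have t_step: "real (t i) * real r \<le> real (t j)" if "i < j" for i j
  proof -
    have "t (Suc i) \<le> t j" using that t_mono by (simp add: strict_mono_less_eq)
    moreover have "t (Suc i) = t i * r" by (simp add: t_def)
    ultimately show ?thesis by (metis of_nat_le_iff of_nat_mult)
  qed
  have lnr: "0 < ln (real r)" using r3 by simp
  define x where "x i = (1 - \<delta> / 2) * ln (ln (real (t i)))" for i
  have x_eq: "x i = (1 - \<delta> / 2) * ln (ln (real r) * real (Suc i))" for i
  proof -
    have "ln (real (t i)) = ln (real r) * real (Suc i)"
      using r3 unfolding t_def of_nat_power by (subst ln_realpow) (auto simp: mult.commute)
    then show ?thesis by (simp add: x_def)
  qed
  have "filterlim x at_top sequentially"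
    unfolding x_eq using \<delta> lnr by real_asymp
  then have "eventually (\<lambda>i. 1 \<le> x i) sequentially" by (simp only: filterlim_at_top)
  then obtain m where m: "\<And>i. m \<le> i \<Longrightarrow> 1 \<le> x i" by (auto simp: eventually_sequentially)
  have "AE \<omega> in M. \<exists>\<^sub>\<infinity>i. (1 - \<delta>) * c * (real (t i) * ln (ln (real (t i)))) < Z (t i) \<omega>"
  proof (rule permanental_infinitely_often[OF perm a V f potential_half_nonneg[OF f] t_mono t1, where m = m and x = x
        and \<eta> = "\<lambda>i. real (t i) / real r" and \<kappa> = "\<lambda>_. 1 / (c0 * real r)"])
    show "1 \<le> x i" if "m \<le> i" for i by (rule m[OF that])
    \<comment> \<open>For \<open>j < i\<close> the entry is at most \<open>t j\<close>, which the
      constant covers. For \<open>j > i\<close> it can have the size of \<open>t i\<close> itself,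
      too large for the constant, but it is at most \<open>t j / r\<close>, while the column of
      \<open>t N\<close> has grown to at least \<open>c0 * t j\<close>.\<close>
    show "green (t j) (t i) \<le> real (t i) / real r + 1 / (c0 * real r) * green (t j) (t N)"
      if "j \<le> N" "j \<noteq> i" for i j N
    proof (cases "j < i")
      case True
      have "green (t j) (t i) \<le> real (t j)" using green_le_min[of "t j" "t i"] by linarith
      also have "\<dots> \<le> real (t i) / real r" using t_step[OF True] r3 by (simp add: pos_le_divide_eq)
      finally show ?thesis using c0(1) green_nonneg[of "t j" "t N"] by (simp add: add_increasing2)
    next
      case False
      then have ij: "i < j" using that by simp
      have "min (t j) (t N) = t j" using that(1) t_mono by (simp add: strict_mono_less_eq)
      then have "c0 * real (t j) \<le> green (t j) (t N)" using c0(2)[of "t j" "t N"] by simp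
      then have "1 / (c0 * real r) * (c0 * real (t j)) \<le> 1 / (c0 * real r) * green (t j) (t N)"
        using c0(1) by (intro mult_left_mono) auto
      moreover have "1 / (c0 * real r) * (c0 * real (t j)) = real (t j) / real r" using c0(1) by simp
      moreover have "real (t i) \<le> real (t j) / real r" using t_step[OF ij] r3 by (simp add: pos_le_divide_eq)
      moreover have "green (t j) (t i) \<le> real (t i)" using green_le_min[of "t j" "t i"] by linarith
      moreover have "0 \<le> real (t i) / real r" by simp
      ultimately show ?thesis by linarith
    qed
    show "(1 - \<delta>) * c * (real (t i) * ln (ln (real (t i)))) \<le>
        x i * (green (t i) (t i) - real (t i) / real r - 1 / (c0 * real r) * green (t i) (t N))"
      if "m \<le> i" for i N
    proof -
      have x0: "0 \<le> x i" using m[OF that] by simp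
      then have l0: "0 \<le> ln (ln (real (t i)))" using \<delta> by (simp add: x_def zero_le_mult_iff)
      have "(1 - \<delta>) * (c * (real (t i) * ln (ln (real (t i))))) \<le>
          ((1 - \<delta> / 2) * (1 - \<delta> / 2)) * (c * (real (t i) * ln (ln (real (t i)))))"
      proof (rule mult_right_mono)
        show "1 - \<delta> \<le> (1 - \<delta> / 2) * (1 - \<delta> / 2)"
          using zero_le_square[of \<delta>] by (simp add: field_simps)
      qed (use l0 c in simp)
      also have "\<dots> = x i * ((1 - \<delta> / 2) * c * real (t i))" by (simp add: x_def)
      also have "\<dots> \<le> x i * (green (t i) (t i) - real (t i) / real r - 1 / (c0 * real r) * green (t i) (t N))"
      proof (rule mult_left_mono[OF _ x0])
        define y where "y = real (t i) / real r"
        have ty: "real (t i) = y * real r" using r3 by (simp add: y_def)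
        have y1: "1 \<le> y" using t_r[of i] r3 by (simp add: y_def)
        have "1 / (c0 * real r) * green (t i) (t N) \<le> 1 / (c0 * real r) * real (t i)"
          using green_le_min[of "t i" "t N"] c0(1) by (intro mult_left_mono) auto
        also have "\<dots> = y * (1 / c0)" by (simp add: y_def)
        finally have 1: "1 / (c0 * real r) * green (t i) (t N) \<le> y * (1 / c0)" .
        have 2: "c * real (t i) - C * y \<le> green (t i) (t i)"
          using C[of "t i"] mult_left_mono[OF y1 C0] by (simp add: c_def)
        have "y * ((C + 1 + 1 / c0) * 2) \<le> y * (real r * (\<delta> * c))"
          using rC y1 by (intro mult_left_mono) auto
        then have "C * y + y + y * (1 / c0) \<le> \<delta> / 2 * c * real (t i)"
          unfolding ty by (simp add: algebra_simps)
        then show "(1 - \<delta> / 2) * c * real (t i) \<le> green (t i) (t i) - real (t i) / real r - 1 / (c0 * real r) * green (t i) (t N)"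
          using 1 2 left_diff_distrib[of 1 "\<delta> / 2" "c * real (t i)"]
          unfolding y_def[symmetric] mult_1_left mult.assoc by linarith
      qed
      finally show ?thesis by (simp add: mult.assoc)
    qed
    show "\<not> summable (\<lambda>i. exp (- x i) / (x i + 1))"
      unfolding x_eq using \<delta> lnr by (intro not_summable_exp_neg_ln) auto
  qed (use c0 in auto)
  then show ?thesis using t_mono unfolding c_def by blast
qed

lemma permanental_limsup_critical:
  fixes Z :: "nat \<Rightarrow> 'b \<Rightarrow> real"
  assumes s: "(\<Sum>l=1..k. p l) = 1"
    and V: "\<And>i j. 1 \<le> i \<Longrightarrow> 1 \<le> j \<Longrightarrow> V i j = green i j"
    and h: "h \<in> l1_plus" and pot: "is_potential_of V h f"
    and perm: "permanental_sequence a (\<lambda>i j. V i j + f j) M Z" and a: "a > 0"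
  shows "AE \<omega> in M. limsup (\<lambda>j. ereal (Z j \<omega> / (real j * ln (ln (real j))))) = ereal (1 / \<mu>\<^sup>2)"
proof (rule AE_limsup_ratio)
  have h0: "\<And>n. 1 \<le> n \<Longrightarrow> 0 \<le> h n" using h by (simp add: l1_plus_def)
  obtain u where u: "potential_half u f" using potential_has_half[OF V h0 pot] by blast
  show D: "eventually (\<lambda>j. 0 < real j * ln (ln (real j))) sequentially" by real_asymp
  show "AE \<omega> in M. eventually (\<lambda>j. Z j \<omega> \<le> (1 / \<mu>\<^sup>2 + d) * (real j * ln (ln (real j)))) sequentially"
    if d: "0 < d" for d
  proof -
    \<comment> \<open>The constant of the chaining bound is continuous in \<open>\<epsilon>\<close>
      and equals \<open>1 / \<mu>\<^sup>2\<close> at 0, so some admissible \<open>\<epsilon>\<close>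
      brings it below \<open>1 / \<mu>\<^sup>2 + d\<close>.\<close>
    have "((\<lambda>\<epsilon>. exp (3 * \<epsilon>) * ((1 + \<epsilon>) * (1 / \<mu>\<^sup>2 + \<epsilon>) + 3 * \<epsilon>) * (1 + \<epsilon>)) \<longlongrightarrow>
        exp (3 * 0) * ((1 + 0) * (1 / \<mu>\<^sup>2 + 0) + 3 * 0) * (1 + 0)) (at_right 0)"
      by (intro tendsto_intros)
    then have "((\<lambda>\<epsilon>. exp (3 * \<epsilon>) * ((1 + \<epsilon>) * (1 / \<mu>\<^sup>2 + \<epsilon>) + 3 * \<epsilon>) * (1 + \<epsilon>)) \<longlongrightarrow> 1 / \<mu>\<^sup>2) (at_right 0)"
      by simp
    then have "eventually (\<lambda>\<epsilon>. exp (3 * \<epsilon>) * ((1 + \<epsilon>) * (1 / \<mu>\<^sup>2 + \<epsilon>) + 3 * \<epsilon>) * (1 + \<epsilon>) < 1 / \<mu>\<^sup>2 + d) (at_right 0)"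
      by (rule order_tendstoD) (use d in simp)
    moreover have "eventually (\<lambda>\<epsilon>::real. 0 < \<epsilon> \<and> \<epsilon> < 1) (at_right 0)"
      by (auto simp: eventually_at_right[of 0 1] intro!: exI[of _ 1])
    ultimately have "eventually (\<lambda>\<epsilon>. (0 < \<epsilon> \<and> \<epsilon> < 1) \<and>
        exp (3 * \<epsilon>) * ((1 + \<epsilon>) * (1 / \<mu>\<^sup>2 + \<epsilon>) + 3 * \<epsilon>) * (1 + \<epsilon>) < 1 / \<mu>\<^sup>2 + d) (at_right 0)"
      by eventually_elim simp
    then obtain \<epsilon> where \<epsilon>: "0 < \<epsilon>" "\<epsilon> \<le> 1"
      "exp (3 * \<epsilon>) * ((1 + \<epsilon>) * (1 / \<mu>\<^sup>2 + \<epsilon>) + 3 * \<epsilon>) * (1 + \<epsilon>) \<le> 1 / \<mu>\<^sup>2 + d"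
      using eventually_happens'[of "at_right (0::real)"] by (metis (no_types, lifting) less_imp_le trivial_limit_at_right_real)
    have "AE \<omega> in M. eventually (\<lambda>j. Z j \<omega> \<le>
        exp (3 * \<epsilon>) * ((1 + \<epsilon>) * (1 / \<mu>\<^sup>2 + \<epsilon>) + 3 * \<epsilon>) * (1 + \<epsilon>) * (real j * ln (ln (real j)))) sequentially"
      by (rule permanental_upper_critical[OF s V h pot potential_half_nonneg[OF u] perm a \<epsilon>(1,2)])
    then show ?thesis
    proof eventually_elim
      case (elim \<omega>)
      from elim D show ?case
      proof eventually_elim
        case (elim j)
        note elim(1)
        also have "exp (3 * \<epsilon>) * ((1 + \<epsilon>) * (1 / \<mu>\<^sup>2 + \<epsilon>) + 3 * \<epsilon>) * (1 + \<epsilon>) * (real j * ln (ln (real j))) \<le>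
            (1 / \<mu>\<^sup>2 + d) * (real j * ln (ln (real j)))"
          using \<epsilon>(3) elim(2) by (intro mult_right_mono) auto
        finally show ?case .
      qed
    qed
  qed
  show "\<exists>t::nat \<Rightarrow> nat. strict_mono t \<and>
      (AE \<omega> in M. \<exists>\<^sub>\<infinity>i. (1 - \<delta>) * (1 / \<mu>\<^sup>2) * (real (t i) * ln (ln (real (t i)))) < Z (t i) \<omega>)"
    if "0 < \<delta>" "\<delta> < 1" for \<delta>
    by (rule permanental_lower_critical[OF s V u perm a that])
qed

end

theorem theorem1p9:
  fixes k :: nat and p :: "nat \<Rightarrow> real"
    and N :: "'a measure" and g :: "nat \<Rightarrow> 'a \<Rightarrow> real" and \<xi> :: "int \<Rightarrow> 'a \<Rightarrow> real"
    and V :: "nat \<Rightarrow> nat \<Rightarrow> real"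
    and pt :: "real \<Rightarrow> nat \<Rightarrow> nat \<Rightarrow> real"
    and f :: "nat \<Rightarrow> real"
  assumes k: "2 \<le> k"
    and p_decreasing: "\<And>i j. 1 \<le> i \<Longrightarrow> i \<le> j \<Longrightarrow> j \<le> k \<Longrightarrow> p j \<le> p i"
    and p_pos: "0 < p k"
    and p_sum: "(\<Sum>l=1..k. p l) \<le> 1"
    and g: "iid_std_normal N g"
    and \<xi>: "autoregressive k p N g \<xi>"
    and V: "\<And>m n. 1 \<le> m \<Longrightarrow> 1 \<le> n \<Longrightarrow> V m n = covariance N (\<xi> (int m)) (\<xi> (int n))"
    and Y_chain: "transition_function pt" "symmetric_chain pt"
    and Y_Q_matrix: "has_Q_matrix pt (\<lambda>m n. - A_matrix k p m n)"
    and Y_potential: "has_potential_density pt V"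
    and f: "excessive pt f"
  shows
    "((\<Sum>l=1..k. p l) < 1 \<and> f \<in> c0_plus \<longrightarrow>
       (\<exists>c::real.
          1 + (p 1)\<^sup>2 \<le> c \<and> c \<le> 1 / (1 - (\<Sum>l=1..k. p l)\<^sup>2) \<and>
          complex_of_real c = c_star k p \<and>
          (\<forall>\<alpha>>0. \<forall>(M :: 'b measure) Z.
             permanental_sequence \<alpha> (\<lambda>i j. V i j + f j) M Z \<longrightarrow>
             (AE \<omega> in M. limsup (\<lambda>j. ereal (Z j \<omega> / ln (real j))) = ereal c))))
     \<and>
     ((\<Sum>l=1..k. p l) = 1 \<and> (\<exists>h\<in>l1_plus. is_potential_of V h f) \<longrightarrow>
       (\<forall>\<alpha>\<ge>1/2. \<forall>(M :: 'b measure) Z.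
          permanental_sequence \<alpha> (\<lambda>i j. V i j + f j) M Z \<longrightarrow>
          (AE \<omega> in M. limsup (\<lambda>j. ereal (Z j \<omega> / (real j * ln (ln (real j))))) =
             ereal (1 / (\<Sum>l=1..k. real l * p l)\<^sup>2))))
     \<and>
     ((\<Sum>l=1..k. p l) < 1 \<longrightarrow>
       (f \<in> c0_plus \<longleftrightarrow> (\<exists>h\<in>c0_plus. is_potential_of V h f)))"
proof -
  interpret autoregression k p
    by (rule autoregression.intro) (use k p_decreasing p_pos p_sum in auto)
  have Vg: "V i j = green i j" if "1 \<le> i" "1 \<le> j" for i j
    using V[OF that] covariance_autoregressive[OF g \<xi>] by simp
  have equiv: "f \<in> c0_plus \<longleftrightarrow> (\<exists>h\<in>c0_plus. is_potential_of V h f)" if "(\<Sum>l=1..k. p l) < 1"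
    using excessive_is_potential[OF that Vg Y_chain(1) Y_Q_matrix f] potential_tendsto_0[OF that Vg] by blast
  show ?thesis
  proof (intro conjI impI)
    assume s: "(\<Sum>l=1..k. p l) < 1 \<and> f \<in> c0_plus"
    \<comment> \<open>Membership of \<open>f\<close> in \<open>c0_plus\<close> is turned into a
      representation as a potential, which supplies the half \<open>u\<close> on which the lower
      bound rests.\<close>
    then obtain h where h: "h \<in> c0_plus" "is_potential_of V h f" using equiv by blast
    have h0: "\<And>n. 1 \<le> n \<Longrightarrow> 0 \<le> h n" using h(1) by (simp add: c0_plus_def)
    obtain u where u: "potential_half u f" using potential_has_half[OF Vg h0 h(2)] by blast
    have "AE \<omega> in M. limsup (\<lambda>j. ereal (Z j \<omega> / ln (real j))) = ereal (\<Sum>n. (\<phi> n)\<^sup>2)"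
      if "0 < \<alpha>" "permanental_sequence \<alpha> (\<lambda>i j. V i j + f j) M Z" for \<alpha> and M :: "'b measure" and Z
      using s permanental_limsup_subcritical[OF _ Vg _ u that(2,1)] by blast
    then show "\<exists>c::real. 1 + (p 1)\<^sup>2 \<le> c \<and> c \<le> 1 / (1 - (\<Sum>l=1..k. p l)\<^sup>2) \<and>
          complex_of_real c = c_star k p \<and>
          (\<forall>\<alpha>>0. \<forall>(M :: 'b measure) Z.
             permanental_sequence \<alpha> (\<lambda>i j. V i j + f j) M Z \<longrightarrow>
             (AE \<omega> in M. limsup (\<lambda>j. ereal (Z j \<omega> / ln (real j))) = ereal c))"
      using s \<phi>_square_norm_bounds c_star_eq by (intro exI[of _ "\<Sum>n. (\<phi> n)\<^sup>2"]) auto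
  next
    assume s: "(\<Sum>l=1..k. p l) = 1 \<and> (\<exists>h\<in>l1_plus. is_potential_of V h f)"
    then obtain h where h: "h \<in> l1_plus" "is_potential_of V h f" by blast
    have "AE \<omega> in M. limsup (\<lambda>j. ereal (Z j \<omega> / (real j * ln (ln (real j))))) =
             ereal (1 / (\<Sum>l=1..k. real l * p l)\<^sup>2)"
      if "1 / 2 \<le> \<alpha>" "permanental_sequence \<alpha> (\<lambda>i j. V i j + f j) M Z" for \<alpha> and M :: "'b measure" and Z
      using permanental_limsup_critical[OF conjunct1[OF s] Vg h that(2)] that(1) unfolding \<mu>_def by simp
    then show "\<forall>\<alpha>\<ge>1/2. \<forall>(M :: 'b measure) Z.
          permanental_sequence \<alpha> (\<lambda>i j. V i j + f j) M Z \<longrightarrow>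
          (AE \<omega> in M. limsup (\<lambda>j. ereal (Z j \<omega> / (real j * ln (ln (real j))))) =
             ereal (1 / (\<Sum>l=1..k. real l * p l)\<^sup>2))"
      by blast
  qed (use equiv in blast)+
qed

end
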